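(* Let $F$ be a field and $F * A_1$, $F * A_2$ twisted group algebras of finitely generated free abelian groups $A_1,A_2$ over $F$ such that, for each $i\in\{1,2\}$: $\mathrm{codim}(F * A_i)\ge2$, $\dim(F * A_i)\ge2$, and $F * A_i$ has center $F$. Let $d=\dim(F * A_1\otimes_F F * A_2)$. Then $$d<\min\{\dim(F * A_1)+\mathrm{rk}(A_2),\ \dim(F * A_2)+\mathrm{rk}(A_1)\}-1.$$
   Context: A twisted group algebra $F * A$ is an $F$-algebra with $F$-basis $\{\bar a: a\in A\}$ and $\bar a_1\bar a_2=\tau(a_1,a_2)\overline{a_1a_2}$, $\tau$ a 2-cocycle with values in $F\setminus\{0\}$. The tensor product is a twisted group algebra of $A_1\times A_2$. $\dim$ denotes the Krull dimension, which for these algebras coincides with the global dimension; $\mathrm{rk}$ is the rank and $\mathrm{codim}(F * A)=\mathrm{rk}(A)-\dim(F * A)$. *)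

theory Defs
  imports Main "HOL-Library.Extended_Nat" "HOL-Library.Product_Plus"
begin

definition zsc :: "int \<Rightarrow> 'a::ab_group_add \<Rightarrow> 'a" where
  "zsc k a = (if 0 \<le> k then (((+) a) ^^ nat k) 0 else - ((((+) a) ^^ nat (- k)) 0))"

definition ab_basis :: "'a::ab_group_add list \<Rightarrow> bool" where
  "ab_basis bs \<longleftrightarrow>
     (\<forall>a. \<exists>!c::int list. length c = length bs \<and> a = (\<Sum>i<length bs. zsc (c ! i) (bs ! i)))"

definition free_fg_ab :: "'a::ab_group_add itself \<Rightarrow> bool" where
  "free_fg_ab _ \<longleftrightarrow> (\<exists>bs::'a list. ab_basis bs)"

definition grk :: "'a::ab_group_add itself \<Rightarrow> nat" where
  "grk _ = length (SOME bs::'a list. ab_basis bs)"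

definition two_cocycle :: "('a::ab_group_add \<Rightarrow> 'a \<Rightarrow> 'f::field) \<Rightarrow> bool" where
  "two_cocycle \<tau> \<longleftrightarrow> (\<forall>a b. \<tau> a b \<noteq> 0) \<and>
     (\<forall>a b c. \<tau> a b * \<tau> (a + b) c = \<tau> b c * \<tau> a (b + c))"

(* twisted group algebra F * A: finitely supported functions A \<Rightarrow> F,
   x = \<Sum> x(a) \<bar>a, with \<bar>a \<bar>b = \<tau>(a,b) \<bar>(a+b) *)
definition tga_carrier :: "('a \<Rightarrow> 'f::zero) set" where
  "tga_carrier = {x. finite {a. x a \<noteq> 0}}"

definition tga_mult :: "('a::ab_group_add \<Rightarrow> 'a \<Rightarrow> 'f::field) \<Rightarrow> ('a \<Rightarrow> 'f) \<Rightarrow> ('a \<Rightarrow> 'f) \<Rightarrow> ('a \<Rightarrow> 'f)" where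
  "tga_mult \<tau> x y = (\<lambda>c. \<Sum>a\<in>{a. x a \<noteq> 0}. x a * y (c - a) * \<tau> a (c - a))"

definition tga_right_ideals :: "('a::ab_group_add \<Rightarrow> 'a \<Rightarrow> 'f::field) \<Rightarrow> ('a \<Rightarrow> 'f) set set" where
  "tga_right_ideals \<tau> = {I. I \<subseteq> tga_carrier \<and> (\<lambda>_. 0) \<in> I \<and>
      (\<forall>x\<in>I. \<forall>y\<in>I. (\<lambda>c. x c + y c) \<in> I) \<and>
      (\<forall>x\<in>I. \<forall>r\<in>tga_carrier. tga_mult \<tau> x r \<in> I)}"

(* Gabriel-Rentschler deviation of the interval [J, I] of the poset S (ordered by inclusion):
   devle n S J I  means  dev [J,I] \<le> n  (deviation -\<infinity> allowed). *)
fun devle :: "nat \<Rightarrow> 'b set set \<Rightarrow> 'b set \<Rightarrow> 'b set \<Rightarrow> bool" where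
  "devle 0 S J I = (\<forall>K. (\<forall>i. K i \<in> S \<and> J \<subseteq> K i \<and> K i \<subseteq> I \<and> K (Suc i) \<subseteq> K i)
        \<longrightarrow> (\<exists>m. \<forall>i\<ge>m. K (Suc i) = K i))"
| "devle (Suc n) S J I = (\<forall>K. (\<forall>i. K i \<in> S \<and> J \<subseteq> K i \<and> K i \<subseteq> I \<and> K (Suc i) \<subseteq> K i)
        \<longrightarrow> (\<exists>m. \<forall>i\<ge>m. devle n S (K (Suc i)) (K i)))"

definition kdim :: "'b set set \<Rightarrow> 'b set \<Rightarrow> 'b set \<Rightarrow> enat" where
  "kdim S J I = (if \<exists>n. devle n S J I then enat (LEAST n. devle n S J I) else \<infinity>)"

definition tga_kdim :: "('a::ab_group_add \<Rightarrow> 'a \<Rightarrow> 'f::field) \<Rightarrow> enat" where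
  "tga_kdim \<tau> = kdim (tga_right_ideals \<tau>) {\<lambda>_. 0} tga_carrier"

definition tga_codim :: "'a::ab_group_add itself \<Rightarrow> ('a \<Rightarrow> 'a \<Rightarrow> 'f::field) \<Rightarrow> enat" where
  "tga_codim A \<tau> = enat (grk A) - tga_kdim \<tau>"

definition tga_center :: "('a::ab_group_add \<Rightarrow> 'a \<Rightarrow> 'f::field) \<Rightarrow> ('a \<Rightarrow> 'f) set" where
  "tga_center \<tau> = {x\<in>tga_carrier. \<forall>y\<in>tga_carrier. tga_mult \<tau> x y = tga_mult \<tau> y x}"

definition center_is_F :: "('a::ab_group_add \<Rightarrow> 'a \<Rightarrow> 'f::field) \<Rightarrow> bool" where
  "center_is_F \<tau> \<longleftrightarrow> tga_center \<tau> = {x\<in>tga_carrier. \<forall>a. a \<noteq> 0 \<longrightarrow> x a = 0}"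

(* cocycle of F*A1 \<otimes>_F F*A2 as a twisted group algebra of A1 \<times> A2 *)
definition tensor_cocycle :: "('a::ab_group_add \<Rightarrow> 'a \<Rightarrow> 'f::field) \<Rightarrow> ('b::ab_group_add \<Rightarrow> 'b \<Rightarrow> 'f)
    \<Rightarrow> ('a \<times> 'b) \<Rightarrow> ('a \<times> 'b) \<Rightarrow> 'f" where
  "tensor_cocycle \<tau>1 \<tau>2 = (\<lambda>(a1, a2) (b1, b2). \<tau>1 a1 b1 * \<tau>2 a2 b2)"

end

theory Submission
  imports Defs Complex_Main "HOL-Library.FuncSet"
begin

text \<open>
  The Krull dimension of \<open>F * A\<close> equals the largest rank of an isotropic subgroup of \<open>A\<close>, that is,
  of a subgroup on which the commutator form of the cocycle is trivial.

  For the upper bound, degenerate a proper right ideal \<open>I\<close> to its ideal of leading forms with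
  respect to a real linear form on \<open>A\<close>.  A form for which the degeneration stays proper exists as
  long as \<open>F * A / I\<close> has infinite dimension: take a limit direction of the monomials that cannot
  be reduced modulo \<open>I\<close> to combinations of shorter ones.  After finitely many steps the quotient has
  finite dimension, and then the annihilator of the quotient forces some multiple of every element
  into the radical of the commutator form.  Hence every proper right ideal meets \<open>F * C\<close> trivially
  for a coordinate subgroup \<open>C\<close> of rank at least \<open>n - d\<close>, where \<open>n = rk A\<close> and \<open>d\<close> is the largest
  isotropic rank.  In terms of leading exponents in the positive orthant, every nonzero subquotient
  therefore contains a translate of an \<open>(n - d)\<close>-dimensional coordinate cone, and Dickson's lemma
  bounds the deviation by \<open>d\<close>.  For the lower bound, commuting independent elements \<open>x\<close> give the
  ideals spanned by monomials in the \<open>x - 1\<close>, which are told apart by Taylor coefficients at 1.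

  It remains to bound the rank of an isotropic subgroup \<open>B\<close> of the product.  If
  \<open>rk B > dim (F * A1) + rk A2 - 2\<close>, then \<open>B\<close> projects onto a subgroup of \<open>A2\<close> of corank at most 1.
  In either case one can enlarge \<open>B \<inter> A1\<close>, by elements of \<open>B\<close> lying over an isotropic subgroup of
  \<open>A2\<close>, to an isotropic subgroup of \<open>A1\<close> that is too large: corank 0 uses that the centre of
  \<open>F * A2\<close> is \<open>F\<close> and that its dimension is at least 2, corank 1 uses that its codimension is at
  least 2.
\<close>

text \<open>The upper bound rests on linear algebra, since nothing commutes. If \<open>x\<close>
  represents a nonzero class of \<open>I / J\<close>, its annihilator is a proper right ideal, so
  the products of \<open>x\<close> with the monomials of a box in \<open>C\<close> stay independent
  modulo \<open>J\<close>. Their number grows like \<open>t ^ h\<close>, with \<open>h\<close> the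
  rank of \<open>C\<close>, whereas a set of leading exponents without an
  \<open>h\<close>-dimensional cone has growth of degree at most \<open>h - 1\<close>. The linear
  form used for degeneration has real values because a limit of integral directions may be
  irrational; its kernel still has strictly smaller rank. For the lower bound, the right ideals are
  cut out by functionals rather than given by generators: a condition imposed on all right
  translates defines a right ideal, and strictness of an inclusion is tested on one explicit
  element.\<close>

lemma exists_nontrivial_relation:
  fixes v :: "'i \<Rightarrow> 'q \<Rightarrow> 'r::idom"
  assumes "finite Q" "finite P" "card Q < card P"
  shows "\<exists>c. (\<exists>i\<in>P. c i \<noteq> 0) \<and> (\<forall>q\<in>Q. (\<Sum>i\<in>P. c i * v i q) = 0)"
  using assms
proof (induction Q arbitrary: P v rule: finite_induct)
  case empty
  then have "P \<noteq> {}" by auto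
  then show ?case by (intro exI[of _ "\<lambda>_. 1"]) auto
next
  case (insert q Q)
  show ?case
  proof (cases "\<forall>i\<in>P. v i q = 0")
    case True
    have "card Q < card P" using insert by simp
    from insert.IH[OF insert.prems(1) this, of v] obtain c where
      "(\<exists>i\<in>P. c i \<noteq> 0)" "(\<forall>q\<in>Q. (\<Sum>i\<in>P. c i * v i q) = 0)" by blast
    then show ?thesis using True by (intro exI[of _ c]) auto
  next
    case False
    then obtain p where p: "p \<in> P" "v p q \<noteq> 0" by blast
    \<comment> \<open>Cross-multiplication replaces the division of Gaussian elimination, as the
      coefficients only form an integral domain: the lemma is applied to integers as well as to
      field elements.\<close>
    define w where "w i r = v p q * v i r - v i q * v p r" for i r
    have "card Q < card (P - {p})" using insert p by simp
    from insert.IH[OF _ this, of w] insert.prems(1) obtain c where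
      c: "\<exists>i\<in>P - {p}. c i \<noteq> 0" "\<forall>r\<in>Q. (\<Sum>i\<in>P - {p}. c i * w i r) = 0" by blast
    define e where "e i = (if i = p then - (\<Sum>i\<in>P - {p}. c i * v i q) else v p q * c i)" for i
    have split: "(\<Sum>i\<in>P. e i * v i r) = (\<Sum>i\<in>P - {p}. c i * w i r)" for r
    proof -
      have "(\<Sum>i\<in>P. e i * v i r) = e p * v p r + (\<Sum>i\<in>P - {p}. e i * v i r)"
        using insert.prems(1) p by (simp add: sum.remove)
      also have "(\<Sum>i\<in>P - {p}. e i * v i r) = (\<Sum>i\<in>P - {p}. v p q * c i * v i r)"
        by (intro sum.cong) (auto simp: e_def)
      also have "e p * v p r = - (\<Sum>i\<in>P - {p}. c i * v i q * v p r)"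
        by (simp add: e_def sum_distrib_right)
      finally show ?thesis
        by (simp add: w_def algebra_simps sum_subtractf)
    qed
    have "w i q = 0" for i by (simp add: w_def)
    then have "\<forall>r\<in>insert q Q. (\<Sum>i\<in>P. e i * v i r) = 0" using c split by auto
    moreover have "\<exists>i\<in>P. e i \<noteq> 0" using c(1) p by (auto simp: e_def)
    ultimately show ?thesis by blast
  qed
qed

subsection \<open>Independence in abelian groups\<close>

lemma zsc_0 [simp]: "zsc 0 a = 0" by (simp add: zsc_def)

lemma zsc_Suc: "zsc (k + 1) a = a + zsc k a"
proof -
  consider "0 \<le> k" | "k = -1" | "k < -1" by linarith
  then show ?thesis
  proof cases
    case 1
    then have "nat (k + 1) = Suc (nat k)" by simp
    then show ?thesis using 1 by (simp add: zsc_def)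
  next
    case 2
    then show ?thesis by (simp add: zsc_def)
  next
    case 3
    then have "nat (- k) = Suc (nat (- (k + 1)))" by simp
    then show ?thesis using 3 by (simp add: zsc_def)
  qed
qed

lemma zsc_1 [simp]: "zsc 1 a = a" using zsc_Suc[of 0 a] by simp

text \<open>\<open>zsc\<close> is an iteration with a case split on the sign; uniqueness for this
  recursion, run in both directions of the integers, spares later identities that split.\<close>

lemma additive_zsc_unique:
  assumes "f 0 = 0" "\<And>k. f (k + 1) = a + f k"
  shows "f k = zsc k a"
proof (induction k rule: int_induct[where k = 0])
  case (step2 i)
  then show ?case using assms(2)[of "i - 1"] zsc_Suc[of "i - 1" a] by simp
qed (use assms zsc_Suc[of _ a] in auto)

lemma zsc_add: "zsc (k + l) a = zsc k a + zsc l a"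
proof -
  have "zsc (k + l) a - zsc l a = zsc k a"
    by (rule additive_zsc_unique) (use zsc_Suc[of "_ + l" a] in \<open>simp_all add: algebra_simps\<close>)
  then show ?thesis by (simp add: algebra_simps)
qed

lemma zsc_minus: "zsc (- k) a = - zsc k a"
  using zsc_add[of "- k" k a] by (simp add: eq_neg_iff_add_eq_0)

lemma zsc_diff: "zsc (k - l) a = zsc k a - zsc l a"
  using zsc_add[of k "- l" a] by (simp add: zsc_minus)

lemma zsc_zero_right [simp]: "zsc k 0 = 0"
  by (rule additive_zsc_unique[symmetric, where f = "\<lambda>_. 0"]) auto

lemma zsc_zsc: "zsc (k * l) a = zsc k (zsc l a)"
  by (rule additive_zsc_unique) (auto simp: algebra_simps zsc_add)

lemma additive_zsc:
  assumes "\<And>x y. f (x + y) = f x + f y"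
  shows "f (zsc k a) = zsc k (f a)"
proof (rule additive_zsc_unique)
  show "f (zsc 0 a) = 0" using assms[of 0 0] by simp
qed (simp add: zsc_Suc assms)

lemma zsc_add_right: "zsc k (a + b) = zsc k a + zsc k b"
  by (rule additive_zsc_unique[symmetric]) (auto simp: zsc_Suc)

lemma zsc_sum: "zsc k (\<Sum>x\<in>X. f x) = (\<Sum>x\<in>X. zsc k (f x))"
  by (induction X rule: infinite_finite_induct) (auto simp: zsc_add_right)

lemma sum_zsc: "zsc (\<Sum>x\<in>X. c x) a = (\<Sum>x\<in>X. zsc (c x) a)"
  by (induction X rule: infinite_finite_induct) (auto simp: zsc_add)

lemma zsc_int [simp]: "zsc k (a::int) = k * a"
  by (rule additive_zsc_unique[symmetric]) (auto simp: algebra_simps)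

lemma zsc_prod: "zsc k (a, b) = (zsc k a, zsc k b)"
  by (rule additive_zsc_unique[symmetric]) (auto simp: zsc_Suc zero_prod_def)

definition indep :: "'a::ab_group_add set \<Rightarrow> bool" where
  "indep X \<longleftrightarrow> finite X \<and> (\<forall>c. (\<Sum>x\<in>X. zsc (c x) x) = 0 \<longrightarrow> (\<forall>x\<in>X. c x = 0))"

definition zspan :: "'a::ab_group_add set \<Rightarrow> 'a set" where
  "zspan X = range (\<lambda>c. \<Sum>x\<in>X. zsc (c x) x)"

text \<open>Integral stand-in for the rational span: a maximal independent set need not generate the
  group, but its isolator is everything.\<close>

definition isolator :: "'a::ab_group_add set \<Rightarrow> 'a set" where
  "isolator X = {g. \<exists>m. m \<noteq> 0 \<and> zsc m g \<in> zspan X}"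

lemma indep_empty [simp]: "indep {}" by (simp add: indep_def)

lemma indepD: "indep X \<Longrightarrow> (\<Sum>x\<in>X. zsc (c x) x) = 0 \<Longrightarrow> x \<in> X \<Longrightarrow> c x = 0"
  unfolding indep_def by blast

lemma zspan_add: "x \<in> zspan X \<Longrightarrow> y \<in> zspan X \<Longrightarrow> x + y \<in> zspan X"
proof -
  assume "x \<in> zspan X" "y \<in> zspan X"
  then obtain c d where "x = (\<Sum>x\<in>X. zsc (c x) x)" "y = (\<Sum>x\<in>X. zsc (d x) x)"
    by (auto simp: zspan_def)
  then have "x + y = (\<Sum>x\<in>X. zsc (c x + d x) x)" by (simp add: zsc_add sum.distrib)
  then show ?thesis by (auto simp: zspan_def)
qed

lemma zspan_zsc: "x \<in> zspan X \<Longrightarrow> zsc k x \<in> zspan X"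
proof -
  assume "x \<in> zspan X"
  then obtain c where "x = (\<Sum>x\<in>X. zsc (c x) x)" by (auto simp: zspan_def)
  then have "zsc k x = (\<Sum>x\<in>X. zsc (k * c x) x)" by (simp add: zsc_zsc zsc_sum)
  then show ?thesis by (auto simp: zspan_def)
qed

lemma zspan_base: "finite X \<Longrightarrow> x \<in> X \<Longrightarrow> x \<in> zspan X"
proof -
  assume "finite X" "x \<in> X"
  then have "(\<Sum>y\<in>X. zsc (if y = x then 1 else 0) y) = x"
    by (subst sum.remove[of _ x]) (auto intro!: sum.neutral)
  then show ?thesis unfolding zspan_def
    by (intro range_eqI[of _ _ "\<lambda>y. if y = x then 1 else 0"]) simp
qed

lemma zspan_zero [simp]: "0 \<in> zspan X"
  unfolding zspan_def by (rule range_eqI[of _ _ "\<lambda>_. 0"]) simp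

lemma zspan_minimal:
  assumes "x \<in> zspan X" "X \<subseteq> H" "0 \<in> H" "\<And>x y. x \<in> H \<Longrightarrow> y \<in> H \<Longrightarrow> x + y \<in> H"
    "\<And>k x. x \<in> H \<Longrightarrow> zsc k x \<in> H"
  shows "x \<in> H"
proof -
  have "(\<Sum>x\<in>Y. zsc (c x) x) \<in> H" if "Y \<subseteq> H" for c Y
    using that by (induction Y rule: infinite_finite_induct) (auto intro: assms)
  then show ?thesis using assms(1,2) by (auto simp: zspan_def)
qed

lemma zspan_mono: "finite Y \<Longrightarrow> X \<subseteq> Y \<Longrightarrow> zspan X \<subseteq> zspan Y"
  by (rule subsetI, erule zspan_minimal) (auto intro: zspan_add zspan_zsc zspan_base)

lemma isolator_base: "finite X \<Longrightarrow> x \<in> X \<Longrightarrow> x \<in> isolator X"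
  by (auto simp: isolator_def intro!: exI[of _ 1] zspan_base)

text \<open>Multiples of the \<open>y\<close> are combinations of fewer \<open>x\<close>, so their
  coefficient rows satisfy an integral relation \<open>l\<close>; weighting it by the multipliers
  \<open>m y\<close> gives a relation among the \<open>y\<close> themselves.\<close>

lemma indep_card_le:
  assumes Y: "indep Y" and X: "finite X" and sub: "Y \<subseteq> isolator X"
  shows "card Y \<le> card X"
proof (rule ccontr)
  assume "\<not> ?thesis"
  have "\<forall>y\<in>Y. \<exists>m c. m \<noteq> 0 \<and> zsc m y = (\<Sum>x\<in>X. zsc (c x) x)"
  proof
    fix y assume "y \<in> Y"
    then obtain m where "m \<noteq> 0" "zsc m y \<in> zspan X" using sub by (auto simp: isolator_def)
    then show "\<exists>m c. m \<noteq> 0 \<and> zsc m y = (\<Sum>x\<in>X. zsc (c x) x)" by (auto simp: zspan_def)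
  qed
  then obtain m c where mc: "\<And>y. y \<in> Y \<Longrightarrow> m y \<noteq> (0::int)"
    "\<And>y. y \<in> Y \<Longrightarrow> zsc (m y) y = (\<Sum>x\<in>X. zsc (c y x) x)" by metis
  from exists_nontrivial_relation[of X Y c] X Y \<open>\<not> ?thesis\<close> obtain l where
    l: "\<exists>y\<in>Y. l y \<noteq> 0" "\<forall>x\<in>X. (\<Sum>y\<in>Y. l y * c y x) = 0" by (auto simp: indep_def)
  have "(\<Sum>y\<in>Y. zsc (l y * m y) y) = (\<Sum>y\<in>Y. zsc (l y) (\<Sum>x\<in>X. zsc (c y x) x))"
    by (intro sum.cong) (auto simp: zsc_zsc mc)
  also have "\<dots> = (\<Sum>x\<in>X. \<Sum>y\<in>Y. zsc (l y * c y x) x)"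
    by (subst sum.swap) (simp add: zsc_sum zsc_zsc)
  also have "\<dots> = (\<Sum>x\<in>X. zsc (\<Sum>y\<in>Y. l y * c y x) x)" by (simp add: sum_zsc)
  also have "\<dots> = 0" using l(2) by (simp add: sum.neutral)
  finally have "\<forall>y\<in>Y. l y * m y = 0" using indepD[OF Y, of "\<lambda>y. l y * m y"] by blast
  then show False using l(1) mc(1) by auto
qed

lemma indep_insert:
  assumes X: "indep X" and g: "g \<notin> isolator X"
  shows "indep (insert g X)" "g \<notin> X"
proof -
  show gX: "g \<notin> X" using g X isolator_base by (auto simp: indep_def)
  have fin: "finite X" using X by (simp add: indep_def)
  have "c x = 0" if c: "(\<Sum>x\<in>insert g X. zsc (c x) x) = 0" and x: "x \<in> insert g X" for c x
  proof -
    have s: "zsc (c g) g + (\<Sum>x\<in>X. zsc (c x) x) = 0" using c gX fin by simp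
    have "c g = 0"
    proof (rule ccontr)
      assume "c g \<noteq> 0"
      have "(\<Sum>x\<in>X. zsc (- c x) x) \<in> zspan X" by (auto simp: zspan_def)
      moreover have "zsc (c g) g = (\<Sum>x\<in>X. zsc (- c x) x)"
        using s by (simp add: zsc_minus sum_negf eq_neg_iff_add_eq_0)
      ultimately show False using g \<open>c g \<noteq> 0\<close> by (auto simp: isolator_def)
    qed
    then have "(\<Sum>x\<in>X. zsc (c x) x) = 0" using s by simp
    then show ?thesis using x \<open>c g = 0\<close> indepD[OF X] by blast
  qed
  then show "indep (insert g X)" using fin by (auto simp: indep_def)
qed

lemma indep_extend:
  assumes "indep X" "X \<subseteq> H" and bd: "\<And>Z. indep Z \<Longrightarrow> Z \<subseteq> H \<Longrightarrow> card Z \<le> N"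
  shows "\<exists>Z. X \<subseteq> Z \<and> Z \<subseteq> H \<and> indep Z \<and> H \<subseteq> isolator Z"
  using assms(1,2)
proof (induction "N - card X" arbitrary: X rule: less_induct)
  case less
  show ?case
  proof (cases "H \<subseteq> isolator X")
    case True
    then show ?thesis using less.prems by blast
  next
    case False
    then obtain g where g: "g \<in> H" "g \<notin> isolator X" by blast
    have i: "indep (insert g X)" "g \<notin> X" using indep_insert[OF less.prems(1) g(2)] by auto
    have c: "card (insert g X) = Suc (card X)" using i less.prems by (simp add: indep_def)
    have "card (insert g X) \<le> N" using bd[OF i(1)] g less.prems by auto
    then have "N - card (insert g X) < N - card X" using c by linarith
    from less.hyps[OF this i(1)] g less.prems show ?thesis by auto
  qed
qed

lemma indep_subset: "indep X \<Longrightarrow> Y \<subseteq> X \<Longrightarrow> indep Y"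
proof -
  assume X: "indep X" and Y: "Y \<subseteq> X"
  have fin: "finite X" "finite Y" using X Y finite_subset by (auto simp: indep_def)
  have "\<forall>y\<in>Y. c y = 0" if "(\<Sum>y\<in>Y. zsc (c y) y) = 0" for c
  proof -
    have "(\<Sum>x\<in>X. zsc (if x \<in> Y then c x else 0) x) = (\<Sum>y\<in>Y. zsc (c y) y)"
      using Y fin by (intro sum.mono_neutral_cong_right) auto
    then have "(if x \<in> Y then c x else 0) = 0" if "x \<in> X" for x
      using indepD[OF X _ that, of "\<lambda>x. if x \<in> Y then c x else 0"] \<open>(\<Sum>y\<in>Y. zsc (c y) y) = 0\<close> by simp
    then show ?thesis using Y by (metis subsetD)
  qed
  then show ?thesis using fin by (auto simp: indep_def)
qed

subsection \<open>Right ideals of twisted group algebras\<close>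

abbreviation supp :: "('a \<Rightarrow> 'f::zero) \<Rightarrow> 'a set" where
  "supp f \<equiv> {a. f a \<noteq> 0}"

definition single :: "'a \<Rightarrow> 'a \<Rightarrow> 'f::field" where
  "single a = (\<lambda>c. if c = a then 1 else 0)"

definition subgrp :: "'a::ab_group_add set \<Rightarrow> bool" where
  "subgrp A \<longleftrightarrow> 0 \<in> A \<and> (\<forall>a\<in>A. \<forall>b\<in>A. a - b \<in> A)"

lemma subgrp_zero: "subgrp A \<Longrightarrow> 0 \<in> A" by (simp add: subgrp_def)

lemma subgrp_diff: "subgrp A \<Longrightarrow> a \<in> A \<Longrightarrow> b \<in> A \<Longrightarrow> a - b \<in> A" by (simp add: subgrp_def)

lemma subgrp_minus: "subgrp A \<Longrightarrow> a \<in> A \<Longrightarrow> - a \<in> A"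
  using subgrp_diff[of A 0 a] by (simp add: subgrp_zero)

lemma subgrp_add: "subgrp A \<Longrightarrow> a \<in> A \<Longrightarrow> b \<in> A \<Longrightarrow> a + b \<in> A"
  using subgrp_diff[of A a "- b"] by (simp add: subgrp_minus)

lemma subgrp_zsc: "subgrp A \<Longrightarrow> a \<in> A \<Longrightarrow> zsc k a \<in> A"
proof (induction k rule: int_induct[where k = 0])
  case (step2 i)
  then show ?case by (simp add: zsc_diff subgrp_diff)
qed (auto simp: zsc_add subgrp_add subgrp_zero)

lemma supp_single [simp]: "supp (single a :: 'a \<Rightarrow> 'f::field) = {a}" by (auto simp: single_def)

locale cocycle =
  fixes \<tau> :: "'a::ab_group_add \<Rightarrow> 'a \<Rightarrow> 'f::field"
  assumes two_cocycle: "two_cocycle \<tau>"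
begin

lemma nz [simp]: "\<tau> a b \<noteq> 0" using two_cocycle by (simp add: two_cocycle_def)

lemma coc: "\<tau> a b * \<tau> (a + b) c = \<tau> b c * \<tau> a (b + c)"
  using two_cocycle by (simp add: two_cocycle_def)

lemma zero_right: "\<tau> a 0 = \<tau> 0 0"
  using coc[of a 0 0] nz[of a 0] by (metis add.right_neutral mult_right_cancel)

lemma zero_left: "\<tau> 0 a = \<tau> 0 0"
  using coc[of 0 0 a] nz[of 0 a] by (metis add_0 mult_right_cancel)

text \<open>The scalar comparing the two products of the basis units of \<open>x\<close> and
  \<open>y\<close>. Unlike \<open>\<tau>\<close> it is multiplicative in each argument, which makes
  commutation an additive condition.\<close>

definition commutator :: "'a \<Rightarrow> 'a \<Rightarrow> 'f" where
  "commutator x y = \<tau> x y / \<tau> y x"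

definition commute :: "'a \<Rightarrow> 'a \<Rightarrow> bool" where
  "commute x y \<longleftrightarrow> \<tau> x y = \<tau> y x"

lemma commute_iff: "commute x y \<longleftrightarrow> commutator x y = 1"
  by (simp add: commute_def commutator_def)

lemma commutator_nz [simp]: "commutator x y \<noteq> 0"
  by (simp add: commutator_def)

text \<open>Three instances of the cocycle identity move \<open>z\<close> past \<open>y\<close> and
  then past \<open>x\<close>.\<close>

lemma commutator_add_left: "commutator (x + y) z = commutator x z * commutator y z"
proof -
  have 1: "\<tau> (x + y) z = \<tau> y z * \<tau> x (y + z) / \<tau> x y"
    using coc[of x y z] by (simp add: field_simps)
  have 2: "\<tau> z (x + y) = \<tau> z x * \<tau> (x + z) y / \<tau> x y"
    using coc[of z x y] by (simp add: field_simps)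
  have 3: "\<tau> x (y + z) = \<tau> x z * \<tau> (x + z) y / \<tau> z y"
    using coc[of x z y] by (simp add: field_simps)
  show ?thesis unfolding commutator_def 1 2 3 by (simp add: field_simps)
qed

lemma commute_refl [simp]: "commute x x" by (simp add: commute_def)

lemma commute_sym: "commute x y \<Longrightarrow> commute y x" by (simp add: commute_def)

lemma commute_zero [simp]: "commute 0 y"
  using zero_left[of y] zero_right[of y] by (simp add: commute_def)

lemma commute_add: "commute x z \<Longrightarrow> commute y z \<Longrightarrow> commute (x + y) z"
  by (simp add: commute_iff commutator_add_left)

lemma commute_minus: "commute x z \<Longrightarrow> commute (- x) z"
  using commutator_add_left[of x "- x" z] commute_zero[of z] by (simp add: commute_iff)

lemma commute_zsc: "commute x z \<Longrightarrow> commute (zsc k x) z"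
  by (rule subgrp_zsc[of "{x. commute x z}", simplified])
    (auto simp: subgrp_def diff_conv_add_uminus simp del: add_uminus_conv_diff intro: commute_add commute_minus)

lemma commute_diffI:
  assumes "commutator x z = commutator y z"
  shows "commute (x - y) z"
proof -
  have "commutator x z = commutator (x - y) z * commutator y z"
    using commutator_add_left[of "x - y" y z] by simp
  then show ?thesis using assms by (simp add: commute_iff)
qed

lemma commute_sum: "(\<And>i. i \<in> P \<Longrightarrow> commute (f i) z) \<Longrightarrow> commute (\<Sum>i\<in>P. f i) z"
  by (induction P rule: infinite_finite_induct) (auto intro: commute_add)

definition isotropic :: "'a set \<Rightarrow> bool" where
  "isotropic X \<longleftrightarrow> (\<forall>x\<in>X. \<forall>y\<in>X. commute x y)"

lemma commute_zspan_right:
  assumes "y \<in> zspan X" "\<And>x. x \<in> X \<Longrightarrow> commute z x"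
  shows "commute z y"
proof -
  obtain c where y: "y = (\<Sum>x\<in>X. zsc (c x) x)" using assms(1) by (auto simp: zspan_def)
  have "commute y z" unfolding y by (intro commute_sum commute_zsc commute_sym[OF assms(2)])
  then show ?thesis by (rule commute_sym)
qed

lemma isotropic_zspan: "isotropic X \<Longrightarrow> isotropic (zspan X)"
  unfolding isotropic_def
  by (meson commute_sym commute_zspan_right)

text \<open>Multiplication by the basis element of \<open>b\<close> from the right and from the left.\<close>

definition rsh :: "'a \<Rightarrow> ('a \<Rightarrow> 'f) \<Rightarrow> 'a \<Rightarrow> 'f" where
  "rsh b f = (\<lambda>c. f (c - b) * \<tau> (c - b) b)"

definition lsh :: "'a \<Rightarrow> ('a \<Rightarrow> 'f) \<Rightarrow> 'a \<Rightarrow> 'f" where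
  "lsh b f = (\<lambda>c. \<tau> b (c - b) * f (c - b))"

lemma supp_rsh: "supp (rsh b f) = (\<lambda>a. a + b) ` supp f"
proof -
  have "c \<in> (\<lambda>a. a + b) ` supp f" if "f (c - b) \<noteq> 0" for c
    using that by (intro image_eqI[of _ _ "c - b"]) auto
  then show ?thesis by (auto simp: rsh_def)
qed

lemma supp_lsh: "supp (lsh b f) = (\<lambda>a. a + b) ` supp f"
proof -
  have "c \<in> (\<lambda>a. a + b) ` supp f" if "f (c - b) \<noteq> 0" for c
    using that by (intro image_eqI[of _ _ "c - b"]) auto
  then show ?thesis by (auto simp: lsh_def)
qed

lemma rsh_rsh: "rsh c (rsh b f) = (\<lambda>x. \<tau> b c * rsh (b + c) f x)"
proof
  fix x
  have e: "x - c - b = x - (b + c)" by (simp add: algebra_simps)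
  have H: "\<tau> (x - (b + c)) b * \<tau> (x - c) c = \<tau> b c * \<tau> (x - (b + c)) (b + c)"
    using coc[of "x - (b + c)" b c] by (simp add: algebra_simps)
  have "rsh c (rsh b f) x = f (x - (b + c)) * (\<tau> (x - (b + c)) b * \<tau> (x - c) c)"
    by (simp only: rsh_def e mult.assoc)
  then show "rsh c (rsh b f) x = \<tau> b c * rsh (b + c) f x"
    unfolding H by (simp only: rsh_def mult_ac)
qed

lemma lsh_lsh: "lsh b (lsh c f) = (\<lambda>x. \<tau> b c * lsh (b + c) f x)"
proof
  fix x
  have e: "x - b - c = x - (b + c)" by (simp add: algebra_simps)
  have H: "\<tau> b c * \<tau> (b + c) (x - (b + c)) = \<tau> c (x - (b + c)) * \<tau> b (x - b)"
    using coc[of b c "x - (b + c)"] by (simp add: algebra_simps)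
  have "lsh b (lsh c f) x = (\<tau> c (x - (b + c)) * \<tau> b (x - b)) * f (x - (b + c))"
    by (simp only: lsh_def e mult_ac)
  then show "lsh b (lsh c f) x = \<tau> b c * lsh (b + c) f x"
    unfolding H[symmetric] by (simp only: lsh_def mult_ac)
qed

lemma lsh_rsh: "lsh b (rsh c f) = rsh c (lsh b f)"
proof
  fix x
  have e: "x - b - c = x - (b + c)" "x - c - b = x - (b + c)" by (simp_all add: algebra_simps)
  have H: "\<tau> b (x - (b + c)) * \<tau> (x - c) c = \<tau> (x - (b + c)) c * \<tau> b (x - b)"
    using coc[of b "x - (b + c)" c] by (simp add: algebra_simps)
  have "lsh b (rsh c f) x = f (x - (b + c)) * (\<tau> (x - (b + c)) c * \<tau> b (x - b))"
    by (simp only: lsh_def rsh_def e mult_ac)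
  then show "lsh b (rsh c f) x = rsh c (lsh b f) x"
    unfolding H[symmetric] by (simp only: lsh_def rsh_def e mult_ac)
qed

lemma rsh_zero: "rsh 0 f = (\<lambda>x. \<tau> 0 0 * f x)"
proof
  fix x show "rsh 0 f x = \<tau> 0 0 * f x" using zero_right[of x] by (simp add: rsh_def)
qed

lemma lsh_single: "lsh a (single b) = (\<lambda>x. \<tau> a b * single (a + b) x)"
  by (rule ext) (auto simp: lsh_def single_def algebra_simps)

lemma rsh_single: "rsh a (single b) = (\<lambda>x. \<tau> b a * single (a + b) x)"
  by (rule ext) (auto simp: rsh_def single_def algebra_simps)

lemma rsh_lin: "rsh b (\<lambda>x. \<Sum>i\<in>P. c i * f i x) = (\<lambda>x. \<Sum>i\<in>P. c i * rsh b (f i) x)"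
  by (auto simp: rsh_def sum_distrib_right sum_distrib_left mult_ac)

lemma lsh_lin: "lsh b (\<lambda>x. \<Sum>i\<in>P. c i * f i x) = (\<lambda>x. \<Sum>i\<in>P. c i * lsh b (f i) x)"
  by (auto simp: lsh_def sum_distrib_right sum_distrib_left mult_ac)

text \<open>Right ideals of the subalgebra on a subgroup \<open>A\<close>, kept as functions on the
  whole group so that \<open>A\<close> can shrink under degeneration. Scalars and right
  multiplication by basis elements replace multiplication by arbitrary elements.\<close>

definition rideal :: "'a set \<Rightarrow> ('a \<Rightarrow> 'f) set \<Rightarrow> bool" where
  "rideal A I \<longleftrightarrow> (\<forall>f\<in>I. finite (supp f) \<and> supp f \<subseteq> A) \<and> (\<lambda>_. 0) \<in> I \<and>
     (\<forall>f\<in>I. \<forall>g\<in>I. (\<lambda>x. f x + g x) \<in> I) \<and> (\<forall>f\<in>I. \<forall>k. (\<lambda>x. k * f x) \<in> I) \<and>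
     (\<forall>f\<in>I. \<forall>b\<in>A. rsh b f \<in> I)"

lemma ridealD:
  assumes "rideal A I"
  shows "f \<in> I \<Longrightarrow> finite (supp f)" "f \<in> I \<Longrightarrow> f a \<noteq> 0 \<Longrightarrow> a \<in> A" "(\<lambda>_. 0) \<in> I"
    "f \<in> I \<Longrightarrow> g \<in> I \<Longrightarrow> (\<lambda>x. f x + g x) \<in> I" "f \<in> I \<Longrightarrow> (\<lambda>x. k * f x) \<in> I"
    "f \<in> I \<Longrightarrow> b \<in> A \<Longrightarrow> rsh b f \<in> I"
  using assms unfolding rideal_def by blast+

lemma rideal_diff: "rideal A I \<Longrightarrow> f \<in> I \<Longrightarrow> g \<in> I \<Longrightarrow> (\<lambda>x. f x - k * g x) \<in> I"
  using ridealD(4)[of A I f "\<lambda>x. - k * g x"] ridealD(5)[of A I g "- k"] by simp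

lemma rideal_lincomb:
  assumes "rideal A I" "\<And>i. i \<in> P \<Longrightarrow> f i \<in> I"
  shows "(\<lambda>x. \<Sum>i\<in>P. c i * f i x) \<in> I"
  using assms(2)
proof (induction P rule: infinite_finite_induct)
  case (insert i P)
  have "(\<lambda>x. c i * f i x + (\<Sum>i\<in>P. c i * f i x)) \<in> I"
    using insert by (intro ridealD(4)[OF assms(1)] ridealD(5)[OF assms(1)]) auto
  then show ?case using insert by simp
qed (use assms(1) ridealD(3) in auto)

lemma rideal_scale_iff:
  assumes "rideal A I" "k \<noteq> 0"
  shows "(\<lambda>x. k * f x) \<in> I \<longleftrightarrow> f \<in> I"
  using ridealD(5)[OF assms(1), of f k] ridealD(5)[OF assms(1), of "\<lambda>x. k * f x" "inverse k"] assms(2)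
  by (auto simp: mult.assoc[symmetric])

text \<open>Basis elements are units: shifting back by \<open>- b\<close> undoes
  \<open>rsh b\<close> up to a nonzero scalar.\<close>

lemma rideal_rsh_iff:
  assumes "subgrp A" "rideal A I" "b \<in> A"
  shows "rsh b f \<in> I \<longleftrightarrow> f \<in> I"
proof
  assume "rsh b f \<in> I"
  then have "rsh (- b) (rsh b f) \<in> I" 
    using ridealD(6)[OF assms(2)] subgrp_minus[OF assms(1,3)] by blast
  then have "(\<lambda>x. \<tau> b (- b) * (\<tau> 0 0 * f x)) \<in> I" by (simp add: rsh_rsh rsh_zero)
  then show "f \<in> I" using assms(2) rideal_scale_iff[of A I "\<tau> b (- b) * \<tau> 0 0" f]
    by (simp add: mult.assoc)
qed (rule ridealD(6)[OF assms(2) _ assms(3)])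

lemma fun_as_singles: "finite (supp f) \<Longrightarrow> f = (\<lambda>x. \<Sum>a\<in>supp f. f a * single a x)"
  by (rule ext) (auto simp: single_def if_distrib[of "(*) _"] sum.delta cong: if_cong)

lemma tga_mult_rsh:
  assumes "finite (supp x)" "finite (supp r)"
  shows "tga_mult \<tau> x r = (\<lambda>c. \<Sum>b\<in>supp r. r b * rsh b x c)"
proof
  fix c
  have "tga_mult \<tau> x r c = (\<Sum>a | x a \<noteq> 0 \<and> r (c - a) \<noteq> 0. x a * r (c - a) * \<tau> a (c - a))"
    unfolding tga_mult_def using assms by (intro sum.mono_neutral_right) auto
  also have "\<dots> = (\<Sum>b | r b \<noteq> 0 \<and> x (c - b) \<noteq> 0. r b * rsh b x c)"
    by (rule sum.reindex_bij_witness[of _ "\<lambda>b. c - b" "\<lambda>a. c - a"]) (auto simp: rsh_def mult_ac)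
  also have "\<dots> = (\<Sum>b\<in>supp r. r b * rsh b x c)"
    using assms by (intro sum.mono_neutral_left) (auto simp: rsh_def)
  finally show "tga_mult \<tau> x r c = (\<Sum>b\<in>supp r. r b * rsh b x c)" .
qed

lemma tga_mult_single: "finite (supp x) \<Longrightarrow> tga_mult \<tau> x (single b) = rsh b x"
  using tga_mult_rsh[of x "single b"] by (simp add: single_def)

lemma tga_mult_rsh_right: "tga_mult \<tau> x (rsh b r) = rsh b (tga_mult \<tau> x r)"
proof
  fix c
  have "x a * rsh b r (c - a) * \<tau> a (c - a) = x a * r (c - b - a) * \<tau> a (c - b - a) * \<tau> (c - b) b" for a
  proof -
    have e: "c - a - b = c - b - a" by (simp add: algebra_simps)
    have H: "\<tau> a (c - b - a) * \<tau> (c - b) b = \<tau> (c - b - a) b * \<tau> a (c - a)"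
      using coc[of a "c - b - a" b] by (simp add: algebra_simps)
    have "x a * rsh b r (c - a) * \<tau> a (c - a)
        = x a * r (c - b - a) * (\<tau> (c - b - a) b * \<tau> a (c - a))"
      by (simp only: rsh_def e mult_ac)
    then show ?thesis unfolding H[symmetric] by (simp only: mult_ac)
  qed
  then show "tga_mult \<tau> x (rsh b r) c = rsh b (tga_mult \<tau> x r) c"
    by (simp only: tga_mult_def rsh_def[of b "\<lambda>c. \<Sum>a\<in>supp x. x a * r (c - a) * \<tau> a (c - a)"]
        sum_distrib_right)
qed

lemma tga_mult_lin_right:
  "tga_mult \<tau> x (\<lambda>c. \<Sum>i\<in>P. k i * f i c) = (\<lambda>c. \<Sum>i\<in>P. k i * tga_mult \<tau> x (f i) c)"
proof
  fix c
  have "tga_mult \<tau> x (\<lambda>c. \<Sum>i\<in>P. k i * f i c) c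
      = (\<Sum>a\<in>supp x. \<Sum>i\<in>P. k i * (x a * f i (c - a) * \<tau> a (c - a)))"
    by (simp add: tga_mult_def sum_distrib_left sum_distrib_right mult_ac)
  also have "\<dots> = (\<Sum>i\<in>P. k i * tga_mult \<tau> x (f i) c)"
    by (subst sum.swap) (simp add: tga_mult_def sum_distrib_left)
  finally show "tga_mult \<tau> x (\<lambda>c. \<Sum>i\<in>P. k i * f i c) c = (\<Sum>i\<in>P. k i * tga_mult \<tau> x (f i) c)" .
qed

lemma supp_scale_finite: "finite (supp f) \<Longrightarrow> finite (supp (\<lambda>x. (k::'f) * f x))"
  by (erule rev_finite_subset) auto

lemma supp_add_finite: "finite (supp f) \<Longrightarrow> finite (supp g) \<Longrightarrow> finite (supp (\<lambda>x. (f x::'f) + g x))"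
  by (rule finite_subset[of _ "supp f \<union> supp g"]) auto

lemma finite_supp_rsh: "finite (supp f) \<Longrightarrow> finite (supp (rsh b f))"
  by (simp only: supp_rsh finite_imageI)

lemma finite_supp_lsh: "finite (supp f) \<Longrightarrow> finite (supp (lsh b f))"
  by (simp only: supp_lsh finite_imageI)

lemma tga_right_ideals_eq: "tga_right_ideals \<tau> = {I. rideal UNIV I}"
proof (intro set_eqI iffI)
  fix I assume I: "I \<in> tga_right_ideals \<tau>"
  have fin: "finite (supp f)" if "f \<in> I" for f
    using I that by (auto simp: tga_right_ideals_def tga_carrier_def)
  have mul: "tga_mult \<tau> f r \<in> I" if "f \<in> I" "finite (supp r)" for f r
    using I that by (auto simp: tga_right_ideals_def tga_carrier_def)
  have rsh: "rsh b f \<in> I" if "f \<in> I" for b f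
    using mul[OF that, of "single b"] fin[OF that] by (simp add: tga_mult_single)
  have sc: "(\<lambda>x. k * f x) \<in> I" if "f \<in> I" for k f
  proof -
    \<comment> \<open>The cocycle need not be normalised, so the identity of the algebra is
      \<open>single 0\<close> divided by \<open>\<tau> 0 0\<close>.\<close>
    let ?r = "\<lambda>x. (k / \<tau> 0 0) * single 0 x"
    have "tga_mult \<tau> f ?r = (\<lambda>x. k * f x)"
      using tga_mult_lin_right[of f "\<lambda>_. k / \<tau> 0 0" "\<lambda>_. single 0" "{()}"]
      by (simp add: tga_mult_single fin[OF that] rsh_zero)
    moreover have "finite (supp ?r)" by (rule supp_scale_finite) simp
    ultimately show ?thesis using mul[OF that, of ?r] by simp
  qed
  show "I \<in> {I. rideal UNIV I}"
    using I fin rsh sc unfolding rideal_def tga_right_ideals_def by auto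
next
  fix I assume "I \<in> {I. rideal UNIV I}"
  then have I: "rideal UNIV I" by simp
  have "tga_mult \<tau> x r \<in> I" if "x \<in> I" "finite (supp r)" for x r
    unfolding tga_mult_rsh[OF ridealD(1)[OF I that(1)] that(2)]
    using that by (intro rideal_lincomb[OF I] ridealD(6)[OF I]) auto
  then show "I \<in> tga_right_ideals \<tau>"
    using I ridealD[OF I] by (auto simp: tga_right_ideals_def tga_carrier_def)
qed

end

subsection \<open>Lattices with coordinates\<close>

locale lattice =
  fixes n :: nat and coord :: "'a::ab_group_add \<Rightarrow> nat \<Rightarrow> int"
  assumes coord_add: "coord (a + b) i = coord a i + coord b i"
    and coord_inj: "(\<And>i. i < n \<Longrightarrow> coord a i = coord b i) \<Longrightarrow> a = b"
    and coord_surj: "\<exists>a. \<forall>i<n. coord a i = f i"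
begin

lemma coord_zero [simp]: "coord 0 i = 0" using coord_add[of 0 0 i] by simp

lemma coord_diff: "coord (a - b) i = coord a i - coord b i"
  using coord_add[of "a - b" b i] by simp

lemma coord_zsc: "coord (zsc k a) i = k * coord a i"
  using additive_zsc[of "\<lambda>a. coord a i" k a] by (simp add: coord_add)

lemma coord_sum: "coord (\<Sum>x\<in>P. f x) i = (\<Sum>x\<in>P. coord (f x) i)"
  by (induction P rule: infinite_finite_induct) (auto simp: coord_add)

lemma zsc_eq_0D:
  fixes a :: 'a
  assumes "zsc k a = 0" "a \<noteq> 0"
  shows "k = 0"
proof -
  obtain i where "i < n" "coord a i \<noteq> 0" using coord_inj[of a 0] assms(2) by auto
  then show ?thesis using coord_zsc[of k a i] assms(1) by simp
qed

lemma indep_card_le_rank: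
  fixes X :: "'a set"
  assumes "indep X"
  shows "card X \<le> n"
proof (rule ccontr)
  assume "\<not> ?thesis"
  then obtain c where c: "\<exists>x\<in>X. c x \<noteq> 0" "\<forall>i\<in>{..<n}. (\<Sum>x\<in>X. c x * coord x i) = 0"
    using exists_nontrivial_relation[of "{..<n}" X coord] assms by (auto simp: indep_def)
  have "(\<Sum>x\<in>X. zsc (c x) x) = 0"
    using c(2) by (intro coord_inj) (simp add: coord_sum coord_zsc)
  then show False using c(1) indepD[OF assms] by blast
qed

lemma finite_coord_box: "finite {a. \<forall>i<n. l \<le> coord a i \<and> coord a i \<le> u}" (is "finite ?B")
proof (rule finite_imageD)
  show "inj_on (\<lambda>a. restrict (coord a) {..<n}) ?B"
  proof (rule inj_onI)
    fix a b assume e: "restrict (coord a) {..<n} = restrict (coord b) {..<n}"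
    have "coord a i = coord b i" if "i < n" for i
      using fun_cong[OF e, of i] that by simp
    then show "a = b" by (rule coord_inj)
  qed
  show "finite ((\<lambda>a. restrict (coord a) {..<n}) ` ?B)"
    by (rule finite_subset[of _ "{..<n} \<rightarrow>\<^sub>E {l..u}"]) (auto intro!: finite_PiE split: if_splits)
qed

definition coord_sub :: "nat set \<Rightarrow> 'a set" where
  "coord_sub S = {a. \<forall>i<n. i \<notin> S \<longrightarrow> coord a i = 0}"

lemma subgrp_coord_sub: "subgrp (coord_sub S)"
  by (auto simp: subgrp_def coord_sub_def coord_diff)

lemma coord_sub_mono: "S \<subseteq> S' \<Longrightarrow> coord_sub S \<subseteq> coord_sub S'"
  by (auto simp: coord_sub_def)

definition nsq :: "'a \<Rightarrow> int" where
  "nsq a = (\<Sum>i<n. (coord a i)\<^sup>2)"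

lemma nsq_nonneg [simp]: "0 \<le> nsq a" by (simp add: nsq_def sum_nonneg)

lemma nsq_coord: "i < n \<Longrightarrow> (coord a i)\<^sup>2 \<le> nsq a"
  unfolding nsq_def by (rule member_le_sum) auto

lemma finite_nsq_ball: "finite {a. nsq a \<le> N}"
proof (rule finite_subset)
  show "{a. nsq a \<le> N} \<subseteq> {a. \<forall>i<n. - N \<le> coord a i \<and> coord a i \<le> N}"
  proof (intro subsetI CollectI allI impI)
    fix a i assume "a \<in> {a. nsq a \<le> N}" "i < n"
    then have "(coord a i)\<^sup>2 \<le> N" using nsq_coord[of i a] by simp
    moreover have "\<bar>coord a i\<bar> \<le> (coord a i)\<^sup>2"
      using self_le_power[of "\<bar>coord a i\<bar>" 2] by (cases "coord a i = 0") (auto simp: power2_abs)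
    ultimately show "- N \<le> coord a i \<and> coord a i \<le> N" by linarith
  qed
qed (rule finite_coord_box)

text \<open>Take \<open>S\<close> maximal with trivial intersection. Adding an index
  \<open>j\<close> creates a nonzero element of \<open>A\<close> supported on
  \<open>insert j S\<close>, whose \<open>j\<close>-th coordinate cannot vanish; these elements are
  diagonal on the complement of \<open>S\<close>.\<close>

lemma complementary_coordinates:
  fixes A :: "'a set"
  assumes "subgrp A"
  shows "\<exists>S b. S \<subseteq> {..<n} \<and> A \<inter> coord_sub S = {0} \<and>
    (\<forall>j\<in>{..<n} - S. b j \<in> A \<and> coord (b j) j \<noteq> 0 \<and> (\<forall>i\<in>{..<n} - S. i \<noteq> j \<longrightarrow> coord (b j) i = 0))"
proof -
  define \<S> where "\<S> = {S. S \<subseteq> {..<n} \<and> A \<inter> coord_sub S = {0}}"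
  have "coord_sub {} = {0}" using coord_inj[of _ 0] by (auto simp: coord_sub_def)
  then have "{} \<in> \<S>" using subgrp_zero[OF assms] by (auto simp: \<S>_def)
  moreover have fin: "finite \<S>" by (rule finite_subset[of _ "Pow {..<n}"]) (auto simp: \<S>_def)
  ultimately obtain S where S: "S \<in> \<S>" "\<And>S'. S' \<in> \<S> \<Longrightarrow> S \<subseteq> S' \<Longrightarrow> S = S'"
    using finite_has_maximal[OF fin] by blast
  have "\<exists>b. b \<in> A \<and> coord b j \<noteq> 0 \<and> (\<forall>i\<in>{..<n} - S. i \<noteq> j \<longrightarrow> coord b i = 0)" if j: "j \<in> {..<n} - S" for j
  proof -
    have "insert j S \<notin> \<S>" using S(2)[of "insert j S"] j by auto
    then have "A \<inter> coord_sub (insert j S) \<noteq> {0}" using S(1) j by (auto simp: \<S>_def)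
    moreover have "0 \<in> A \<inter> coord_sub (insert j S)"
      using subgrp_zero[OF assms] subgrp_zero[OF subgrp_coord_sub] by auto
    ultimately obtain b where b: "b \<in> A" "b \<in> coord_sub (insert j S)" "b \<noteq> 0" by blast
    have "b \<notin> coord_sub S" using b S(1) by (auto simp: \<S>_def)
    then have "coord b j \<noteq> 0" using b(2) by (auto simp: coord_sub_def)
    then show ?thesis using b by (auto simp: coord_sub_def)
  qed
  then obtain b where "\<forall>j\<in>{..<n} - S. b j \<in> A \<and> coord (b j) j \<noteq> 0 \<and> (\<forall>i\<in>{..<n} - S. i \<noteq> j \<longrightarrow> coord (b j) i = 0)"
    by metis
  then show ?thesis using S(1) by (auto simp: \<S>_def)
qed

lemma diagonal_indep:
  assumes P: "finite P" "P \<subseteq> {..<n}"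
    and b: "\<And>j. j \<in> P \<Longrightarrow> coord (b j) j \<noteq> 0" "\<And>i j. i \<in> P \<Longrightarrow> j \<in> P \<Longrightarrow> i \<noteq> j \<Longrightarrow> coord (b j) i = 0"
  shows "indep (b ` P)" "card (b ` P) = card P"
proof -
  have inj: "inj_on b P"
    using b by (intro inj_onI) metis
  then show "card (b ` P) = card P" by (rule card_image)
  have "c (b j) = 0" if "(\<Sum>x\<in>b ` P. zsc (c x) x) = 0" "j \<in> P" for c j
  proof -
    have "coord (\<Sum>x\<in>b ` P. zsc (c x) x) j = (\<Sum>i\<in>P. c (b i) * coord (b i) j)"
      using inj by (simp add: sum.reindex coord_sum coord_zsc)
    also have "\<dots> = c (b j) * coord (b j) j"
      using P(1) that(2) b(2)[of j] by (subst sum.remove[of _ j]) (auto intro!: sum.neutral)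
    finally show ?thesis using that b(1) by simp
  qed
  then show "indep (b ` P)" using P(1) by (auto simp: indep_def)
qed

end

text \<open>Bolzano-Weierstrass in finitely many coordinates, one coordinate at a time.\<close>

lemma common_convergent_subsequence:
  fixes f :: "'i \<Rightarrow> nat \<Rightarrow> real"
  assumes "finite P" "\<And>i k. i \<in> P \<Longrightarrow> \<bar>f i k\<bar> \<le> C"
  shows "\<exists>r. strict_mono r \<and> (\<forall>i\<in>P. convergent (f i \<circ> r))"
  using assms
proof (induction P rule: finite_induct)
  case empty
  show ?case by (auto intro: exI[of _ id] simp: strict_mono_def)
next
  case (insert i P)
  then obtain r where r: "strict_mono r" "\<forall>j\<in>P. convergent (f j \<circ> r)" by blast
  obtain s where s: "strict_mono (s::nat \<Rightarrow> nat)" "monoseq (\<lambda>k. (f i \<circ> r) (s k))"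
    using seq_monosub by blast
  have "Bseq (\<lambda>k. (f i \<circ> r) (s k))"
    using insert.prems[of i] by (intro BseqI'[of _ C]) auto
  then have "convergent (\<lambda>k. (f i \<circ> r) (s k))" using s(2) by (rule Bseq_monoseq_convergent)
  moreover have "convergent (f j \<circ> (r \<circ> s))" if "j \<in> P" for j
    using convergent_subseq_convergent[of "f j \<circ> r" s] r(2) that s(1) by (simp add: o_assoc)
  ultimately show ?case using strict_mono_o[OF r(1) s(1)]
    by (intro exI[of _ "r \<circ> s"]) (auto simp: o_def)
qed

locale twisted_lattice = lattice n coord + cocycle \<tau>
  for n :: nat and coord :: "'a::ab_group_add \<Rightarrow> nat \<Rightarrow> int" and \<tau> :: "'a \<Rightarrow> 'a \<Rightarrow> 'f::field"
begin

subsection \<open>Ideals of finite codimension\<close>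

text \<open>If all monomials of \<open>A\<close> lie here for one finite \<open>W\<close>, then
  \<open>F * A / I\<close> has finite dimension.\<close>

definition reducible :: "'a set \<Rightarrow> ('a \<Rightarrow> 'f) set \<Rightarrow> ('a \<Rightarrow> 'f) set" where
  "reducible W I = {f. \<exists>c. (\<lambda>x. f x - (\<Sum>w\<in>W. c w * single w x)) \<in> I}"

lemma reducible_lincomb:
  assumes I: "rideal A I" and f: "\<And>i. i \<in> P \<Longrightarrow> f i \<in> reducible W I"
  shows "(\<lambda>x. \<Sum>i\<in>P. k i * f i x) \<in> reducible W I"
proof -
  from f obtain c where c: "\<And>i. i \<in> P \<Longrightarrow> (\<lambda>x. f i x - (\<Sum>w\<in>W. c i w * single w x)) \<in> I"
    unfolding reducible_def mem_Collect_eq by metis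
  have "(\<lambda>x. \<Sum>i\<in>P. k i * (f i x - (\<Sum>w\<in>W. c i w * single w x))) \<in> I"
    using c by (rule rideal_lincomb[OF I])
  moreover have "(\<Sum>i\<in>P. k i * (f i x - (\<Sum>w\<in>W. c i w * single w x)))
      = (\<Sum>i\<in>P. k i * f i x) - (\<Sum>w\<in>W. (\<Sum>i\<in>P. k i * c i w) * single w x)" for x
  proof -
    have "(\<Sum>i\<in>P. k i * (\<Sum>w\<in>W. c i w * single w x)) = (\<Sum>w\<in>W. (\<Sum>i\<in>P. k i * c i w) * single w x)"
      unfolding sum_distrib_left sum_distrib_right by (subst sum.swap) (simp add: mult.assoc)
    then show ?thesis by (simp add: right_diff_distrib sum_subtractf)
  qed
  ultimately show ?thesis unfolding reducible_def by auto
qed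

text \<open>Such a \<open>p\<close> annihilates the right module \<open>F * A / I\<close>. Its
  action on a module spanned by \<open>W\<close> is described by \<open>card (W \<times> W)\<close>
  coefficients, so one more power of \<open>a\<close> than that forces a linear relation.\<close>

lemma annihilating_combination:
  assumes A: "subgrp A" and I: "rideal A I" and W: "finite W" "W \<subseteq> A"
    and red: "\<And>a. a \<in> A \<Longrightarrow> single a \<in> reducible W I"
    and a: "a \<in> A" "a \<noteq> 0"
  shows "\<exists>p. p \<noteq> (\<lambda>_. 0) \<and> finite (supp p) \<and> supp p \<subseteq> range (\<lambda>i. zsc i a) \<and> (\<forall>x\<in>A. lsh x p \<in> I)"
proof -
  define T where "T = {..int (card (W \<times> W))} \<inter> {0..}"
  have T: "finite T" "card T = Suc (card (W \<times> W))"
    unfolding T_def by (auto simp: atLeastAtMost_def[symmetric] Int_commute)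
  have mono: "lsh w (single (zsc i a)) \<in> reducible W I" if "w \<in> W" for w i
  proof -
    have "w + zsc i a \<in> A" using A W a that by (auto intro: subgrp_add subgrp_zsc)
    from reducible_lincomb[OF I, of "{()}" "\<lambda>_. single (w + zsc i a)" W "\<lambda>_. \<tau> w (zsc i a)"] red[OF this]
    show ?thesis by (simp add: lsh_single)
  qed
  have "\<forall>w\<in>W. \<forall>i. \<exists>c. (\<lambda>x. lsh w (single (zsc i a)) x - (\<Sum>w'\<in>W. c w' * single w' x)) \<in> I"
    using mono unfolding reducible_def by blast
  then obtain c where c: "\<And>w i. w \<in> W \<Longrightarrow>
      (\<lambda>x. lsh w (single (zsc i a)) x - (\<Sum>w'\<in>W. c w i w' * single w' x)) \<in> I" by metis
  obtain k where k: "\<exists>i\<in>T. k i \<noteq> 0" "\<forall>q\<in>W \<times> W. (\<Sum>i\<in>T. k i * c (fst q) i (snd q)) = 0"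
    using exists_nontrivial_relation[of "W \<times> W" T "\<lambda>i q. c (fst q) i (snd q)"] W T by auto
  define p where "p = (\<lambda>x. \<Sum>i\<in>T. k i * single (zsc i a) x)"
  have inj: "zsc i a = zsc j a \<longleftrightarrow> i = j" for i j
    using zsc_eq_0D[of "i - j" a] a by (auto simp: zsc_diff)
  have "p (zsc i a) = k i" if "i \<in> T" for i
    using T(1) that by (simp add: p_def single_def inj if_distrib[of "(*) _"] sum.delta cong: if_cong)
  then have p0: "p \<noteq> (\<lambda>_. 0)" using k(1) by force
  have suppp: "supp p \<subseteq> (\<lambda>i. zsc i a) ` T"
  proof
    fix x assume "x \<in> supp p"
    then have "p x \<noteq> 0" by simp
    then obtain i where "i \<in> T" "k i * single (zsc i a) x \<noteq> 0"
      unfolding p_def by (rule sum.not_neutral_contains_not_neutral)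
    then show "x \<in> (\<lambda>i. zsc i a) ` T" by (auto simp: single_def split: if_splits)
  qed
  then have fin: "finite (supp p)" using T(1) finite_surj by blast
  have pA: "b \<in> A" if "b \<in> supp p" for b using that suppp A a by (auto intro: subgrp_zsc)
  have lshW: "lsh w p \<in> I" if w: "w \<in> W" for w
  proof -
    have "(\<lambda>x. \<Sum>i\<in>T. k i * (lsh w (single (zsc i a)) x - (\<Sum>w'\<in>W. c w i w' * single w' x))) \<in> I"
      using c[OF w] by (intro rideal_lincomb[OF I])
    moreover have "(\<Sum>i\<in>T. k i * (lsh w (single (zsc i a)) x - (\<Sum>w'\<in>W. c w i w' * single w' x))) = lsh w p x" for x
    proof -
      have "(\<Sum>i\<in>T. k i * (\<Sum>w'\<in>W. c w i w' * single w' x)) = (\<Sum>w'\<in>W. (\<Sum>i\<in>T. k i * c w i w') * single w' x)"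
        unfolding sum_distrib_left sum_distrib_right by (subst sum.swap) (simp add: mult.assoc)
      also have "\<dots> = 0" using k(2) w by (auto intro!: sum.neutral)
      finally show ?thesis unfolding p_def lsh_lin by (simp add: right_diff_distrib sum_subtractf)
    qed
    ultimately show ?thesis by simp
  qed
  have "lsh x p \<in> I" if x: "x \<in> A" for x
  proof -
    \<comment> \<open>Right multiplication by \<open>p\<close>. It respects congruence modulo the
      right ideal \<open>I\<close>, which carries the conclusion from \<open>W\<close> to every
      \<open>x\<close>.\<close>
    define rm where "rm f = (\<lambda>c. \<Sum>b\<in>supp p. p b * rsh b f c)" for f
    have rm1: "rm (single y) = lsh y p" for y
    proof -
      have "lsh y p = lsh y (\<lambda>c. \<Sum>b\<in>supp p. p b * single b c)"
        by (rule arg_cong[OF fun_as_singles[OF fin]])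
      also have "\<dots> = rm (single y)"
        unfolding lsh_lin rm_def by (simp add: lsh_single rsh_single add.commute)
      finally show ?thesis by simp
    qed
    from red[OF x] obtain d where d: "(\<lambda>z. single x z - (\<Sum>w\<in>W. d w * single w z)) \<in> I" (is "?g \<in> I")
      by (auto simp: reducible_def)
    have "rm ?g \<in> I" unfolding rm_def
      using pA d by (intro rideal_lincomb[OF I] ridealD(6)[OF I]) auto
    moreover have "rm ?g = (\<lambda>z. lsh x p z - (\<Sum>w\<in>W. d w * lsh w p z))"
    proof
      fix z
      have "rm ?g z = (\<Sum>b\<in>supp p. p b * (rsh b (single x) z - rsh b (\<lambda>z. \<Sum>w\<in>W. d w * single w z) z))"
        by (simp add: rm_def rsh_def left_diff_distrib)
      also have "\<dots> = rm (single x) z - (\<Sum>b\<in>supp p. p b * (\<Sum>w\<in>W. d w * rsh b (single w) z))"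
        unfolding rsh_lin by (simp add: rm_def right_diff_distrib sum_subtractf)
      also have "(\<Sum>b\<in>supp p. p b * (\<Sum>w\<in>W. d w * rsh b (single w) z)) = (\<Sum>w\<in>W. d w * rm (single w) z)"
        unfolding sum_distrib_left rm_def by (subst sum.swap) (simp add: mult.left_commute)
      finally show "rm ?g z = lsh x p z - (\<Sum>w\<in>W. d w * lsh w p z)" by (simp add: rm1)
    qed
    ultimately have "(\<lambda>z. lsh x p z - (\<Sum>w\<in>W. d w * lsh w p z)) \<in> I" by simp
    moreover have "(\<lambda>z. \<Sum>w\<in>W. d w * lsh w p z) \<in> I" using lshW by (rule rideal_lincomb[OF I])
    ultimately show ?thesis using ridealD(4)[OF I, of "\<lambda>z. lsh x p z - (\<Sum>w\<in>W. d w * lsh w p z)"] by force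
  qed
  then show ?thesis using p0 fin suppp by blast
qed

text \<open>Among the nonzero annihilators of \<open>F * A / I\<close> supported on multiples of
  \<open>a\<close>, take \<open>p\<close> with smallest support. It has at least two terms, since a
  monomial is a unit and would put \<open>single 0\<close> into \<open>I\<close>. For each
  \<open>b\<close>, a twisted commutator of \<open>p\<close> with \<open>b\<close> has smaller
  support and so vanishes; hence two different multiples of \<open>a\<close> have the same
  commutator with \<open>b\<close>.\<close>

lemma finite_codimension_radical:
  assumes A: "subgrp A" and I: "rideal A I" and proper: "single 0 \<notin> I" and W: "finite W" "W \<subseteq> A"
    and red: "\<And>a. a \<in> A \<Longrightarrow> single a \<in> reducible W I"
    and a: "a \<in> A"
  shows "\<exists>k. k \<noteq> 0 \<and> (\<forall>b\<in>A. commute (zsc k a) b)"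
proof (cases "a = 0")
  case True
  then show ?thesis by (intro exI[of _ 1]) auto
next
  case False
  define Q where "Q p \<longleftrightarrow> p \<noteq> (\<lambda>_. 0) \<and> finite (supp p) \<and> supp p \<subseteq> range (\<lambda>i. zsc i a) \<and> (\<forall>x\<in>A. lsh x p \<in> I)" for p
  have "\<exists>p. Q p" unfolding Q_def using annihilating_combination[OF A I W red a False] .
  then obtain p where p: "Q p" "\<And>p'. Q p' \<Longrightarrow> card (supp p) \<le> card (supp p')"
    using ex_has_least_nat[of Q _ "\<lambda>p. card (supp p)"] by blast
  then have pQ: "p \<noteq> (\<lambda>_. 0)" "finite (supp p)" "supp p \<subseteq> range (\<lambda>i. zsc i a)" "\<And>x. x \<in> A \<Longrightarrow> lsh x p \<in> I"
    by (auto simp: Q_def)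
  obtain i where i: "p (zsc i a) \<noteq> 0" using pQ(1,3) by auto
  have "\<exists>j. j \<noteq> i \<and> p (zsc j a) \<noteq> 0"
  proof (rule ccontr)
    assume "\<not> ?thesis"
    then have "p x = 0" if "x \<noteq> zsc i a" for x using that pQ(3) by auto
    then have peq: "p = (\<lambda>x. p (zsc i a) * single (zsc i a) x)" by (auto simp: single_def)
    let ?b = "- zsc i a"
    have "lsh ?b p = (\<lambda>x. \<Sum>u\<in>{()}. p (zsc i a) * lsh ?b (single (zsc i a)) x)"
      using lsh_lin[of ?b "\<lambda>_. p (zsc i a)" "\<lambda>_. single (zsc i a)" "{()}"] peq by simp
    also have "\<dots> = (\<lambda>x. (p (zsc i a) * \<tau> ?b (zsc i a)) * single 0 x)"
      by (simp add: lsh_single mult.assoc)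
    finally have "(\<lambda>x. (p (zsc i a) * \<tau> ?b (zsc i a)) * single 0 x) \<in> I"
      using pQ(4)[of ?b] A a by (simp add: subgrp_minus subgrp_zsc)
    then have "single 0 \<in> I" using rideal_scale_iff[OF I, of "p (zsc i a) * \<tau> ?b (zsc i a)" "single 0"] i by simp
    then show False using proper by simp
  qed
  then obtain j where j: "j \<noteq> i" "p (zsc j a) \<noteq> 0" by blast
  have "commute (zsc (j - i) a) b" if b: "b \<in> A" for b
  proof -
    \<comment> \<open>This scalar cancels the term at \<open>zsc i a\<close>; the shift by
      \<open>- b\<close> in \<open>p'\<close> brings the support back to multiples of
      \<open>a\<close>.\<close>
    define al where "al = \<tau> b (zsc i a) / \<tau> (zsc i a) b"
    define p' where "p' = rsh (- b) (\<lambda>x. lsh b p x - al * rsh b p x)"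
    have p'v: "p' y = (\<tau> b y - al * \<tau> y b) * p y * \<tau> (y + b) (- b)" for y
      by (simp add: p'_def rsh_def lsh_def algebra_simps)
    have sub: "supp p' \<subseteq> supp p - {zsc i a}" by (auto simp: p'v al_def)
    have "lsh x p' \<in> I" if x: "x \<in> A" for x
    proof -
      have "lsh x (\<lambda>x. lsh b p x - al * rsh b p x) = (\<lambda>y. lsh x (lsh b p) y - al * lsh x (rsh b p) y)"
        by (auto simp: lsh_def algebra_simps)
      also have "\<dots> = (\<lambda>y. \<tau> x b * lsh (x + b) p y - al * rsh b (lsh x p) y)"
        by (simp add: lsh_lsh lsh_rsh)
      also have "\<dots> \<in> I"
        using x b A pQ(4) by (intro rideal_diff[OF I] ridealD(5,6)[OF I]) (auto intro: subgrp_add)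
      finally show ?thesis unfolding p'_def lsh_rsh
        using b A by (intro ridealD(6)[OF I]) (auto intro: subgrp_minus)
    qed
    moreover have fin': "finite (supp p')" using sub pQ(2) finite_subset by blast
    moreover have "card (supp p') < card (supp p)"
      using sub pQ(2) i by (intro psubset_card_mono) auto
    ultimately have "p' = (\<lambda>_. 0)" using p(2)[of p'] sub pQ(3) unfolding Q_def by force
    then have "(\<tau> b (zsc j a) - al * \<tau> (zsc j a) b) * p (zsc j a) * \<tau> (zsc j a + b) (- b) = 0"
      using p'v[of "zsc j a"] by metis
    then have "\<tau> b (zsc j a) = al * \<tau> (zsc j a) b" using j by simp
    then have "commutator (zsc j a) b = commutator (zsc i a) b"
      by (simp add: commutator_def al_def field_simps)
    then show ?thesis unfolding zsc_diff by (rule commute_diffI)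
  qed
  then show ?thesis using j by (intro exI[of _ "j - i"]) auto
qed

end

context twisted_lattice
begin

subsection \<open>Degeneration of ideals along a direction\<close>

text \<open>The exponents that are not the strictly longest one in any element of \<open>I\<close>.
  Euclidean length is no monomial order, since ties occur and translation does not preserve it, so
  only strict dominance permits a reduction.\<close>

definition standard :: "'a set \<Rightarrow> ('a \<Rightarrow> 'f) set \<Rightarrow> 'a set" where
  "standard A I = {a \<in> A. \<forall>g\<in>I. g a \<noteq> 0 \<longrightarrow> (\<exists>b. b \<noteq> a \<and> g b \<noteq> 0 \<and> nsq a \<le> nsq b)}"

lemma reducible_base:
  assumes I: "rideal A I" "finite W" "w \<in> W"
  shows "single w \<in> reducible W I"
proof -
  have "(\<Sum>v\<in>W. (if v = w then 1 else 0) * single v x) = (single w x :: 'f)" for x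
    using assms by (simp add: if_distrib[of "\<lambda>c. c * _"] sum.delta cong: if_cong)
  then show ?thesis unfolding reducible_def mem_Collect_eq
    using ridealD(3)[OF I(1)] by (intro exI[of _ "\<lambda>v. if v = w then 1 else 0"]) simp
qed

lemma reducible_ideal:
  assumes I: "rideal A I" "g \<in> I"
  shows "g \<in> reducible W I"
  unfolding reducible_def mem_Collect_eq using I by (intro exI[of _ "\<lambda>_. 0"]) simp

text \<open>Induction on the length: a nonstandard exponent is the strictly longest one of some
  \<open>g\<close> in \<open>I\<close>, and \<open>g\<close> rewrites it through shorter
  ones.\<close>

lemma standard_spans:
  assumes I: "rideal A I" and fin: "finite (standard A I)" and a: "a \<in> A"
  shows "single a \<in> reducible (standard A I) I"
  using a
proof (induction "nat (nsq a)" arbitrary: a rule: less_induct)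
  case less
  let ?W = "standard A I"
  show ?case
  proof (cases "a \<in> ?W")
    case True
    then show ?thesis using reducible_base[OF I fin] by simp
  next
    case False
    then obtain g where g: "g \<in> I" "g a \<noteq> 0" "\<And>b. b \<noteq> a \<Longrightarrow> g b \<noteq> 0 \<Longrightarrow> nsq b < nsq a"
      using less.prems by (force simp: standard_def)
    have fing: "finite (supp g)" using ridealD(1)[OF I g(1)] .
    let ?P = "supp g - {a}"
    have low: "(\<lambda>x. \<Sum>b\<in>?P. (g b / g a) * single b x) \<in> reducible ?W I"
    proof (rule reducible_lincomb[OF I])
      fix b assume b: "b \<in> ?P"
      then have "nsq b < nsq a" "b \<in> A" using g(3) ridealD(2)[OF I g(1)] by auto
      moreover from this have "0 < nsq a" using nsq_nonneg[of b] by linarith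
      ultimately show "single b \<in> reducible ?W I" by (intro less.hyps) auto
    qed
    define F where "F t = (if t then g else (\<lambda>x. \<Sum>b\<in>?P. (g b / g a) * single b x))" for t :: bool
    have "(\<lambda>x. \<Sum>t\<in>UNIV. (if t then inverse (g a) else -1) * F t x) \<in> reducible ?W I"
      by (rule reducible_lincomb[OF I]) (use low reducible_ideal[OF I g(1)] in \<open>auto simp: F_def\<close>)
    moreover have "(\<Sum>t\<in>UNIV. (if t then inverse (g a) else -1) * F t x) = single a x" for x
    proof -
      have "g x = (\<Sum>b\<in>supp g. g b * single b x)" by (rule fun_cong[OF fun_as_singles[OF fing]])
      also have "\<dots> = g a * single a x + (\<Sum>b\<in>?P. g b * single b x)"
        using g(2) fing by (subst sum.remove[of _ a]) auto
      finally have gx: "g x = g a * single a x + (\<Sum>b\<in>?P. g b * single b x)" .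
      have "(\<Sum>b\<in>?P. (g b / g a) * single b x) = (\<Sum>b\<in>?P. g b * single b x) / g a"
        by (simp add: sum_divide_distrib)
      then have "inverse (g a) * g x = single a x + (\<Sum>b\<in>?P. (g b / g a) * single b x)"
        unfolding gx using g(2) by (simp add: divide_inverse distrib_left mult.commute)
      then show ?thesis by (simp add: UNIV_bool F_def)
    qed
    ultimately show ?thesis by simp
  qed
qed

text \<open>Let \<open>\<phi>\<close> be the scalar product with a limit \<open>v\<close> of the
  normalised standard exponents \<open>a k\<close>. If some \<open>g\<close> in \<open>I\<close> had
  0 in its support and \<open>\<phi>\<close> negative on the rest, then for a late member
  \<open>a k\<close> of the convergent subsequence the shift of \<open>g\<close> by
  \<open>a k\<close> would have \<open>a k\<close> as strictly longest exponent, contrary to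
  standardness.\<close>

lemma infinite_standard_direction:
  assumes A: "subgrp A" and I: "rideal A I" and inf: "infinite (standard A I)"
  shows "\<exists>\<phi>::'a \<Rightarrow> real. (\<forall>a b. \<phi> (a - b) = \<phi> a - \<phi> b) \<and> (\<exists>a\<in>A. \<phi> a \<noteq> 0) \<and>
    (\<forall>g\<in>I. g 0 \<noteq> 0 \<longrightarrow> (\<exists>a. a \<noteq> 0 \<and> g a \<noteq> 0 \<and> 0 \<le> \<phi> a))"
proof -
  obtain a :: "nat \<Rightarrow> 'a" where a: "inj a" "range a \<subseteq> standard A I"
    using infinite_countable_subset[OF inf] by auto
  define N where "N k = sqrt (real_of_int (nsq (a k)))" for k
  have sq: "(N k)\<^sup>2 = real_of_int (nsq (a k))" for k by (simp add: N_def)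
  have coordN: "\<bar>real_of_int (coord (a k) i)\<bar> \<le> N k" if "i < n" for i k
    unfolding N_def using nsq_coord[OF that, of "a k"]
    by (intro real_le_rsqrt) (simp flip: of_int_power)
  define x where "x i k = real_of_int (coord (a k) i) / N k" for i k
  have "\<bar>x i k\<bar> \<le> 1" if "i \<in> {..<n}" for i k
  proof -
    have "0 \<le> N k" by (simp add: N_def)
    then show ?thesis using coordN[of i k] that by (auto simp: x_def divide_le_eq_1)
  qed
  then obtain r where r: "strict_mono r" "\<forall>i\<in>{..<n}. convergent (x i \<circ> r)"
    using common_convergent_subsequence[of "{..<n}" x 1] by auto
  then have "\<forall>i\<in>{..<n}. \<exists>l. (\<lambda>k. x i (r k)) \<longlonglongrightarrow> l" by (simp add: convergent_def o_def)
  then obtain v where v: "\<And>i. i < n \<Longrightarrow> (\<lambda>k. x i (r k)) \<longlonglongrightarrow> v i" by (metis lessThan_iff)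
  define \<phi> where "\<phi> c = (\<Sum>i<n. v i * real_of_int (coord c i))" for c
  \<comment> \<open>A ball contains only finitely many lattice points, so distinct points leave
    every ball.\<close>
  have Ninf: "filterlim (\<lambda>k. N (r k)) at_top sequentially"
    unfolding filterlim_at_top
  proof
    fix Z :: real
    let ?S = "{k. N (r k) < Z}"
    have "inj (a \<circ> r)" using a(1) r(1) by (intro inj_compose strict_mono_imp_inj_on)
    moreover have "(a \<circ> r) ` ?S \<subseteq> {b. nsq b \<le> \<lceil>Z\<^sup>2\<rceil>}"
    proof clarsimp
      fix k assume "N (r k) < Z"
      then have "(N (r k))\<^sup>2 \<le> Z\<^sup>2" by (intro power_mono) (auto simp: N_def)
      then show "nsq (a (r k)) \<le> \<lceil>Z\<^sup>2\<rceil>" unfolding sq by linarith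
    qed
    ultimately have "finite ?S" using finite_nsq_ball by (meson finite_imageD finite_subset inj_on_subset subset_UNIV)
    then have "eventually (\<lambda>k. k \<notin> ?S) sequentially"
      by (simp add: eventually_cofinite cofinite_eq_sequentially[symmetric])
    then show "eventually (\<lambda>k. Z \<le> N (r k)) sequentially" by (rule eventually_mono) auto
  qed
  have Npos: "eventually (\<lambda>k. N (r k) > 0) sequentially"
    using Ninf unfolding filterlim_at_top_dense by blast
  have lim: "(\<lambda>k. \<Sum>i<n. real_of_int (coord c i) * x i (r k)) \<longlonglongrightarrow> \<phi> c" for c
    unfolding \<phi>_def using v by (intro tendsto_sum) (auto intro!: tendsto_eq_intros)
  have "(\<lambda>k. \<Sum>i<n. x i (r k) * x i (r k)) \<longlonglongrightarrow> (\<Sum>i<n. v i * v i)"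
    using v by (intro tendsto_sum tendsto_mult) auto
  moreover have "eventually (\<lambda>k. (\<Sum>i<n. x i (r k) * x i (r k)) = 1) sequentially"
    using Npos
  proof (rule eventually_mono)
    fix k assume "N (r k) > 0"
    have "(\<Sum>i<n. x i (r k) * x i (r k)) = real_of_int (nsq (a (r k))) / (N (r k))\<^sup>2"
      by (simp add: x_def nsq_def sum_divide_distrib power2_eq_square)
    then show "(\<Sum>i<n. x i (r k) * x i (r k)) = 1" using \<open>N (r k) > 0\<close> by (simp add: sq[symmetric])
  qed
  ultimately have "(\<lambda>k. 1) \<longlonglongrightarrow> (\<Sum>i<n. v i * v i)"
    by (rule Lim_transform_eventually)
  \<comment> \<open>As the limit direction has length one, \<open>\<phi>\<close> is positive at some
    \<open>a (r k)\<close>; thus it is nontrivial on \<open>A\<close> and not merely on the ambient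
    group.\<close>
  then have vv: "(\<Sum>i<n. v i * v i) = 1" by (simp add: LIMSEQ_const_iff)
  have "(\<lambda>k. \<Sum>i<n. v i * x i (r k)) \<longlonglongrightarrow> (\<Sum>i<n. v i * v i)"
    using v by (intro tendsto_sum tendsto_mult) auto
  then have "eventually (\<lambda>k. (\<Sum>i<n. v i * x i (r k)) > 0) sequentially"
    unfolding vv by (rule order_tendstoD) simp
  then obtain k where k: "(\<Sum>i<n. v i * x i (r k)) > 0" using eventually_happens' sequentially_bot by blast
  have "(\<Sum>i<n. v i * x i (r k)) = \<phi> (a (r k)) / N (r k)"
    by (simp add: x_def \<phi>_def sum_divide_distrib)
  then have "\<phi> (a (r k)) \<noteq> 0" using k by auto
  moreover have "a (r k) \<in> A" using a(2) by (auto simp: standard_def)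
  ultimately have nz: "\<exists>a\<in>A. \<phi> a \<noteq> 0" by blast
  have "\<exists>a. a \<noteq> 0 \<and> g a \<noteq> 0 \<and> 0 \<le> \<phi> a" if g: "g \<in> I" "g 0 \<noteq> 0" for g
  proof (rule ccontr)
    assume "\<not> ?thesis"
    then have neg: "\<phi> c < 0" if "c \<in> supp g - {0}" for c using that by force
    have ev: "eventually (\<lambda>k. nsq (c + a (r k)) < nsq (a (r k))) sequentially" if c: "c \<in> supp g - {0}" for c
    proof -
      have "(\<lambda>k. real_of_int (nsq c) / N (r k)) \<longlonglongrightarrow> 0"
        using Ninf by (intro real_tendsto_divide_at_top[OF tendsto_const])
      \<comment> \<open>The change of squared length from \<open>a (r k)\<close> to
        \<open>c + a (r k)\<close>, divided by \<open>N (r k)\<close>; its limit has the sign of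
        \<open>\<phi> c\<close>.\<close>
      then have "(\<lambda>k. 2 * (\<Sum>i<n. real_of_int (coord c i) * x i (r k)) + real_of_int (nsq c) / N (r k))
          \<longlonglongrightarrow> 2 * \<phi> c + 0"
        by (intro tendsto_add tendsto_mult tendsto_const lim)
      then have "eventually (\<lambda>k. 2 * (\<Sum>i<n. real_of_int (coord c i) * x i (r k)) + real_of_int (nsq c) / N (r k) < 0) sequentially"
        by (rule order_tendstoD(2)) (use neg[OF c] in simp)
      then show ?thesis using Npos
      proof eventually_elim
        case (elim k)
        have "2 * (\<Sum>i<n. real_of_int (coord c i) * x i (r k)) + real_of_int (nsq c) / N (r k)
            = (2 * (\<Sum>i<n. real_of_int (coord c i) * real_of_int (coord (a (r k)) i)) + real_of_int (nsq c)) / N (r k)"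
          by (simp add: x_def sum_divide_distrib[symmetric] add_divide_distrib)
        then have "2 * (\<Sum>i<n. real_of_int (coord c i) * real_of_int (coord (a (r k)) i)) + real_of_int (nsq c) < 0"
          using elim by (simp add: divide_less_0_iff)
        then have "real_of_int (2 * (\<Sum>i<n. coord c i * coord (a (r k)) i) + nsq c) < 0" by simp
        then have "2 * (\<Sum>i<n. coord c i * coord (a (r k)) i) + nsq c < 0" by linarith
        moreover have "nsq (c + a (r k)) = nsq c + 2 * (\<Sum>i<n. coord c i * coord (a (r k)) i) + nsq (a (r k))"
          unfolding nsq_def by (simp add: coord_add power2_sum sum.distrib sum_distrib_left mult.assoc)
        ultimately show ?case by linarith
      qed
    qed
    have "finite (supp g - {0})" using ridealD(1)[OF I g(1)] by simp
    then have "eventually (\<lambda>k. \<forall>c\<in>supp g - {0}. nsq (c + a (r k)) < nsq (a (r k))) sequentially"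
      using ev by (simp add: eventually_ball_finite)
    then obtain k where k: "\<forall>c\<in>supp g - {0}. nsq (c + a (r k)) < nsq (a (r k))"
      using eventually_happens' sequentially_bot by blast
    let ?b = "a (r k)"
    have b: "?b \<in> standard A I" using a(2) by auto
    then have "?b \<in> A" by (simp add: standard_def)
    then have gI: "rsh ?b g \<in> I" using ridealD(6)[OF I g(1)] by blast
    have "rsh ?b g ?b \<noteq> 0" using g(2) by (simp add: rsh_def)
    then obtain b' where b': "b' \<noteq> ?b" "rsh ?b g b' \<noteq> 0" "nsq ?b \<le> nsq b'"
      using b gI by (auto simp: standard_def)
    have "b' - ?b \<in> supp g - {0}" using b' by (auto simp: rsh_def)
    then have "nsq (b' - ?b + ?b) < nsq ?b" using k by blast
    then show False using b'(3) by simp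
  qed
  moreover have "\<phi> (a - b) = \<phi> a - \<phi> b" for a b
    by (simp add: \<phi>_def coord_diff right_diff_distrib sum_subtractf)
  ultimately show ?thesis using nz by blast
qed


text \<open>The ideal of \<open>\<phi>\<close>-leading forms, made homogeneous of degree 0, lives on the kernel of \<open>\<phi>\<close>.\<close>

definition top_ideal :: "('a \<Rightarrow> real) \<Rightarrow> 'a set \<Rightarrow> ('a \<Rightarrow> 'f) set \<Rightarrow> ('a \<Rightarrow> 'f) set" where
  "top_ideal \<phi> A I = {f. supp f \<subseteq> {a \<in> A. \<phi> a = 0} \<and>
     (\<exists>g\<in>I. \<forall>a. (0 < \<phi> a \<longrightarrow> g a = 0) \<and> (\<phi> a = 0 \<longrightarrow> g a = f a))}"

lemma top_idealI:
  assumes "supp f \<subseteq> {a \<in> A. \<phi> a = 0}" "g \<in> I" "\<And>a. 0 < \<phi> a \<Longrightarrow> g a = 0" "\<And>a. \<phi> a = 0 \<Longrightarrow> g a = f a"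
  shows "f \<in> top_ideal \<phi> A I"
  using assms unfolding top_ideal_def by blast

lemma top_ideal_rideal:
  assumes I: "rideal A I" and \<phi>: "\<And>a b. \<phi> (a - b) = \<phi> a - \<phi> b"
  shows "rideal {a \<in> A. \<phi> a = 0} (top_ideal \<phi> A I)"
proof -
  let ?J = "top_ideal \<phi> A I"
  have ex: "\<exists>g\<in>I. (\<forall>a. 0 < \<phi> a \<longrightarrow> g a = 0) \<and> (\<forall>a. \<phi> a = 0 \<longrightarrow> g a = f a)" if "f \<in> ?J" for f
    using that unfolding top_ideal_def by blast
  have sup: "supp f \<subseteq> {a \<in> A. \<phi> a = 0}" if "f \<in> ?J" for f
    using that unfolding top_ideal_def by blast
  have sup': "f a = 0" if "f \<in> ?J" "a \<notin> A \<or> \<phi> a \<noteq> 0" for f a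
    using sup[OF that(1)] that(2) by auto
  show ?thesis unfolding rideal_def
  proof (intro conjI ballI allI)
    fix f assume f: "f \<in> ?J"
    then obtain g where g: "g \<in> I" "\<forall>a. 0 < \<phi> a \<longrightarrow> g a = 0" "\<forall>a. \<phi> a = 0 \<longrightarrow> g a = f a"
      using ex by blast
    show "supp f \<subseteq> {a \<in> A. \<phi> a = 0}" using sup[OF f] .
    have "supp f \<subseteq> supp g" using sup[OF f] g(3) by auto
    then show "finite (supp f)" using ridealD(1)[OF I g(1)] finite_subset by blast
    show "(\<lambda>x. k * f x) \<in> ?J" for k
      by (rule top_idealI[of _ _ _ "\<lambda>x. k * g x"]) (use g sup[OF f] ridealD(5)[OF I g(1)] in auto)
    show "rsh b f \<in> ?J" if b: "b \<in> {a \<in> A. \<phi> a = 0}" for b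
    proof (rule top_idealI[of _ _ _ "rsh b g"])
      show "rsh b g \<in> I" using ridealD(6)[OF I g(1)] b by blast
      show "supp (rsh b f) \<subseteq> {a \<in> A. \<phi> a = 0}"
      proof
        fix c assume "c \<in> supp (rsh b f)"
        then have "c - b \<in> supp f" and c: "c \<in> supp (rsh b g)"
          using g(3) sup[OF f] by (auto simp: rsh_def)
        then have "\<phi> (c - b) = 0" using sup[OF f] by auto
        moreover have "c \<in> A" using ridealD(2)[OF I \<open>rsh b g \<in> I\<close>] c by auto
        ultimately show "c \<in> {a \<in> A. \<phi> a = 0}" using b \<phi> by auto
      qed
      show "rsh b g a = 0" if "0 < \<phi> a" for a using that b g(2) by (simp add: rsh_def \<phi>)
      show "rsh b g a = rsh b f a" if "\<phi> a = 0" for a using that b g(3) by (simp add: rsh_def \<phi>)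
    qed
    fix f' assume f': "f' \<in> ?J"
    then obtain g' where g': "g' \<in> I" "\<forall>a. 0 < \<phi> a \<longrightarrow> g' a = 0" "\<forall>a. \<phi> a = 0 \<longrightarrow> g' a = f' a"
      using ex by blast
    show "(\<lambda>x. f x + f' x) \<in> ?J"
    proof (rule top_idealI[of _ _ _ "\<lambda>x. g x + g' x"])
      show "supp (\<lambda>x. f x + f' x) \<subseteq> {a \<in> A. \<phi> a = 0}"
        using sup'[OF f] sup'[OF f'] by force
    qed (use g g' ridealD(4)[OF I g(1) g'(1)] in auto)
  next
    show "(\<lambda>_. 0) \<in> ?J" by (rule top_idealI[of _ _ _ "\<lambda>_. 0"]) (use ridealD(3)[OF I] in auto)
  qed
qed

text \<open>Shift a nonzero \<open>f\<close> so that an exponent of maximal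
  \<open>\<phi>\<close>-value moves to 0. Its part on the kernel of \<open>\<phi>\<close> is a
  nonzero element of \<open>top_ideal\<close>, still supported on the coordinate subgroup because
  that is closed under differences.\<close>

lemma top_ideal_detects:
  assumes A: "subgrp A" and I: "rideal A I" and \<phi>: "\<And>a b. \<phi> (a - b) = \<phi> a - \<phi> b"
    and S: "\<And>f. f \<in> top_ideal \<phi> A I \<Longrightarrow> supp f \<subseteq> coord_sub S \<Longrightarrow> f = (\<lambda>_. 0)"
    and f: "f \<in> I" "supp f \<subseteq> coord_sub S"
  shows "f = (\<lambda>_. 0)"
proof (rule ccontr)
  assume "f \<noteq> (\<lambda>_. 0)"
  then have ne: "supp f \<noteq> {}" by auto
  have fin: "finite (supp f)" using ridealD(1)[OF I f(1)] .
  define m where "m = Max (\<phi> ` supp f)"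
  have "m \<in> \<phi> ` supp f" unfolding m_def using fin ne by (intro Max_in) auto
  then obtain a where a: "f a \<noteq> 0" "\<phi> a = m" by auto
  have max: "\<phi> b \<le> \<phi> a" if "f b \<noteq> 0" for b
    unfolding a(2) m_def using fin that by (intro Max_ge) auto
  have aA: "a \<in> A" using ridealD(2)[OF I f(1) a(1)] .
  define g where "g = rsh (- a) f"
  have gI: "g \<in> I" unfolding g_def using subgrp_minus[OF A aA] by (rule ridealD(6)[OF I f(1)])
  have \<phi>0: "\<phi> 0 = 0" using \<phi>[of 0 0] by simp
  have \<phi>p: "\<phi> (b + a) = \<phi> b + \<phi> a" for b using \<phi>[of "b + a" a] by simp
  have gv: "g b = f (b + a) * \<tau> (b + a) (- a)" for b by (simp add: g_def rsh_def)
  define h where "h = (\<lambda>b. if \<phi> b = 0 then g b else 0)"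
  have "h \<in> top_ideal \<phi> A I"
  proof (rule top_idealI[of _ _ _ g])
    show "supp h \<subseteq> {a \<in> A. \<phi> a = 0}" using ridealD(2)[OF I gI] by (auto simp: h_def split: if_splits)
    show "g b = 0" if "0 < \<phi> b" for b using max[of "b + a"] that by (auto simp: gv \<phi>p)
  qed (auto simp: h_def gI)
  moreover have "supp h \<subseteq> coord_sub S"
  proof
    fix b assume "b \<in> supp h"
    then have "b + a \<in> coord_sub S" using f(2) by (auto simp: h_def gv split: if_splits)
    moreover have "a \<in> coord_sub S" using f(2) a(1) by auto
    ultimately show "b \<in> coord_sub S" using subgrp_diff[OF subgrp_coord_sub, of "b + a" S a] by simp
  qed
  ultimately have "h = (\<lambda>_. 0)" by (rule S)
  then have "h 0 = 0" by simp
  then show False using a(1) by (simp add: h_def gv \<phi>0)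
qed

text \<open>Induction on the rank of \<open>A\<close>. The set \<open>S\<close> refers to the
  ambient coordinates, so the count of \<open>n\<close> survives each degeneration: rank lost by
  \<open>A\<close> reappears in \<open>S\<close>. In the finite-dimensional case \<open>S\<close> is
  complementary to \<open>A\<close>, and multiples of the elements diagonal outside \<open>S\<close>
  lie in the radical.\<close>

lemma isotropic_and_free_coordinates:
  assumes "\<And>X. indep X \<Longrightarrow> X \<subseteq> A \<Longrightarrow> card X \<le> m" "subgrp A" "rideal A I" "single 0 \<notin> I"
  shows "\<exists>S X. S \<subseteq> {..<n} \<and> indep X \<and> X \<subseteq> A \<and> isotropic X \<and> n \<le> card X + card S \<and>
    (\<forall>f\<in>I. supp f \<subseteq> coord_sub S \<longrightarrow> f = (\<lambda>_. 0))"
  using assms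
proof (induction m arbitrary: A I rule: less_induct)
  case (less m)
  note A = less.prems(2) and I = less.prems(3) and proper = less.prems(4)
  show ?case
  proof (cases "finite (standard A I)")
    case True
    obtain S b where S: "S \<subseteq> {..<n}" "A \<inter> coord_sub S = {0}"
      and bb: "\<forall>j\<in>{..<n} - S. b j \<in> A \<and> coord (b j) j \<noteq> 0 \<and> (\<forall>i\<in>{..<n} - S. i \<noteq> j \<longrightarrow> coord (b j) i = 0)"
      using complementary_coordinates[OF A] by (elim exE conjE)
    have b: "b j \<in> A" "coord (b j) j \<noteq> 0" if "j \<in> {..<n} - S" for j using bb that by blast+
    have b': "coord (b j) i = 0" if "i \<in> {..<n} - S" "j \<in> {..<n} - S" "i \<noteq> j" for i j
      using bb that by blast
    have "\<exists>k. k \<noteq> 0 \<and> (\<forall>y\<in>A. commute (zsc k x) y)" if "x \<in> A" for x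
      by (rule finite_codimension_radical[OF A I proper True _ standard_spans[OF I True] that])
        (auto simp: standard_def)
    then obtain k where k: "\<And>x. x \<in> A \<Longrightarrow> k x \<noteq> 0" "\<And>x y. x \<in> A \<Longrightarrow> y \<in> A \<Longrightarrow> commute (zsc (k x) x) y"
      by metis
    define e where "e j = zsc (k (b j)) (b j)" for j
    let ?P = "{..<n} - S" and ?X = "e ` ({..<n} - S)"
    have XA: "?X \<subseteq> A" using b(1) A by (auto simp: e_def intro: subgrp_zsc)
    have "indep ?X" "card ?X = card ?P"
      by (rule diagonal_indep; use b b' k in \<open>auto simp: e_def coord_zsc\<close>)+
    moreover have "isotropic ?X" unfolding isotropic_def
    proof (intro ballI)
      fix x y assume "x \<in> ?X" "y \<in> ?X"
      then show "commute x y" using k(2) b(1) XA by (auto simp: e_def)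
    qed
    moreover have "n \<le> card ?P + card S"
      using S(1) by (simp add: card_Diff_subset finite_subset)
    moreover have "f = (\<lambda>_. 0)" if f: "f \<in> I" "supp f \<subseteq> coord_sub S" for f
    proof -
      have "supp f \<subseteq> {0}" using f ridealD(2)[OF I f(1)] S(2) by blast
      then have feq: "f = (\<lambda>x. f 0 * single 0 x)" by (auto simp: single_def fun_eq_iff)
      have "f 0 = 0"
      proof (rule ccontr)
        assume "f 0 \<noteq> 0"
        then have "single 0 \<in> I" using rideal_scale_iff[OF I, of "f 0" "single 0"] f(1) feq by simp
        then show False using proper by simp
      qed
      then show ?thesis using feq by simp
    qed
    ultimately show ?thesis using S(1) XA by (intro exI[of _ S] exI[of _ ?X]) auto
  next
    case False
    from infinite_standard_direction[OF A I False] obtain \<phi> :: "'a \<Rightarrow> real" where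
      \<phi>: "\<And>a b. \<phi> (a - b) = \<phi> a - \<phi> b" and "\<exists>a\<in>A. \<phi> a \<noteq> 0" and
      top: "\<And>g. g \<in> I \<Longrightarrow> g 0 \<noteq> 0 \<Longrightarrow> \<exists>a. a \<noteq> 0 \<and> g a \<noteq> 0 \<and> 0 \<le> \<phi> a" by blast
    then obtain a where a: "a \<in> A" "\<phi> a \<noteq> 0" by blast
    let ?A = "{a \<in> A. \<phi> a = 0}" and ?I = "top_ideal \<phi> A I"
    have \<phi>0: "\<phi> 0 = 0" using \<phi>[of 0 0] by simp
    have A0: "subgrp ?A" using A \<phi> \<phi>0 by (auto simp: subgrp_def)
    have ins: "card X < m" if X: "indep X" "X \<subseteq> ?A" for X
    proof -
      \<comment> \<open>\<open>\<phi>\<close> vanishes on the isolator of \<open>X\<close>, as the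
        reals have no torsion, but not at \<open>a\<close>; so the kernel has smaller rank.\<close>
      have "a \<notin> isolator X"
      proof
        assume "a \<in> isolator X"
        then obtain l where l: "l \<noteq> 0" "zsc l a \<in> zspan X" by (auto simp: isolator_def)
        have "zsc l a \<in> ?A"
          using l(2) X(2) subgrp_zero[OF A0] subgrp_add[OF A0] subgrp_zsc[OF A0] by (rule zspan_minimal)
        moreover have "\<phi> (zsc l a) = of_int l * \<phi> a"
        proof (induction l rule: int_induct[where k = 0])
          case (step1 i)
          have "zsc (i + 1) a - zsc i a = a" by (simp add: zsc_add)
          then have "\<phi> a = \<phi> (zsc (i + 1) a) - \<phi> (zsc i a)" using \<phi>[of "zsc (i + 1) a" "zsc i a"] by simp
          then show ?case using step1 by (simp add: algebra_simps)
        qed (simp_all add: \<phi>0 zsc_diff \<phi> algebra_simps)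
        ultimately show False using a l by simp
      qed
      from indep_insert[OF X(1) this] have "card (insert a X) = Suc (card X)" "indep (insert a X)"
        using X(1) by (auto simp: indep_def)
      moreover have "insert a X \<subseteq> A" using X(2) a(1) by blast
      ultimately show ?thesis using less.prems(1)[of "insert a X"] by simp
    qed
    then have "m > 0" using ins[of "{}"] by simp
    moreover have "card X \<le> m - 1" if "indep X" "X \<subseteq> ?A" for X using ins[OF that] by linarith
    \<comment> \<open>The direction was chosen for this: an element of \<open>I\<close> with leading
      form \<open>single 0\<close> would have \<open>\<phi>\<close> negative at every exponent other
      than 0.\<close>
    moreover have "single 0 \<notin> ?I"
    proof
      assume "single 0 \<in> ?I"
      then obtain g where g: "g \<in> I" "\<forall>a. 0 < \<phi> a \<longrightarrow> g a = 0" "\<forall>a. \<phi> a = 0 \<longrightarrow> g a = single 0 a"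
        unfolding top_ideal_def by blast
      then have "g 0 \<noteq> 0" using \<phi>0 by (simp add: single_def)
      then obtain c where "c \<noteq> 0" "g c \<noteq> 0" "0 \<le> \<phi> c" using top[OF g(1)] by blast
      then show False using g(2,3) by (cases "\<phi> c = 0") (auto simp: single_def)
    qed
    ultimately obtain S X where "S \<subseteq> {..<n}" "indep X" "X \<subseteq> ?A" "isotropic X" "n \<le> card X + card S"
      and S: "\<And>f. f \<in> ?I \<Longrightarrow> supp f \<subseteq> coord_sub S \<Longrightarrow> f = (\<lambda>_. 0)"
      using less.IH[of "m - 1" ?A ?I] A0 top_ideal_rideal[OF I \<phi>] by auto
    then show ?thesis using top_ideal_detects[OF A I \<phi> S] by blast
  qed
qed

end

subsection \<open>Cones in the positive orthant\<close>

text \<open>Dickson's lemma in sequence form. A nonincreasing sequence of nonnegative integers is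
  eventually constant, so a monotone subsequence can always be taken nondecreasing, one index after
  another.\<close>

lemma common_incseq_subsequence:
  fixes f :: "'i \<Rightarrow> nat \<Rightarrow> int"
  assumes "finite P" "\<And>i k. i \<in> P \<Longrightarrow> 0 \<le> f i k"
  shows "\<exists>r::nat \<Rightarrow> nat. strict_mono r \<and> (\<forall>i\<in>P. incseq (\<lambda>k. f i (r k)))"
  using assms
proof (induction P rule: finite_induct)
  case empty
  show ?case by (auto intro: exI[of _ id] simp: strict_mono_def)
next
  case (insert i P)
  then obtain r where r: "strict_mono r" "\<forall>j\<in>P. incseq (\<lambda>k. f j (r k))" by blast
  define g where "g k = f i (r k)" for k
  have g0: "0 \<le> g k" for k using insert.prems[of i] by (simp add: g_def)
  obtain s where s: "strict_mono (s::nat \<Rightarrow> nat)" "monoseq (\<lambda>k. g (s k))"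
    using seq_monosub by blast
  have "\<exists>q::nat \<Rightarrow> nat. strict_mono q \<and> incseq (\<lambda>k. g (q k))"
  proof (cases "incseq (\<lambda>k. g (s k))")
    case True
    then show ?thesis using s(1) by blast
  next
    case False
    then have dec: "decseq (\<lambda>k. g (s k))" using s(2) by (simp add: monoseq_iff)
    obtain m where m: "\<And>k. nat (g (s m)) \<le> nat (g (s k))"
      using ex_has_least_nat[of "\<lambda>_. True" _ "\<lambda>k. nat (g (s k))"] by blast
    have const: "g (s (m + k)) = g (s m)" for k
      using decseqD[OF dec, of m "m + k"] m[of "m + k"] g0[of "s m"] g0[of "s (m + k)"] by simp
    have "strict_mono (\<lambda>k. s (m + k))" using s(1) by (simp add: strict_mono_def)
    then show ?thesis using const by (intro exI[of _ "\<lambda>k. s (m + k)"]) (simp add: incseq_def)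
  qed
  then obtain q where q: "strict_mono (q::nat \<Rightarrow> nat)" "incseq (\<lambda>k. g (q k))" by blast
  have "incseq (\<lambda>k. f j (r (q k)))" if "j \<in> P" for j
    using r(2) that strict_mono_mono[OF q(1)] by (auto simp: incseq_def mono_def)
  moreover have "strict_mono (\<lambda>k. r (q k))" using r(1) q(1) by (simp add: strict_mono_def)
  ultimately show ?case using q(2) by (intro exI[of _ "\<lambda>k. r (q k)"]) (auto simp: g_def)
qed

context lattice
begin

definition nonneg :: "'a set" where
  "nonneg = {a. \<forall>i<n. 0 \<le> coord a i}"

definition cone :: "nat set \<Rightarrow> 'a set" where
  "cone S = nonneg \<inter> coord_sub S"

definition cle :: "'a \<Rightarrow> 'a \<Rightarrow> bool" where
  "cle a b \<longleftrightarrow> (\<forall>i<n. coord a i \<le> coord b i)"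

definition upset :: "'a set \<Rightarrow> bool" where
  "upset U \<longleftrightarrow> U \<subseteq> nonneg \<and> (\<forall>a\<in>U. \<forall>b. cle a b \<longrightarrow> b \<in> U)"

definition has_cone :: "nat \<Rightarrow> 'a set \<Rightarrow> bool" where
  "has_cone k E \<longleftrightarrow> (\<exists>u S. S \<subseteq> {..<n} \<and> card S = k \<and> (\<forall>a\<in>cone S. u + a \<in> E))"

lemma nonneg_add: "a \<in> nonneg \<Longrightarrow> b \<in> nonneg \<Longrightarrow> a + b \<in> nonneg"
  by (simp add: nonneg_def coord_add)

lemma zero_cone [simp]: "0 \<in> cone S"
  by (simp add: cone_def nonneg_def coord_sub_def)

lemma incseq_coord_subsequence:
  assumes "\<And>k. w k \<in> nonneg"
  shows "\<exists>r::nat \<Rightarrow> nat. strict_mono r \<and> (\<forall>i<n. incseq (\<lambda>k. coord (w (r k)) i))"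
  using common_incseq_subsequence[of "{..<n}" "\<lambda>i k. coord (w k) i"] assms
  by (auto simp: nonneg_def)

text \<open>Given points with \<open>h\<close> coordinates above every threshold, a subsequence uses
  one fixed set of \<open>h\<close> coordinates and is nondecreasing. The cone at its initial point
  stays in \<open>U\<close>, which is closed upwards, and below later points, which avoid
  \<open>V\<close>.\<close>

lemma bounded_large_coordinates:
  assumes U: "upset U" and V: "upset V" and no: "\<not> has_cone h (U - V)"
  shows "\<exists>c::nat. \<forall>e\<in>U - V. card {i. i < n \<and> int c \<le> coord e i} < h"
proof (rule ccontr)
  assume "\<not> ?thesis"
  then have "\<forall>c::nat. \<exists>e\<in>U - V. h \<le> card {i. i < n \<and> int c \<le> coord e i}" by (meson not_le)
  then obtain e where e: "\<And>c::nat. e c \<in> U - V" "\<And>c. h \<le> card {i. i < n \<and> int c \<le> coord (e c) i}" by metis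
  have "\<forall>c. \<exists>T. T \<subseteq> {i. i < n \<and> int c \<le> coord (e c) i} \<and> card T = h"
  proof
    fix c
    show "\<exists>T. T \<subseteq> {i. i < n \<and> int c \<le> coord (e c) i} \<and> card T = h"
      using obtain_subset_with_card_n[OF e(2)[of c]] by blast
  qed
  from choice[OF this] obtain T where T: "\<And>c. T c \<subseteq> {i. i < n \<and> int c \<le> coord (e c) i}" "\<And>c. card (T c) = h" by blast
  have "finite (range T)" by (rule finite_subset[of _ "Pow {..<n}"]) (use T(1) in auto)
  then obtain c0 where "infinite {c. T c = T c0}"
    using pigeonhole_infinite[of "UNIV :: nat set" T] by auto
  then obtain r where r: "strict_mono (r::nat \<Rightarrow> nat)" "\<And>k. T (r k) = T c0"
    using infinite_enumerate[of "{c. T c = T c0}"] by auto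
  have "e c \<in> nonneg" for c using e(1)[of c] U by (auto simp: upset_def)
  then obtain s where s: "strict_mono (s::nat \<Rightarrow> nat)" "\<And>i. i < n \<Longrightarrow> incseq (\<lambda>k. coord (e (r (s k))) i)"
    using incseq_coord_subsequence[of "\<lambda>k. e (r k)"] by auto
  define w where "w k = e (r (s k))" for k
  have "w 0 + a \<in> U - V" if a: "a \<in> cone (T c0)" for a
  proof
    have "cle (w 0) (w 0 + a)" using a by (auto simp: cle_def coord_add cone_def nonneg_def)
    then show "w 0 + a \<in> U" using U e(1) by (auto simp: upset_def w_def)
    \<comment> \<open>A bound for all coordinates of \<open>w 0 + a\<close>; the coordinates of
      \<open>w k\<close> in \<open>T c0\<close> are at least \<open>k\<close>.\<close>
    define k where "k = nat (\<Sum>i<n. \<bar>coord (w 0 + a) i\<bar>)"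
    have "coord (w 0 + a) i \<le> coord (w k) i" if i: "i < n" for i
    proof (cases "i \<in> T c0")
      case True
      have "coord (w 0 + a) i \<le> \<bar>coord (w 0 + a) i\<bar>" by simp
      also have "\<dots> \<le> (\<Sum>i<n. \<bar>coord (w 0 + a) i\<bar>)" using i by (intro member_le_sum) auto
      also have "\<dots> \<le> int k" by (simp add: k_def)
      also have "\<dots> \<le> int (r (s k))"
        using seq_suble[OF r(1), of "s k"] seq_suble[OF s(1), of k] by simp
      also have "\<dots> \<le> coord (w k) i" using T(1)[of "r (s k)"] True r(2) by (auto simp: w_def)
      finally show ?thesis .
    next
      case False
      then have "coord (w 0 + a) i = coord (w 0) i"
        using a i by (simp add: coord_add cone_def coord_sub_def)
      also have "\<dots> \<le> coord (w k) i" using incseqD[OF s(2)[OF i], of 0 k] by (simp add: w_def)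
      finally show ?thesis .
    qed
    then have "cle (w 0 + a) (w k)" by (simp add: cle_def)
    then show "w 0 + a \<notin> V" using V e(1)[of "r (s k)"] by (auto simp: upset_def w_def)
  qed
  moreover have "T c0 \<subseteq> {..<n}" using T(1)[of c0] by auto
  ultimately have "has_cone h (U - V)" unfolding has_cone_def using T(2) by blast
  then show False using no by simp
qed

text \<open>The combinatorial form of one deviation step. Pass to cones with a common
  \<open>S\<close> and nondecreasing base points. Disjointness of the differences keeps base points
  from agreeing outside \<open>S\<close>, so some coordinate \<open>j\<close> outside
  \<open>S\<close> is unbounded along them; it becomes the extra direction of the larger
  cone.\<close>

lemma infinitely_many_cones:
  assumes T: "\<And>i. upset (T i)" "\<And>i. T (Suc i) \<subseteq> T i" and UV: "upset U" "upset V" "\<And>i. T i \<subseteq> U" "\<And>i. V \<subseteq> T i"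
    and inf: "infinite {i. has_cone g (T i - T (Suc i))}"
  shows "has_cone (Suc g) (U - V)"
proof -
  let ?C = "{i. has_cone g (T i - T (Suc i))}"
  have anti: "T j \<subseteq> T i" if "i \<le> j" for i j using lift_Suc_antimono_le[of T i j] T(2) that by blast
  have "\<forall>i\<in>?C. \<exists>u S. S \<subseteq> {..<n} \<and> card S = g \<and> (\<forall>a\<in>cone S. u + a \<in> T i - T (Suc i))"
    by (simp add: has_cone_def)
  from bchoice[OF this] obtain u where
    "\<forall>i\<in>?C. \<exists>S. S \<subseteq> {..<n} \<and> card S = g \<and> (\<forall>a\<in>cone S. u i + a \<in> T i - T (Suc i))" ..
  from bchoice[OF this] obtain S where
    uS: "\<forall>i\<in>?C. S i \<subseteq> {..<n} \<and> card (S i) = g \<and> (\<forall>a\<in>cone (S i). u i + a \<in> T i - T (Suc i))" ..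
  have u: "S i \<subseteq> {..<n}" "card (S i) = g" "\<And>a. a \<in> cone (S i) \<Longrightarrow> u i + a \<in> T i - T (Suc i)"
    if "i \<in> ?C" for i using bspec[OF uS that] by blast+
  have "finite (S ` ?C)" by (rule finite_subset[of _ "Pow {..<n}"]) (use u(1) in auto)
  then obtain i0 where i0: "i0 \<in> ?C" "infinite {i \<in> ?C. S i = S i0}"
    using pigeonhole_infinite[OF inf] by blast
  then obtain r where r: "strict_mono (r::nat \<Rightarrow> nat)" "\<And>k. r k \<in> ?C" "\<And>k. S (r k) = S i0"
    using infinite_enumerate[OF i0(2)] by auto
  have "u i \<in> nonneg" if "i \<in> ?C" for i
    using u(3)[OF that zero_cone] T(1)[of i] by (auto simp: upset_def)
  then obtain s where s: "strict_mono (s::nat \<Rightarrow> nat)" "\<And>i. i < n \<Longrightarrow> incseq (\<lambda>k. coord (u (r (s k))) i)"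
    using incseq_coord_subsequence[of "\<lambda>k. u (r k)"] r(2) by blast
  define w where "w k = u (r (s k))" for k
  define t where "t k = r (s k)" for k
  have tm: "strict_mono t" using r(1) s(1) by (simp add: t_def strict_mono_def)
  have w: "w k + a \<in> T (t k) - T (Suc (t k))" if "a \<in> cone (S i0)" for k a
    using u(3)[OF r(2), of a "s k"] that r(3) by (simp add: w_def t_def)
  have inc: "coord (w k) i \<le> coord (w l) i" if "i < n" "k \<le> l" for i k l
    using incseqD[OF s(2)[OF that(1)] that(2)] by (simp add: w_def)
  text \<open>Two cones with the same coordinates outside \<open>S i0\<close> would meet.\<close>
  have distinct: "\<exists>i<n. i \<notin> S i0 \<and> coord (w k) i \<noteq> coord (w l) i" if "k < l" for k l
  proof (rule ccontr)
    assume "\<not> ?thesis"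
    then have eq: "coord (w k) i = coord (w l) i" if "i < n" "i \<notin> S i0" for i using that by blast
    have "w l - w k \<in> cone (S i0)"
      using eq inc[of _ k l] \<open>k < l\<close> by (auto simp: cone_def nonneg_def coord_sub_def coord_diff)
    then have "w k + (w l - w k) \<notin> T (Suc (t k))" using w by blast
    then have "w l \<notin> T (Suc (t k))" by simp
    moreover have "w l \<in> T (t l)" using w[OF zero_cone, of l] by simp
    moreover have "Suc (t k) \<le> t l" using tm \<open>k < l\<close> by (simp add: strict_mono_def Suc_leI)
    ultimately show False using anti by blast
  qed
  have "\<exists>j<n. j \<notin> S i0 \<and> (\<forall>B. \<exists>k. B < coord (w k) j)"
  proof (rule ccontr)
    assume "\<not> ?thesis"
    then have "\<forall>j\<in>{..<n} - S i0. \<exists>B. \<forall>k. coord (w k) j \<le> B"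
      unfolding not_less[symmetric] by blast
    from bchoice[OF this] obtain B where B: "\<And>j k. j \<in> {..<n} - S i0 \<Longrightarrow> coord (w k) j \<le> B j" by blast
    \<comment> \<open>The coordinate sum outside \<open>S i0\<close> grows strictly, which is
      impossible if each of these coordinates is bounded.\<close>
    define m where "m k = (\<Sum>j\<in>{..<n} - S i0. coord (w k) j)" for k
    have step: "m k + 1 \<le> m (Suc k)" for k
    proof -
      obtain i where i: "i < n" "i \<notin> S i0" "coord (w k) i \<noteq> coord (w (Suc k)) i"
        using distinct[of k "Suc k"] by blast
      have "m k < m (Suc k)" unfolding m_def
      proof (rule sum_strict_mono_ex1)
        show "\<exists>a\<in>{..<n} - S i0. coord (w k) a < coord (w (Suc k)) a"
          using i inc[of i k "Suc k"] by (intro bexI[of _ i]) auto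
      qed (use inc[of _ k "Suc k"] in auto)
      then show ?thesis by simp
    qed
    have "m 0 + int k \<le> m k" for k
    proof (induction k)
      case (Suc k)
      then show ?case using step[of k] by simp
    qed simp
    moreover have "m k \<le> (\<Sum>j\<in>{..<n} - S i0. B j)" for k unfolding m_def using B by (intro sum_mono) auto
    ultimately have "m 0 + int k \<le> (\<Sum>j\<in>{..<n} - S i0. B j)" for k using order_trans by blast
    from this[of "nat ((\<Sum>j\<in>{..<n} - S i0. B j) - m 0 + 1)"] show False by linarith
  qed
  then obtain j where j: "j < n" "j \<notin> S i0" "\<And>B. \<exists>k. B < coord (w k) j" by blast
  have "w 0 + a \<in> U - V" if a: "a \<in> cone (insert j (S i0))" for a
  proof
    have "w 0 \<in> U" using w[OF zero_cone, of 0] UV(3) by auto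
    moreover have "cle (w 0) (w 0 + a)" using a by (auto simp: cle_def coord_add cone_def nonneg_def)
    ultimately show "w 0 + a \<in> U" using UV(1) by (auto simp: upset_def)
    obtain k where k: "coord (w 0 + a) j < coord (w k) j" using j(3) by blast
    \<comment> \<open>Inside the cone at \<open>w k\<close> one may move arbitrarily far along
      \<open>S i0\<close>; \<open>b\<close> does so to dominate \<open>w 0 + a\<close>
      there.\<close>
    obtain b where b: "\<And>i. i < n \<Longrightarrow> coord b i = (if i \<in> S i0 then \<bar>coord (w 0 + a) i\<bar> + \<bar>coord (w k) i\<bar> else 0)"
      using coord_surj[of "\<lambda>i. if i \<in> S i0 then \<bar>coord (w 0 + a) i\<bar> + \<bar>coord (w k) i\<bar> else 0"] by blast
    have "b \<in> cone (S i0)" using b by (auto simp: cone_def nonneg_def coord_sub_def)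
    then have notin: "w k + b \<notin> V" using w UV(4) by blast
    have "coord (w 0 + a) i \<le> coord (w k + b) i" if i: "i < n" for i
    proof -
      consider "i \<in> S i0" | "i = j" | "i \<notin> insert j (S i0)" by blast
      then show ?thesis
      proof cases
        case 1
        then show ?thesis using b[OF i] by (simp add: coord_add[of "w k" b])
      next
        case 2
        then show ?thesis using b[OF i] j k by (simp add: coord_add[of "w k" b])
      next
        case 3
        then have "coord a i = 0" using a i by (simp add: cone_def coord_sub_def)
        then show ?thesis using 3 b[OF i] inc[OF i, of 0 k] by (simp add: coord_add)
      qed
    qed
    then have "cle (w 0 + a) (w k + b)" by (simp add: cle_def)
    then show "w 0 + a \<notin> V" using notin UV(2) by (auto simp: upset_def)
  qed
  moreover have "insert j (S i0) \<subseteq> {..<n}" using u(1)[OF i0(1)] j by auto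
  moreover have "card (insert j (S i0)) = Suc g"
    using j(2) u(1,2)[OF i0(1)] by (simp add: finite_subset)
  ultimately show ?thesis unfolding has_cone_def by blast
qed

definition deg :: "'a \<Rightarrow> int" where
  "deg a = (\<Sum>i<n. coord a i)"

lemma deg_add: "deg (a + b) = deg a + deg b"
  by (simp add: deg_def coord_add sum.distrib)

lemma coord_le_deg: "a \<in> nonneg \<Longrightarrow> i < n \<Longrightarrow> coord a i \<le> deg a"
  unfolding deg_def by (rule member_le_sum) (auto simp: nonneg_def)

lemma finite_deg: "finite {a \<in> nonneg. deg a \<le> D}"
proof (rule finite_subset)
  show "{a \<in> nonneg. deg a \<le> D} \<subseteq> {a. \<forall>i<n. 0 \<le> coord a i \<and> coord a i \<le> D}"
  proof (intro subsetI CollectI allI impI)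
    fix a i assume "a \<in> {a \<in> nonneg. deg a \<le> D}" "i < n"
    then show "0 \<le> coord a i \<and> coord a i \<le> D" using coord_le_deg[of a i] by (auto simp: nonneg_def)
  qed
qed (rule finite_coord_box)

text \<open>Growth of degree \<open>h - 1\<close>: the large coordinates, fewer than
  \<open>h\<close> of them, are chosen in at most \<open>2 ^ n\<close> ways and range up to
  \<open>D\<close>, while each of the others takes at most \<open>c\<close> values.\<close>

lemma card_few_large_coordinates:
  assumes E: "E \<subseteq> nonneg" and c: "0 < c" and few: "\<And>e. e \<in> E \<Longrightarrow> card {i. i < n \<and> int c \<le> coord e i} < h"
  shows "card {e \<in> E. deg e \<le> int D} \<le> 2 ^ n * (c ^ n * (D + 1) ^ (h - 1))"
proof -
  define B where "B T = {e \<in> nonneg. \<forall>i<n. coord e i \<le> (if i \<in> T then int D else int c - 1)}" for T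
  let ?\<T> = "{T \<in> Pow {..<n}. card T < h}"
  have cardB: "card (B T) \<le> c ^ n * (D + 1) ^ (h - 1)" and finB: "finite (B T)" if T: "T \<in> ?\<T>" for T
  proof -
    let ?P = "PiE {..<n} (\<lambda>i. {0..if i \<in> T then int D else int c - 1})"
    have finP: "finite ?P" by (intro finite_PiE) auto
    have inj: "inj_on (\<lambda>e. restrict (coord e) {..<n}) (B T)"
    proof (rule inj_onI)
      fix a b assume e: "restrict (coord a) {..<n} = restrict (coord b) {..<n}"
      have "coord a i = coord b i" if "i < n" for i
        using fun_cong[OF e, of i] that by simp
      then show "a = b" by (rule coord_inj)
    qed
    have sub: "(\<lambda>e. restrict (coord e) {..<n}) ` B T \<subseteq> ?P"
      by (auto simp: B_def nonneg_def split: if_splits)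
    show "finite (B T)" using inj finite_subset[OF sub finP] by (rule finite_imageD[rotated])
    have "card (B T) \<le> card ?P" using inj sub finP by (rule card_inj_on_le)
    also have "\<dots> = (\<Prod>i<n. if i \<in> T then D + 1 else c)"
      unfolding card_PiE[OF finite_lessThan] by (rule prod.cong) (use c in auto)
    also have "\<dots> = (D + 1) ^ card T * c ^ card ({..<n} - T)"
      using T by (simp add: prod.If_cases Int_absorb1 Diff_eq)
    also have "\<dots> \<le> (D + 1) ^ (h - 1) * c ^ n"
    proof (rule mult_le_mono)
      show "(D + 1) ^ card T \<le> (D + 1) ^ (h - 1)" using T by (intro power_increasing) auto
      have "card ({..<n} - T) \<le> n" using card_mono[of "{..<n}" "{..<n} - T"] by auto
      then show "c ^ card ({..<n} - T) \<le> c ^ n" using c by (intro power_increasing) auto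
    qed
    finally show "card (B T) \<le> c ^ n * (D + 1) ^ (h - 1)" by (simp add: mult.commute)
  qed
  have "{e \<in> E. deg e \<le> int D} \<subseteq> (\<Union>T\<in>?\<T>. B T)"
  proof
    fix e assume e: "e \<in> {e \<in> E. deg e \<le> int D}"
    let ?T = "{i. i < n \<and> int c \<le> coord e i}"
    have "coord e i \<le> int D" if "i < n" for i using coord_le_deg[of e i] e E that by auto
    then have "e \<in> B ?T" using e E by (auto simp: B_def)
    moreover have "?T \<in> ?\<T>" using few[of e] e by auto
    ultimately show "e \<in> (\<Union>T\<in>?\<T>. B T)" by blast
  qed
  then have "card {e \<in> E. deg e \<le> int D} \<le> card (\<Union>T\<in>?\<T>. B T)"
    using finB by (intro card_mono finite_UN_I) auto
  also have "\<dots> \<le> (\<Sum>T\<in>?\<T>. card (B T))" by (rule card_UN_le) simp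
  also have "\<dots> \<le> card ?\<T> * (c ^ n * (D + 1) ^ (h - 1))"
    using sum_bounded_above[of ?\<T> "\<lambda>T. card (B T)"] cardB by (simp add: mult.commute)
  also have "\<dots> \<le> 2 ^ n * (c ^ n * (D + 1) ^ (h - 1))"
  proof (rule mult_le_mono1)
    have "card ?\<T> \<le> card (Pow {..<n})" by (intro card_mono) auto
    then show "card ?\<T> \<le> 2 ^ n" by (simp add: card_Pow)
  qed
  finally show ?thesis .
qed

lemma card_cone_box:
  assumes "S \<subseteq> {..<n}"
  shows "(t + 1) ^ card S \<le> card {s \<in> cone S. \<forall>i<n. coord s i \<le> int t}"
    and "finite {s \<in> cone S. \<forall>i<n. coord s i \<le> int t}"
proof -
  let ?B = "{s \<in> cone S. \<forall>i<n. coord s i \<le> int t}"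
  show fin: "finite ?B"
    by (rule finite_subset[OF _ finite_coord_box[of 0 "int t"]]) (auto simp: cone_def nonneg_def)
  have "\<forall>f. \<exists>a. \<forall>i<n. coord a i = (if i \<in> S then f i else 0)"
    by (intro allI coord_surj)
  from choice[OF this] obtain p where p: "\<And>f i. i < n \<Longrightarrow> coord (p f) i = (if i \<in> S then f i else 0)" by blast
  let ?P = "PiE S (\<lambda>_. {0..int t})"
  have "inj_on p ?P"
  proof (rule inj_onI)
    fix f g assume fg: "f \<in> ?P" "g \<in> ?P" "p f = p g"
    show "f = g"
    proof (rule PiE_ext[OF fg(1,2)])
      fix i assume "i \<in> S"
      then show "f i = g i" using p[of i f] p[of i g] fg(3) assms by auto
    qed
  qed
  moreover have "p ` ?P \<subseteq> ?B"
    using p assms by (auto simp: cone_def nonneg_def coord_sub_def)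
  ultimately have "card ?P \<le> card ?B" using fin by (rule card_inj_on_le)
  moreover have "card ?P = (t + 1) ^ card S"
    using finite_subset[OF assms finite_lessThan] by (simp add: card_PiE nat_add_distrib)
  ultimately show "(t + 1) ^ card S \<le> card ?B" by simp
qed

end

context lattice
begin

subsection \<open>A graded monomial order\<close>

text \<open>The coordinates only break ties of the degree. With the degree in front, only finitely
  many nonnegative exponents precede a given one, so that \<open>idx\<close> can serve as an
  induction measure.\<close>

definition key :: "'a \<Rightarrow> nat \<Rightarrow> int" where
  "key x i = (case i of 0 \<Rightarrow> deg x | Suc j \<Rightarrow> coord x j)"

definition lt :: "'a \<Rightarrow> 'a \<Rightarrow> bool" where
  "lt a b \<longleftrightarrow> (\<exists>i\<le>n. key a i < key b i \<and> (\<forall>j<i. key a j = key b j))"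

lemma key_add: "key (a + b) i = key a i + key b i"
  by (simp add: key_def deg_add coord_add split: nat.split)

lemma lt_irrefl [simp]: "\<not> lt a a" by (simp add: lt_def)

lemma lt_trans: "lt a b \<Longrightarrow> lt b c \<Longrightarrow> lt a c"
proof -
  assume "lt a b" "lt b c"
  then obtain i j where ij: "i \<le> n" "key a i < key b i" "\<forall>l<i. key a l = key b l"
    "j \<le> n" "key b j < key c j" "\<forall>l<j. key b l = key c l" by (auto simp: lt_def)
  have "key a (min i j) < key c (min i j)"
    using ij by (cases i j rule: linorder_cases) (auto simp: min_def)
  moreover have "\<forall>l<min i j. key a l = key c l" using ij by simp
  ultimately show ?thesis using ij unfolding lt_def by (intro exI[of _ "min i j"]) auto
qed

lemma lt_total: "a \<noteq> b \<Longrightarrow> lt a b \<or> lt b a"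
proof -
  assume "a \<noteq> b"
  then obtain i where "i < n" "coord a i \<noteq> coord b i" using coord_inj[of a b] by blast
  then have ex: "Suc i \<le> n \<and> key a (Suc i) \<noteq> key b (Suc i)" by (simp add: key_def)
  define m where "m = (LEAST i. i \<le> n \<and> key a i \<noteq> key b i)"
  have m: "m \<le> n \<and> key a m \<noteq> key b m" unfolding m_def by (rule LeastI[of _ "Suc i"]) (rule ex)
  have "key a j = key b j" if "j < m" for j
    using not_less_Least[of j "\<lambda>i. i \<le> n \<and> key a i \<noteq> key b i"] that m by (auto simp: m_def)
  then show ?thesis using m unfolding lt_def by (metis linorder_neqE)
qed

lemma lt_add_right [simp]: "lt (a + c) (b + c) \<longleftrightarrow> lt a b"
  by (simp add: lt_def key_add)

lemma lt_deg: "lt a b \<Longrightarrow> deg a \<le> deg b"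
proof -
  assume "lt a b"
  then obtain i where i: "key a i < key b i" "\<forall>j<i. key a j = key b j" by (auto simp: lt_def)
  have "key a 0 \<le> key b 0" using i by (cases i) auto
  then show ?thesis by (simp add: key_def)
qed

definition idx :: "'a \<Rightarrow> nat" where
  "idx b = card {c \<in> nonneg. lt c b}"

lemma idx_less:
  assumes "a \<in> nonneg" "lt a b"
  shows "idx a < idx b"
  unfolding idx_def
proof (rule psubset_card_mono)
  show "finite {c \<in> nonneg. lt c b}"
    by (rule finite_subset[OF _ finite_deg[of "deg b"]]) (auto dest: lt_deg)
  show "{c \<in> nonneg. lt c a} \<subset> {c \<in> nonneg. lt c b}"
  proof (rule psubsetI)
    show "{c \<in> nonneg. lt c a} \<subseteq> {c \<in> nonneg. lt c b}" using assms(2) lt_trans by blast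
    have "a \<in> {c \<in> nonneg. lt c b}" "a \<notin> {c \<in> nonneg. lt c a}" using assms by auto
    then show "{c \<in> nonneg. lt c a} \<noteq> {c \<in> nonneg. lt c b}" by blast
  qed
qed

end

context twisted_lattice
begin

section \<open>Leading exponents, division with remainder and growth\<close>

definition is_lead :: "('a \<Rightarrow> 'f) \<Rightarrow> 'a \<Rightarrow> bool" where
  "is_lead f a \<longleftrightarrow> supp f \<subseteq> nonneg \<and> f a \<noteq> 0 \<and> (\<forall>b. f b \<noteq> 0 \<longrightarrow> b \<noteq> a \<longrightarrow> lt b a)"

text \<open>Only elements supported in the positive orthant are recorded; a basis unit moves any
  element into the orthant without leaving its right ideal.\<close>

definition leads :: "('a \<Rightarrow> 'f) set \<Rightarrow> 'a set" where
  "leads K = {a. \<exists>f\<in>K. is_lead f a}"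

lemma leads_mono: "J \<subseteq> I \<Longrightarrow> leads J \<subseteq> leads I"
  by (auto simp: leads_def)

lemma upset_leads:
  assumes K: "rideal UNIV K"
  shows "upset (leads K)"
  unfolding upset_def
proof (intro conjI ballI allI impI subsetI)
  fix a assume "a \<in> leads K"
  then obtain f where f: "f \<in> K" "is_lead f a" by (auto simp: leads_def)
  then show "a \<in> nonneg" by (auto simp: is_lead_def)
  fix b assume ab: "cle a b"
  have "b - a \<in> nonneg" using ab by (simp add: nonneg_def cle_def coord_diff)
  have "is_lead (rsh (b - a) f) b"
    unfolding is_lead_def
  proof (intro conjI allI impI)
    show "supp (rsh (b - a) f) \<subseteq> nonneg"
      using f(2) \<open>b - a \<in> nonneg\<close> unfolding supp_rsh is_lead_def by (auto intro: nonneg_add)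
    show "rsh (b - a) f b \<noteq> 0" using f(2) by (simp add: rsh_def is_lead_def)
    fix c assume c: "rsh (b - a) f c \<noteq> 0" "c \<noteq> b"
    then have "f (c - (b - a)) \<noteq> 0" by (simp add: rsh_def)
    moreover have "c - (b - a) \<noteq> a" using c(2) by auto
    ultimately have "lt (c - (b - a)) a" using f(2) unfolding is_lead_def by blast
    then have "lt (c - (b - a) + (b - a)) (a + (b - a))" by (simp only: lt_add_right)
    then show "lt c b" by simp
  qed
  then show "b \<in> leads K" using ridealD(6)[OF K f(1)] by (auto simp: leads_def)
qed

text \<open>Division with remainder: the leading term of \<open>f\<close> is cancelled by an element
  of \<open>J\<close> if possible and by a \<open>g e\<close> otherwise. The order is graded, so
  degrees never exceed \<open>D\<close> and finitely many \<open>g e\<close> suffice.\<close>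

lemma lead_reduction:
  assumes J: "rideal UNIV J" and I: "rideal UNIV I"
    and g: "\<And>e. e \<in> leads I - leads J \<Longrightarrow> g e \<in> I \<and> is_lead (g e) e"
    and f: "f \<in> I" "supp f \<subseteq> {a \<in> nonneg. deg a \<le> D}" and JI: "J \<subseteq> I"
  shows "\<exists>c. (\<lambda>x. f x - (\<Sum>e | e \<in> leads I - leads J \<and> deg e \<le> D. c e * g e x)) \<in> J"
proof -
  let ?E = "{e. e \<in> leads I - leads J \<and> deg e \<le> D}"
  have "leads I \<subseteq> nonneg" using upset_leads[OF I] by (simp add: upset_def)
  then have finE: "finite ?E" by (intro finite_subset[OF _ finite_deg[of D]]) auto
  have "\<exists>c. (\<lambda>x. f x - (\<Sum>e\<in>?E. c e * g e x)) \<in> J" if "\<forall>b\<in>supp f. idx b < N" for N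
    using that f
  proof (induction N arbitrary: f)
    case 0
    then have "f = (\<lambda>_. 0)" by auto
    then show ?case using ridealD(3)[OF J] by (intro exI[of _ "\<lambda>_. 0"]) simp
  next
    case (Suc N)
    show ?case
    proof (cases "\<exists>a\<in>supp f. idx a = N")
      case False
      then have "\<forall>b\<in>supp f. idx b < N" using Suc.prems(1) by (metis less_SucE)
      then show ?thesis using Suc.IH Suc.prems by blast
    next
      case True
      then obtain a where a: "f a \<noteq> 0" "idx a = N" by auto
      have aD: "a \<in> nonneg" "deg a \<le> D" using Suc.prems(3) a(1) by auto
      have small: "lt b a" if "f b \<noteq> 0" "b \<noteq> a" for b
      proof -
        have "\<not> lt a b" using idx_less[OF aD(1), of b] a(2) that(1) Suc.prems(1) by auto
        then show ?thesis using lt_total that(2) by blast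
      qed
      have lead: "is_lead f a" using Suc.prems(3) a(1) small by (auto simp: is_lead_def)
      have reduce: "\<forall>b\<in>supp (\<lambda>x. f x - (f a / h a) * h x). idx b < N"
        "supp (\<lambda>x. f x - (f a / h a) * h x) \<subseteq> {a \<in> nonneg. deg a \<le> D}"
        if h: "is_lead h a" for h
      proof -
        have *: "b \<in> nonneg \<and> lt b a" if b: "f b - (f a / h a) * h b \<noteq> 0" for b
        proof -
          have ba: "b \<noteq> a" using b h by (auto simp: is_lead_def)
          have "f b \<noteq> 0 \<or> h b \<noteq> 0" using b by auto
          then show ?thesis using ba h lead by (auto simp: is_lead_def)
        qed
        then show "\<forall>b\<in>supp (\<lambda>x. f x - (f a / h a) * h x). idx b < N"
          using idx_less a(2) by auto
        show "supp (\<lambda>x. f x - (f a / h a) * h x) \<subseteq> {a \<in> nonneg. deg a \<le> D}"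
          using * aD(2) lt_deg by fastforce
      qed
      show ?thesis
      proof (cases "a \<in> leads J")
        case True
        then obtain h where h: "h \<in> J" "is_lead h a" by (auto simp: leads_def)
        have "(\<lambda>x. f x - (f a / h a) * h x) \<in> I" using h(1) JI Suc.prems(2) by (intro rideal_diff[OF I]) auto
        from Suc.IH[OF reduce(1)[OF h(2)] this reduce(2)[OF h(2)]] obtain c where
          c: "(\<lambda>x. f x - (f a / h a) * h x - (\<Sum>e\<in>?E. c e * g e x)) \<in> J" by blast
        have "(\<lambda>x. (f x - (f a / h a) * h x - (\<Sum>e\<in>?E. c e * g e x)) - (- (f a / h a)) * h x) \<in> J"
          by (rule rideal_diff[OF J c h(1)])
        then show ?thesis by (intro exI[of _ c]) (simp add: algebra_simps)
      next
        case False
        have aE: "a \<in> ?E" using False lead Suc.prems(2) aD(2) by (auto simp: leads_def)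
        then have h: "g a \<in> I" "is_lead (g a) a" using g by auto
        have "(\<lambda>x. f x - (f a / g a a) * g a x) \<in> I" by (rule rideal_diff[OF I Suc.prems(2) h(1)])
        from Suc.IH[OF reduce(1)[OF h(2)] this reduce(2)[OF h(2)]] obtain c where
          c: "(\<lambda>x. f x - (f a / g a a) * g a x - (\<Sum>e\<in>?E. c e * g e x)) \<in> J" by blast
        define c' where "c' e = c e + (if e = a then f a / g a a else 0)" for e
        have "(\<Sum>e\<in>?E. c' e * g e x) = (f a / g a a) * g a x + (\<Sum>e\<in>?E. c e * g e x)" for x
        proof -
          have "(\<Sum>e\<in>?E. (if e = a then f a / g a a else 0) * g e x) = (f a / g a a) * g a x"
            using aE finE by (subst sum.remove[of _ a]) (auto intro!: sum.neutral)
          then show ?thesis by (simp add: c'_def distrib_right sum.distrib)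
        qed
        then show ?thesis using c by (intro exI[of _ c']) (simp add: diff_diff_eq)
      qed
    qed
  qed
  moreover have "\<exists>N. \<forall>b\<in>supp f. idx b < N"
    using ridealD(1)[OF I f(1)] finite_nat_bounded[of "idx ` supp f"] by (auto simp: image_subset_iff)
  ultimately show ?thesis by blast
qed

text \<open>Modulo \<open>J\<close>, the elements of \<open>I\<close> supported in the orthant up to
  degree \<open>D\<close> are spanned by one vector for each new leading exponent of that degree
  range; a longer family is dependent.\<close>

lemma dependent_modulo:
  assumes J: "rideal UNIV J" and I: "rideal UNIV I" and JI: "J \<subseteq> I"
    and v: "finite P" "\<And>s. s \<in> P \<Longrightarrow> v s \<in> I" "\<And>s. s \<in> P \<Longrightarrow> supp (v s) \<subseteq> {a \<in> nonneg. deg a \<le> D}"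
    and card: "card {e. e \<in> leads I - leads J \<and> deg e \<le> D} < card P"
  shows "\<exists>k. (\<exists>s\<in>P. k s \<noteq> 0) \<and> (\<lambda>x. \<Sum>s\<in>P. k s * v s x) \<in> J"
proof -
  let ?E = "{e. e \<in> leads I - leads J \<and> deg e \<le> D}"
  have "leads I \<subseteq> nonneg" using upset_leads[OF I] by (simp add: upset_def)
  then have finE: "finite ?E" by (intro finite_subset[OF _ finite_deg[of D]]) auto
  have "\<forall>e\<in>leads I - leads J. \<exists>g. g \<in> I \<and> is_lead g e" by (auto simp: leads_def)
  from bchoice[OF this] obtain g where g: "\<And>e. e \<in> leads I - leads J \<Longrightarrow> g e \<in> I \<and> is_lead (g e) e" by blast
  have "\<forall>s\<in>P. \<exists>c. (\<lambda>x. v s x - (\<Sum>e\<in>?E. c e * g e x)) \<in> J"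
    using lead_reduction[OF J I g v(2,3) JI] by blast
  from bchoice[OF this] obtain c where c: "\<And>s. s \<in> P \<Longrightarrow> (\<lambda>x. v s x - (\<Sum>e\<in>?E. c s e * g e x)) \<in> J" by blast
  obtain k where k: "\<exists>s\<in>P. k s \<noteq> 0" "\<forall>e\<in>?E. (\<Sum>s\<in>P. k s * c s e) = 0"
    using exists_nontrivial_relation[OF finE v(1) card, of c] by blast
  have "(\<lambda>x. \<Sum>s\<in>P. k s * (v s x - (\<Sum>e\<in>?E. c s e * g e x))) \<in> J"
    using c by (rule rideal_lincomb[OF J])
  moreover have "(\<Sum>s\<in>P. k s * (v s x - (\<Sum>e\<in>?E. c s e * g e x))) = (\<Sum>s\<in>P. k s * v s x)" for x
  proof -
    have "(\<Sum>s\<in>P. k s * (\<Sum>e\<in>?E. c s e * g e x)) = (\<Sum>e\<in>?E. (\<Sum>s\<in>P. k s * c s e) * g e x)"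
      unfolding sum_distrib_left sum_distrib_right by (subst sum.swap) (simp add: mult.assoc)
    also have "\<dots> = 0" using k(2) by (intro sum.neutral) auto
    finally show ?thesis by (simp add: right_diff_distrib sum_subtractf)
  qed
  ultimately show ?thesis using k(1) by auto
qed

text \<open>The annihilator of the class of \<open>x\<close> modulo \<open>J\<close>, to which the
  hypothesis on proper right ideals is applied.\<close>

lemma quotient_rideal:
  assumes J: "rideal UNIV J"
  shows "rideal UNIV {r. finite (supp r) \<and> tga_mult \<tau> x r \<in> J}"
proof -
  have lin: "tga_mult \<tau> x (\<lambda>c. r c + s c) = (\<lambda>c. tga_mult \<tau> x r c + tga_mult \<tau> x s c)" for r s
    by (simp add: tga_mult_def algebra_simps sum.distrib)
  have sc: "tga_mult \<tau> x (\<lambda>c. k * r c) = (\<lambda>c. k * tga_mult \<tau> x r c)" for r k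
    by (simp add: tga_mult_def algebra_simps sum_distrib_left)
  have "tga_mult \<tau> x (\<lambda>_. 0) = (\<lambda>_. 0)" by (simp add: tga_mult_def)
  then show ?thesis unfolding rideal_def
    using ridealD(3-6)[OF J]
    by (simp add: lin sc tga_mult_rsh_right supp_add_finite supp_scale_finite finite_supp_rsh)
qed

lemma strict_inclusion_has_cone:
  assumes J: "rideal UNIV J" and I: "rideal UNIV I" and JI: "J \<subset> I"
    and free: "\<And>K. rideal UNIV K \<Longrightarrow> single 0 \<notin> K \<Longrightarrow>
      \<exists>S. S \<subseteq> {..<n} \<and> card S = h \<and> (\<forall>f\<in>K. supp f \<subseteq> coord_sub S \<longrightarrow> f = (\<lambda>_. 0))"
  shows "has_cone h (leads I - leads J)"
proof (rule ccontr)
  assume no: "\<not> has_cone h (leads I - leads J)"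
  have UI: "upset (leads I)" and UJ: "upset (leads J)" using upset_leads I J by auto
  obtain y where y: "y \<in> I" "y \<notin> J" using JI by blast
  have finy: "finite (supp y)" using ridealD(1)[OF I y(1)] .
  \<comment> \<open>A bound for all coordinates occurring in \<open>y\<close>, so that translation
    by \<open>b\<close> moves the support into the orthant.\<close>
  define M where "M = (\<Sum>a\<in>supp y. \<Sum>i<n. \<bar>coord a i\<bar>)"
  obtain b where b: "\<And>i. i < n \<Longrightarrow> coord b i = M" using coord_surj[of "\<lambda>_. M"] by blast
  define x where "x = rsh b y"
  have xI: "x \<in> I" and xJ: "x \<notin> J"
    unfolding x_def using y rideal_rsh_iff[of UNIV _ b y] I J by (auto simp: subgrp_def)
  have finx: "finite (supp x)" using ridealD(1)[OF I xI] .
  have xnn: "supp x \<subseteq> nonneg"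
  proof -
    have "a + b \<in> nonneg" if a: "a \<in> supp y" for a
    proof -
      have "0 \<le> coord a i + M" if i: "i < n" for i
      proof -
        have "\<bar>coord a i\<bar> \<le> (\<Sum>i<n. \<bar>coord a i\<bar>)" using i by (intro member_le_sum) auto
        also have "\<dots> \<le> M" unfolding M_def using a finy
          by (intro member_le_sum[of a _ "\<lambda>a. \<Sum>i<n. \<bar>coord a i\<bar>"]) (auto intro: sum_nonneg)
        finally show ?thesis by linarith
      qed
      then show ?thesis by (simp add: nonneg_def coord_add b)
    qed
    then show ?thesis unfolding x_def supp_rsh by auto
  qed
  define c0 where "c0 = nat (\<Sum>a\<in>supp x. \<bar>deg a\<bar>)"
  have degx: "deg a \<le> int c0" if "a \<in> supp x" for a
  proof -
    have "deg a \<le> \<bar>deg a\<bar>" by simp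
    also have "\<dots> \<le> (\<Sum>a\<in>supp x. \<bar>deg a\<bar>)"
      using finx that by (intro member_le_sum[of a _ "\<lambda>a. \<bar>deg a\<bar>"]) auto
    finally show ?thesis by (simp add: c0_def)
  qed
  let ?K = "{r. finite (supp r) \<and> tga_mult \<tau> x r \<in> J}"
  have "single 0 \<notin> ?K"
  proof
    assume "single 0 \<in> ?K"
    then have "rsh 0 x \<in> J" using finx by (simp add: tga_mult_single)
    then show False using xJ rideal_rsh_iff[of UNIV J 0 x] J by (auto simp: subgrp_def)
  qed
  from free[OF quotient_rideal[OF J] this] obtain S where
    S: "S \<subseteq> {..<n}" "card S = h" "\<And>f. f \<in> ?K \<Longrightarrow> supp f \<subseteq> coord_sub S \<Longrightarrow> f = (\<lambda>_. 0)" by blast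
  obtain c1 :: nat where c1: "\<forall>e\<in>leads I - leads J. card {i. i < n \<and> int c1 \<le> coord e i} < h"
    using bounded_large_coordinates[OF UI UJ no] by blast
  \<comment> \<open>The successor makes the threshold positive, as the counting bound
    requires.\<close>
  define c where "c = Suc c1"
  have few: "card {i. i < n \<and> int c \<le> coord e i} < h" if "e \<in> leads I - leads J" for e
  proof -
    have "card {i. i < n \<and> int c \<le> coord e i} \<le> card {i. i < n \<and> int c1 \<le> coord e i}"
      by (intro card_mono) (auto simp: c_def)
    also have "\<dots> < h" using c1 that by blast
    finally show ?thesis .
  qed
  have Enn: "leads I - leads J \<subseteq> nonneg" using UI by (auto simp: upset_def)
  \<comment> \<open>Otherwise the products of \<open>x\<close> with the monomials of the box are
    dependent modulo \<open>J\<close>, and the relation \<open>r\<close> is a nonzero element of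
    \<open>?K\<close> supported on \<open>coord_sub S\<close>.\<close>
  have count: "(t + 1) ^ h \<le> 2 ^ n * (c ^ n * (c0 + n * t + 1) ^ (h - 1))" for t
  proof -
    let ?P = "{s \<in> cone S. \<forall>i<n. coord s i \<le> int t}" and ?D = "c0 + n * t"
    have P: "(t + 1) ^ h \<le> card ?P" "finite ?P" using card_cone_box[OF S(1), of t] S(2) by auto
    have "\<not> card {e. e \<in> leads I - leads J \<and> deg e \<le> int ?D} < card ?P"
    proof
      assume lt: "card {e. e \<in> leads I - leads J \<and> deg e \<le> int ?D} < card ?P"
      have "supp (rsh s x) \<subseteq> {a \<in> nonneg. deg a \<le> int ?D}" if s: "s \<in> ?P" for s
      proof -
        have "deg s \<le> int (n * t)"
          using sum_bounded_above[of "{..<n}" "coord s" "int t"] s by (simp add: deg_def)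
        moreover have "s \<in> nonneg" using s by (simp add: cone_def)
        ultimately show ?thesis unfolding supp_rsh
          using degx xnn by (force simp: deg_add intro: nonneg_add)
      qed
      then obtain k where k: "\<exists>s\<in>?P. k s \<noteq> 0" "(\<lambda>z. \<Sum>s\<in>?P. k s * rsh s x z) \<in> J"
        using dependent_modulo[OF J I _ P(2), of "\<lambda>s. rsh s x" "int ?D"] JI ridealD(6)[OF I xI] lt by blast
      define r where "r = (\<lambda>z. \<Sum>s\<in>?P. k s * single s z)"
      have rv: "r s = (if s \<in> ?P then k s else 0)" for s
        using P(2) by (simp add: r_def single_def if_distrib[of "(*) _"] sum.delta cong: if_cong)
      have supr: "supp r \<subseteq> ?P"
      proof
        fix s assume "s \<in> supp r"
        then have "r s \<noteq> 0" by simp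
        then show "s \<in> ?P" unfolding rv by (metis (mono_tags, lifting))
      qed
      have "tga_mult \<tau> x r = (\<lambda>z. \<Sum>s\<in>?P. k s * rsh s x z)"
        unfolding r_def tga_mult_lin_right by (simp add: tga_mult_single finx)
      then have "r \<in> ?K" using k(2) finite_subset[OF supr P(2)] by simp
      moreover have "supp r \<subseteq> coord_sub S" using supr by (auto simp: cone_def)
      ultimately have "r = (\<lambda>_. 0)" by (rule S(3))
      moreover obtain s where "s \<in> ?P" "k s \<noteq> 0" using k(1) by blast
      ultimately show False using rv[of s] by simp
    qed
    then have "(t + 1) ^ h \<le> card {e \<in> leads I - leads J. deg e \<le> int ?D}" using P(1) by (simp add: not_less)
    also have "\<dots> \<le> 2 ^ n * (c ^ n * (?D + 1) ^ (h - 1))"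
      using card_few_large_coordinates[OF Enn _ few, of ?D] by (simp add: c_def)
    finally show ?thesis .
  qed
  show False
  proof (cases h)
    case 0
    \<comment> \<open>For \<open>h = 0\<close> the counting inequality is no contradiction; here
      there are no new leading exponents at all, which puts \<open>x\<close> itself into
      \<open>J\<close>.\<close>
    have "e \<notin> leads I - leads J" for e using few[of e] 0 by auto
    then have "{e. e \<in> leads I - leads J \<and> deg e \<le> int c0} = {}" by blast
    then have *: "card {e. e \<in> leads I - leads J \<and> deg e \<le> int c0} < card {0::'a}" by (simp only:) simp
    have sx: "supp x \<subseteq> {a \<in> nonneg. deg a \<le> int c0}" using xnn degx by blast
    obtain k where "k (0::'a) \<noteq> 0" "(\<lambda>z. k 0 * x z) \<in> J"
      using dependent_modulo[OF J I psubset_imp_subset[OF JI] _ xI sx *] by auto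
    then show False using rideal_scale_iff[OF J, of "k 0" x] xJ by simp
  next
    case (Suc h')
    \<comment> \<open>As \<open>c0 + n * t + 1\<close> is at most
      \<open>(c0 + n + 1) * (t + 1)\<close>, the right-hand side of \<open>count\<close> is at most
      \<open>C * (t + 1) ^ h'\<close>; the choice \<open>t = C\<close> refutes it.\<close>
    define C where "C = 2 ^ n * (c ^ n * (c0 + n + 1) ^ h')"
    define t where "t = C"
    have "(c0 + n * t + 1) \<le> (c0 + n + 1) * (t + 1)" by (simp add: algebra_simps)
    then have "(c0 + n * t + 1) ^ h' \<le> ((c0 + n + 1) * (t + 1)) ^ h'" by (rule power_mono) simp
    then have "2 ^ n * (c ^ n * (c0 + n * t + 1) ^ h') \<le> 2 ^ n * (c ^ n * ((c0 + n + 1) * (t + 1)) ^ h')"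
      by (intro mult_le_mono2)
    also have "\<dots> = C * (t + 1) ^ h'" unfolding C_def power_mult_distrib by (simp only: mult_ac)
    finally have "(t + 1) * (t + 1) ^ h' \<le> C * (t + 1) ^ h'" using count[of t] Suc by simp
    then have "t + 1 \<le> C" by (simp only: mult_le_cancel2) simp
    then show False by (simp add: t_def)
  qed
qed

subsection \<open>Krull dimension and isotropic sets\<close>

text \<open>Each level of the deviation costs one cone dimension: infinitely many bad steps of a
  chain carry cones of dimension \<open>h + m\<close>, and together they produce one of dimension
  \<open>h + m + 1\<close>. Strict inclusions supply the start at dimension
  \<open>h\<close>.\<close>

lemma devle_if_no_cone:
  assumes free: "\<And>K. rideal UNIV K \<Longrightarrow> single 0 \<notin> K \<Longrightarrow>
      \<exists>S. S \<subseteq> {..<n} \<and> card S = h \<and> (\<forall>f\<in>K. supp f \<subseteq> coord_sub S \<longrightarrow> f = (\<lambda>_. 0))"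
    and "rideal UNIV J" "rideal UNIV I" "\<not> has_cone (Suc (h + m)) (leads I - leads J)"
  shows "devle m (tga_right_ideals \<tau>) J I"
  using assms(2-)
proof (induction m arbitrary: I J)
  case 0
  have "\<exists>m. \<forall>i\<ge>m. K (Suc i) = K i"
    if K: "\<forall>i. K i \<in> tga_right_ideals \<tau> \<and> J \<subseteq> K i \<and> K i \<subseteq> I \<and> K (Suc i) \<subseteq> K i" for K
  proof (rule ccontr)
    assume neg: "\<not> ?thesis"
    have KR: "rideal UNIV (K i)" for i using K by (auto simp: tga_right_ideals_eq)
    have sub: "{i. K (Suc i) \<noteq> K i} \<subseteq> {i. has_cone h (leads (K i) - leads (K (Suc i)))}"
      using strict_inclusion_has_cone[OF KR KR _ free] K by blast
    have "infinite {i. K (Suc i) \<noteq> K i}" using neg unfolding infinite_nat_iff_unbounded_le by auto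
    then have "infinite {i. has_cone h (leads (K i) - leads (K (Suc i)))}" using sub finite_subset by blast
    then have "has_cone (Suc h) (leads I - leads J)"
      using K KR 0 by (intro infinitely_many_cones[of "\<lambda>i. leads (K i)"] upset_leads leads_mono) auto
    then show False using 0 by simp
  qed
  then show ?case by simp
next
  case (Suc m)
  have "\<exists>l. \<forall>i\<ge>l. devle m (tga_right_ideals \<tau>) (K (Suc i)) (K i)"
    if K: "\<forall>i. K i \<in> tga_right_ideals \<tau> \<and> J \<subseteq> K i \<and> K i \<subseteq> I \<and> K (Suc i) \<subseteq> K i" for K
  proof (rule ccontr)
    assume neg: "\<not> ?thesis"
    have KR: "rideal UNIV (K i)" for i using K by (auto simp: tga_right_ideals_eq)
    have sub: "{i. \<not> devle m (tga_right_ideals \<tau>) (K (Suc i)) (K i)}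
        \<subseteq> {i. has_cone (Suc (h + m)) (leads (K i) - leads (K (Suc i)))}"
      using Suc.IH[OF KR KR] by blast
    have "infinite {i. \<not> devle m (tga_right_ideals \<tau>) (K (Suc i)) (K i)}"
      using neg unfolding infinite_nat_iff_unbounded_le by auto
    then have "infinite {i. has_cone (Suc (h + m)) (leads (K i) - leads (K (Suc i)))}"
      using sub finite_subset by blast
    then have "has_cone (Suc (Suc (h + m))) (leads I - leads J)"
      using K KR Suc.prems by (intro infinitely_many_cones[of "\<lambda>i. leads (K i)"] upset_leads leads_mono) auto
    then show False using Suc.prems by simp
  qed
  then show ?case by simp
qed

theorem tga_kdim_le_isotropic:
  "\<exists>X. indep X \<and> isotropic X \<and> tga_kdim \<tau> \<le> enat (card X)"
proof -
  have "\<exists>X. (indep X \<and> isotropic X) \<and> (\<forall>Y. indep Y \<and> isotropic Y \<longrightarrow> card Y \<le> card X)"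
    by (rule ex_has_greatest_nat[of _ "{}" _ "Suc n"])
      (auto simp: isotropic_def indep_card_le_rank le_imp_less_Suc)
  then obtain X where X: "indep X" "isotropic X" "\<And>Y. indep Y \<Longrightarrow> isotropic Y \<Longrightarrow> card Y \<le> card X" by blast
  let ?h = "n - card X"
  have Xn: "card X \<le> n" using indep_card_le_rank[OF X(1)] .
  have free: "\<exists>S. S \<subseteq> {..<n} \<and> card S = ?h \<and> (\<forall>f\<in>K. supp f \<subseteq> coord_sub S \<longrightarrow> f = (\<lambda>_. 0))"
    if K: "rideal UNIV K" "single 0 \<notin> K" for K
  proof -
    have "subgrp (UNIV :: 'a set)" by (simp add: subgrp_def)
    from isotropic_and_free_coordinates[OF indep_card_le_rank this K] obtain S Y where
      SY: "S \<subseteq> {..<n}" "indep Y" "isotropic Y" "n \<le> card Y + card S"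
        "\<And>f. f \<in> K \<Longrightarrow> supp f \<subseteq> coord_sub S \<Longrightarrow> f = (\<lambda>_. 0)" by blast
    \<comment> \<open>An isotropic \<open>Y\<close> has at most \<open>card X\<close> elements, so
      at least \<open>?h\<close> coordinates are free. Surplus ones are discarded, since a smaller
      coordinate subgroup is met trivially as well.\<close>
    have "?h \<le> card S" using SY(4) X(3)[OF SY(2,3)] by linarith
    from obtain_subset_with_card_n[OF this] obtain S' where S': "S' \<subseteq> S" "card S' = ?h" by blast
    have "f = (\<lambda>_. 0)" if "f \<in> K" "supp f \<subseteq> coord_sub S'" for f
      using SY(5)[OF that(1)] that(2) coord_sub_mono[OF S'(1)] by blast
    then show ?thesis using S' SY(1) by blast
  qed
  have R: "rideal UNIV (tga_carrier :: ('a \<Rightarrow> 'f) set)"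
    unfolding rideal_def tga_carrier_def
    by (simp add: supp_add_finite supp_scale_finite finite_supp_rsh)
  have Z: "rideal UNIV {\<lambda>_. 0}" by (auto simp: rideal_def rsh_def)
  \<comment> \<open>The forbidden cone has dimension \<open>n + 1\<close>, but only \<open>n\<close>
    coordinates exist.\<close>
  have no: "\<not> has_cone (Suc (?h + card X)) (leads tga_carrier - leads {\<lambda>_. 0})"
  proof
    assume "has_cone (Suc (?h + card X)) (leads tga_carrier - leads {\<lambda>_. 0})"
    then obtain S :: "nat set" where "S \<subseteq> {..<n}" "card S = Suc n" unfolding has_cone_def using Xn by auto
    then show False using card_mono[of "{..<n}" S] by simp
  qed
  have "devle (card X) (tga_right_ideals \<tau>) {\<lambda>_. 0} tga_carrier"
    using free Z R no by (rule devle_if_no_cone)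
  then have "tga_kdim \<tau> \<le> enat (card X)"
    unfolding tga_kdim_def kdim_def by (auto intro: Least_le)
  then show ?thesis using X by blast
qed

end

subsection \<open>A lower bound for the Krull dimension\<close>

text \<open>Antiderivative for the forward difference on all integers, with value 0 at 0;
  \<open>int_prod\<close> is its multiplicative analogue.\<close>

definition int_sum :: "(int \<Rightarrow> 'f::field) \<Rightarrow> int \<Rightarrow> 'f" where
  "int_sum g c = (if 0 \<le> c then \<Sum>j<nat c. g (int j) else - (\<Sum>j<nat (- c). g (- int j - 1)))"

lemma int_sum_Suc: "int_sum g (c + 1) = int_sum g c + g c"
proof -
  consider "0 \<le> c" | "c = -1" | "c < -1" by linarith
  then show ?thesis
  proof cases
    case 1
    then have "nat (c + 1) = Suc (nat c)" by simp
    then show ?thesis using 1 by (simp add: int_sum_def)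
  next
    case 3
    then have "nat (- c) = Suc (nat (- (c + 1)))" by simp
    then show ?thesis using 3 by (simp add: int_sum_def)
  qed (simp add: int_sum_def)
qed

definition int_prod :: "(int \<Rightarrow> 'f::field) \<Rightarrow> int \<Rightarrow> 'f" where
  "int_prod g c = (if 0 \<le> c then \<Prod>j<nat c. g (int j) else inverse (\<Prod>j<nat (- c). g (- int j - 1)))"

lemma int_prod_Suc:
  assumes "\<And>c. g c \<noteq> 0"
  shows "int_prod g (c + 1) = int_prod g c * g c"
proof -
  consider "0 \<le> c" | "c = -1" | "c < -1" by linarith
  then show ?thesis
  proof cases
    case 1
    then have "nat (c + 1) = Suc (nat c)" by simp
    then show ?thesis using 1 by (simp add: int_prod_def)
  next
    case 2
    then show ?thesis using assms by (simp add: int_prod_def)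
  next
    case 3
    then have "nat (- c) = Suc (nat (- (c + 1)))" by simp
    then show ?thesis using 3 assms by (simp add: int_prod_def)
  qed
qed

lemma int_prod_nonzero: "(\<And>c. g c \<noteq> 0) \<Longrightarrow> int_prod g c \<noteq> 0"
  by (simp add: int_prod_def)

text \<open>The binomial coefficients \<open>c choose j\<close> for integers \<open>c\<close>, as elements of the field.\<close>

primrec int_binom :: "nat \<Rightarrow> int \<Rightarrow> 'f::field" where
  "int_binom 0 = (\<lambda>_. 1)"
| "int_binom (Suc j) = int_sum (int_binom j)"

lemma int_binom_Suc:
  "int_binom k (c + 1) = int_binom k c + (if k = 0 then 0 else int_binom (k - 1) c)"
  by (cases k) (simp_all add: int_sum_Suc)

lemma devle_mono:
  assumes "devle m S J I" "J \<subseteq> J'" "I' \<subseteq> I"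
  shows "devle m S J' I'"
proof (cases m)
  case 0
  have "\<exists>l. \<forall>i\<ge>l. K (Suc i) = K i"
    if "\<forall>i. K i \<in> S \<and> J' \<subseteq> K i \<and> K i \<subseteq> I' \<and> K (Suc i) \<subseteq> K i" for K
  proof -
    have "\<forall>i. K i \<in> S \<and> J \<subseteq> K i \<and> K i \<subseteq> I \<and> K (Suc i) \<subseteq> K i" using that assms(2,3) by blast
    then show ?thesis using assms(1) 0 by simp
  qed
  then show ?thesis using 0 by simp
next
  case (Suc m')
  have "\<exists>l. \<forall>i\<ge>l. devle m' S (K (Suc i)) (K i)"
    if "\<forall>i. K i \<in> S \<and> J' \<subseteq> K i \<and> K i \<subseteq> I' \<and> K (Suc i) \<subseteq> K i" for K
  proof -
    have "\<forall>i. K i \<in> S \<and> J \<subseteq> K i \<and> K i \<subseteq> I \<and> K (Suc i) \<subseteq> K i" using that assms(2,3) by blast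
    then show ?thesis using assms(1) Suc by simp
  qed
  then show ?thesis using Suc by simp
qed

context cocycle
begin

text \<open>On an isotropic set the cocycle becomes trivial after rescaling: \<open>\<mu> c\<close>
  times the basis element of the sum behaves like the Laurent monomial with exponents
  \<open>c\<close>, whose exponent at \<open>x\<close> is raised by one under left multiplication by
  the basis element of \<open>x\<close>.\<close>

lemma isotropic_splitting:
  assumes "finite X" "isotropic X"
  shows "\<exists>\<mu>::('a \<Rightarrow> int) \<Rightarrow> 'f. (\<forall>c. \<mu> c \<noteq> 0) \<and> (\<forall>c c'. (\<forall>x\<in>X. c x = c' x) \<longrightarrow> \<mu> c = \<mu> c') \<and>
    (\<forall>c. \<forall>x\<in>X. \<mu> (c(x := c x + 1)) = \<tau> x (\<Sum>x\<in>X. zsc (c x) x) * \<mu> c)"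
  using assms
proof (induction X rule: finite_induct)
  case empty
  show ?case by (intro exI[of _ "\<lambda>_. 1"]) simp
next
  case (insert y X)
  have "isotropic X" using insert.prems by (simp add: isotropic_def)
  then obtain \<mu> :: "('a \<Rightarrow> int) \<Rightarrow> 'f" where \<mu>: "\<And>c. \<mu> c \<noteq> 0"
    "\<And>c c'. (\<And>x. x \<in> X \<Longrightarrow> c x = c' x) \<Longrightarrow> \<mu> c = \<mu> c'"
    "\<And>c x. x \<in> X \<Longrightarrow> \<mu> (c(x := c x + 1)) = \<tau> x (\<Sum>x\<in>X. zsc (c x) x) * \<mu> c"
    using insert.IH by blast
  define p where "p = int_prod (\<lambda>k. \<tau> y (zsc k y))"
  have p: "p k \<noteq> 0" "p (k + 1) = p k * \<tau> y (zsc k y)" for k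
    unfolding p_def by (rule int_prod_nonzero int_prod_Suc; simp)+
  define s where "s c = (\<Sum>x\<in>X. zsc (c x) x)" for c
  \<comment> \<open>The scalar of the product of a monomial in \<open>X\<close> with a power of
    \<open>y\<close>; the factor \<open>p\<close> collects the cocycle values from building that
    power.\<close>
  define \<nu> where "\<nu> c = \<mu> c * p (c y) * \<tau> (s c) (zsc (c y) y)" for c
  have full: "(\<Sum>x\<in>insert y X. zsc (c x) x) = s c + zsc (c y) y" for c
    using insert.hyps by (simp add: s_def add.commute)
  have "\<nu> c = \<nu> c'" if "\<forall>x\<in>insert y X. c x = c' x" for c c'
  proof -
    have "\<mu> c = \<mu> c'" using that by (intro \<mu>(2)) auto
    moreover have "s c = s c'" unfolding s_def using that by (intro sum.cong) auto
    ultimately show ?thesis using that by (simp add: \<nu>_def)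
  qed
  moreover have "\<nu> (c(x := c x + 1)) = \<tau> x (s c + zsc (c y) y) * \<nu> c" if x: "x \<in> insert y X" for c x
  proof (cases "x = y")
    case True
    have "\<mu> (c(y := c y + 1)) = \<mu> c" using insert.hyps by (intro \<mu>(2)) auto
    moreover have "s (c(y := c y + 1)) = s c" unfolding s_def using insert.hyps by (intro sum.cong) auto
    ultimately have 1: "\<nu> (c(y := c y + 1)) = \<mu> c * (p (c y) * \<tau> y (zsc (c y) y)) * \<tau> (s c) (y + zsc (c y) y)"
      by (simp add: \<nu>_def p zsc_Suc)
    \<comment> \<open>Isotropy is what lets the new factor \<open>y\<close> move past the monomial
      in \<open>X\<close>.\<close>
    have "commute y (s c)"
      by (rule commute_zspan_right[of _ X]) (use insert.prems in \<open>auto simp: s_def zspan_def isotropic_def\<close>)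
    then have cm: "\<tau> (s c) y = \<tau> y (s c)" by (simp add: commute_def)
    have "\<tau> y (zsc (c y) y) * \<tau> (s c) (y + zsc (c y) y) = \<tau> (s c) y * \<tau> (s c + y) (zsc (c y) y)"
      using coc[of "s c" y "zsc (c y) y"] by simp
    also have "\<dots> = \<tau> (s c) (zsc (c y) y) * \<tau> y (s c + zsc (c y) y)"
      using coc[of y "s c" "zsc (c y) y"] cm by (simp add: add.commute)
    finally have 2: "\<tau> y (zsc (c y) y) * \<tau> (s c) (y + zsc (c y) y) = \<tau> (s c) (zsc (c y) y) * \<tau> y (s c + zsc (c y) y)" .
    have "\<nu> (c(y := c y + 1)) = \<mu> c * p (c y) * (\<tau> y (zsc (c y) y) * \<tau> (s c) (y + zsc (c y) y))"
      unfolding 1 by (simp only: mult_ac)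
    then show ?thesis unfolding 2 using True by (simp only: \<nu>_def mult_ac)
  next
    case False
    then have xX: "x \<in> X" using x by simp
    have "s (c(x := c x + 1)) = x + s c"
    proof -
      have "s (c(x := c x + 1)) = zsc (c x + 1) x + (\<Sum>z\<in>X - {x}. zsc (c z) z)"
        unfolding s_def using insert.hyps(1) xX by (subst sum.remove[of _ x]) (auto intro!: sum.cong)
      also have "\<dots> = x + s c"
        unfolding s_def using insert.hyps(1) xX by (subst (2) sum.remove[of _ x]) (auto simp: zsc_Suc add.assoc)
      finally show ?thesis .
    qed
    then have "\<nu> (c(x := c x + 1)) = \<mu> c * p (c y) * (\<tau> x (s c) * \<tau> (x + s c) (zsc (c y) y))"
      using False \<mu>(3)[OF xX, of c] by (simp add: \<nu>_def s_def mult_ac)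
    also have "\<tau> x (s c) * \<tau> (x + s c) (zsc (c y) y) = \<tau> (s c) (zsc (c y) y) * \<tau> x (s c + zsc (c y) y)"
      by (rule coc)
    finally show ?thesis by (simp only: \<nu>_def mult_ac)
  qed
  moreover have "\<nu> c \<noteq> 0" for c using \<mu>(1) p(1) by (simp add: \<nu>_def)
  ultimately show ?case unfolding full by blast
qed

text \<open>\<open>h u a\<close> is the coefficient of the product of the
  \<open>(x - 1) ^ u x\<close> in the Taylor expansion at 1 of the basis element of
  \<open>a\<close>, read as a rescaled Laurent monomial, and 0 if \<open>a\<close> is outside
  \<open>zspan X\<close>. That multiplication by \<open>x - 1\<close> lowers \<open>u\<close> at
  \<open>x\<close> by one is Pascal's rule.\<close>

lemma isotropic_taylor_weights:
  assumes X: "indep X" "isotropic X"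
  shows "\<exists>h::('a \<Rightarrow> nat) \<Rightarrow> 'a \<Rightarrow> 'f. h (\<lambda>_. 0) 0 \<noteq> 0 \<and>
    (\<forall>u a. \<forall>x\<in>X. \<tau> x a * h u (x + a) - h u a = (if u x = 0 then 0 else h (u(x := u x - 1)) a))"
proof -
  have fin: "finite X" using X(1) by (simp add: indep_def)
  obtain \<mu> :: "('a \<Rightarrow> int) \<Rightarrow> 'f" where \<mu>: "\<And>c. \<mu> c \<noteq> 0"
    "\<And>c c'. (\<And>x. x \<in> X \<Longrightarrow> c x = c' x) \<Longrightarrow> \<mu> c = \<mu> c'"
    "\<And>c x. x \<in> X \<Longrightarrow> \<mu> (c(x := c x + 1)) = \<tau> x (\<Sum>x\<in>X. zsc (c x) x) * \<mu> c"
    using isotropic_splitting[OF fin X(2)] by blast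
  have "\<forall>a\<in>zspan X. \<exists>c. a = (\<Sum>x\<in>X. zsc (c x) x)" by (auto simp: zspan_def)
  from bchoice[OF this] obtain cf where cf: "\<And>a. a \<in> zspan X \<Longrightarrow> a = (\<Sum>x\<in>X. zsc (cf a x) x)" by blast
  define h where "h u a = (if a \<in> zspan X then (\<Prod>x\<in>X. int_binom (u x) (cf a x)) / \<mu> (cf a) else 0)" for u :: "'a \<Rightarrow> nat" and a
  have "h (\<lambda>_. 0) 0 \<noteq> 0" using \<mu>(1) by (simp add: h_def)
  moreover have "\<tau> x a * h u (x + a) - h u a = (if u x = 0 then 0 else h (u(x := u x - 1)) a)" if x: "x \<in> X" for u a x
  proof (cases "a \<in> zspan X")
    case True
    have xs: "x \<in> zspan X" using fin x by (rule zspan_base)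
    have xa: "x + a \<in> zspan X" using xs True by (rule zspan_add)
    let ?c = "cf a" and ?d = "(cf a)(x := cf a x + 1)"
    have sd: "(\<Sum>z\<in>X. zsc (?d z) z) = x + a"
    proof -
      have "(\<Sum>z\<in>X. zsc (?d z) z) = zsc (?c x + 1) x + (\<Sum>z\<in>X - {x}. zsc (?c z) z)"
        using fin x by (subst sum.remove[of _ x]) (auto intro!: sum.cong)
      also have "\<dots> = x + (\<Sum>z\<in>X. zsc (?c z) z)"
        using fin x by (subst (2) sum.remove[of _ x]) (auto simp: zsc_Suc add.assoc)
      finally show ?thesis using cf[OF True] by simp
    qed
    \<comment> \<open>Independence makes the exponents on \<open>X\<close> unique, so the arbitrary
      choice \<open>cf\<close> is compatible with adding \<open>x\<close>.\<close>
    have same: "cf (x + a) z = ?d z" if "z \<in> X" for z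
    proof -
      have "(\<Sum>z\<in>X. zsc (cf (x + a) z - ?d z) z) = 0"
        using cf[OF xa] sd by (simp only: zsc_diff sum_subtractf) simp
      then show ?thesis using indepD[OF X(1), of "\<lambda>z. cf (x + a) z - ?d z"] that by simp
    qed
    have "\<mu> (cf (x + a)) = \<mu> ?d" using same by (rule \<mu>(2))
    also have "\<dots> = \<tau> x a * \<mu> ?c" using \<mu>(3)[OF x, of ?c] cf[OF True] by simp
    finally have m: "\<mu> (cf (x + a)) = \<tau> x a * \<mu> ?c" .
    define P where "P = (\<Prod>z\<in>X - {x}. int_binom (u z) (?c z) :: 'f)"
    have p1: "(\<Prod>z\<in>X. int_binom (u z) (cf (x + a) z)) = int_binom (u x) (?c x + 1) * P"
    proof -
      have "(\<Prod>z\<in>X. int_binom (u z) (cf (x + a) z)) = (\<Prod>z\<in>X. int_binom (u z) (?d z) :: 'f)"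
        using same by (intro prod.cong) auto
      also have "\<dots> = int_binom (u x) (?c x + 1) * P"
        using fin x unfolding P_def by (subst prod.remove[of _ x]) (auto intro!: prod.cong)
      finally show ?thesis .
    qed
    have p2: "(\<Prod>z\<in>X. int_binom (u z) (?c z)) = int_binom (u x) (?c x) * P"
      using fin x unfolding P_def by (subst prod.remove[of _ x]) auto
    have p3: "(\<Prod>z\<in>X. int_binom ((u(x := u x - 1)) z) (?c z)) = int_binom (u x - 1) (?c x) * P"
      using fin x unfolding P_def by (subst prod.remove[of _ x]) (auto intro!: prod.cong)
    have "\<tau> x a * h u (x + a) = int_binom (u x) (?c x + 1) * P / \<mu> ?c"
      using xa by (simp add: h_def p1 m)
    moreover have "h u a = int_binom (u x) (?c x) * P / \<mu> ?c" using True by (simp only: h_def p2 if_True)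
    moreover have "h (u(x := u x - 1)) a = int_binom (u x - 1) (?c x) * P / \<mu> ?c"
      using True by (simp only: h_def p3 if_True)
    ultimately show ?thesis unfolding int_binom_Suc by (simp add: diff_divide_distrib[symmetric] distrib_right)
  next
    case False
    have "x + a \<notin> zspan X"
    proof
      assume "x + a \<in> zspan X"
      moreover have "zsc (-1) x \<in> zspan X" using fin x by (intro zspan_zsc zspan_base)
      ultimately have "x + a + zsc (-1) x \<in> zspan X" by (rule zspan_add)
      then show False using False by (simp add: zsc_minus)
    qed
    then show ?thesis using False by (simp add: h_def)
  qed
  ultimately show ?thesis by blast
qed

text \<open>The right ideals \<open>Psi T\<close>, indexed by sets \<open>T\<close> of exponents,
  imitate monomial ideals in \<open>card X\<close> variables: a chain in one variable has infinitely
  many steps in each of which the remaining variables are still free.\<close>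

lemma isotropic_card_le_devle:
  assumes X: "indep X" "isotropic X" and dev: "devle m (tga_right_ideals \<tau>) {\<lambda>_. 0} tga_carrier"
  shows "card X \<le> m"
proof -
  obtain h :: "('a \<Rightarrow> nat) \<Rightarrow> 'a \<Rightarrow> 'f" where h0: "h (\<lambda>_. 0) 0 \<noteq> 0"
    and h: "\<And>u a x. x \<in> X \<Longrightarrow> \<tau> x a * h u (x + a) - h u a = (if u x = 0 then 0 else h (u(x := u x - 1)) a)"
    using isotropic_taylor_weights[OF X] by blast
  define lam where "lam u f = (\<Sum>a\<in>supp f. f a * h u a)" for u f
  have lam_sup: "lam u f = (\<Sum>a\<in>B. f a * h u a)" if "finite B" "supp f \<subseteq> B" for u f B
    unfolding lam_def using that by (intro sum.mono_neutral_left) auto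
  have lam_lin: "lam u (\<lambda>a. k * f a + l * g a) = k * lam u f + l * lam u g"
    if "finite (supp f)" "finite (supp g)" for u f g k l
  proof -
    let ?B = "supp f \<union> supp g"
    have "lam u (\<lambda>a. k * f a + l * g a) = (\<Sum>a\<in>?B. (k * f a + l * g a) * h u a)"
      using that by (intro lam_sup) auto
    also have "\<dots> = k * (\<Sum>a\<in>?B. f a * h u a) + l * (\<Sum>a\<in>?B. g a * h u a)"
      by (simp add: sum.distrib sum_distrib_left algebra_simps)
    also have "\<dots> = k * lam u f + l * lam u g"
      using that lam_sup[of ?B f u] lam_sup[of ?B g u] by auto
    finally show ?thesis .
  qed
  have lam_lsh: "lam u (\<lambda>c. lsh x f c - f c) = (if u x = 0 then 0 else lam (u(x := u x - 1)) f)"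
    if x: "x \<in> X" and f: "finite (supp f)" for u f x
  proof -
    have "lam u (\<lambda>c. lsh x f c - f c) = lam u (lsh x f) - lam u f"
      using lam_lin[OF finite_supp_lsh[OF f, of x] f, of u 1 "-1"] by simp
    also have "lam u (lsh x f) = (\<Sum>a\<in>supp f. lsh x f (a + x) * h u (a + x))"
      unfolding lam_def supp_lsh by (subst sum.reindex) (auto simp: inj_on_def)
    also have "\<dots> = (\<Sum>a\<in>supp f. f a * (\<tau> x a * h u (x + a)))"
      by (intro sum.cong) (auto simp: lsh_def add.commute)
    also have "\<dots> - lam u f = (\<Sum>a\<in>supp f. f a * (\<tau> x a * h u (x + a) - h u a))"
      by (simp add: lam_def right_diff_distrib sum_subtractf)
    also have "\<dots> = (if u x = 0 then 0 else lam (u(x := u x - 1)) f)"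
      unfolding h[OF x] by (simp add: lam_def)
    finally show ?thesis .
  qed
  define Psi where "Psi T = {f. finite (supp f) \<and> (\<forall>u. u \<notin> T \<longrightarrow> (\<forall>b. lam u (rsh b f) = 0))}" for T
  have Psi_R: "Psi T \<in> tga_right_ideals \<tau>" for T
    unfolding tga_right_ideals_eq mem_Collect_eq rideal_def
  proof (intro conjI ballI allI)
    show "(\<lambda>_. 0) \<in> Psi T" by (simp add: Psi_def rsh_def lam_def)
    fix f assume f: "f \<in> Psi T"
    then show ff: "finite (supp f)" by (simp add: Psi_def)
    show "supp f \<subseteq> UNIV" by simp
    have f0: "lam u (rsh b f) = 0" if "u \<notin> T" for u b using f that by (simp add: Psi_def)
    show "(\<lambda>x. k * f x) \<in> Psi T" for k
    proof -
      have "rsh b (\<lambda>x. k * f x) = (\<lambda>x. k * rsh b f x + 0 * rsh b f x)" for b by (auto simp: rsh_def)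
      then show ?thesis using f0 ff by (simp add: Psi_def supp_scale_finite lam_lin finite_supp_rsh del: mult_zero_left)
    qed
    show "rsh b f \<in> Psi T" for b
    proof -
      have "rsh c (rsh b f) = (\<lambda>x. \<tau> b c * rsh (b + c) f x + 0 * rsh (b + c) f x)" for c
        by (simp add: rsh_rsh)
      then show ?thesis using f0 ff by (simp add: Psi_def lam_lin finite_supp_rsh del: mult_zero_left)
    qed
    fix g assume g: "g \<in> Psi T"
    then have fg: "finite (supp g)" and g0: "\<And>u b. u \<notin> T \<Longrightarrow> lam u (rsh b g) = 0" by (auto simp: Psi_def)
    have "rsh b (\<lambda>x. f x + g x) = (\<lambda>x. 1 * rsh b f x + 1 * rsh b g x)" for b
      by (auto simp: rsh_def algebra_simps)
    then show "(\<lambda>x. f x + g x) \<in> Psi T"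
      using f0 g0 ff fg by (simp add: Psi_def supp_add_finite lam_lin finite_supp_rsh del: mult_1_left)
  qed
  have Psi_mono: "Psi T \<subseteq> Psi T'" if "T \<subseteq> T'" for T T' using that by (auto simp: Psi_def)
  text \<open>The element \<open>f\<close> below is the product of the powers \<open>(x - 1) ^ u x\<close>.\<close>
  have ex: "\<exists>f. finite (supp f) \<and> (\<forall>v b. lam v (rsh b f) =
      (if u \<le> v then lam (\<lambda>y. v y - u y) (rsh b (single 0)) else 0))" if "\<forall>y. y \<notin> X \<longrightarrow> u y = 0" for u
    using that
  proof (induction "\<Sum>x\<in>X. u x" arbitrary: u)
    case 0
    then have "u = (\<lambda>_. 0)" using X(1) by (auto simp: indep_def fun_eq_iff)
    then show ?case by (intro exI[of _ "single 0"]) (simp add: le_fun_def)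
  next
    case (Suc N)
    then have "(\<Sum>x\<in>X. u x) \<noteq> 0" by simp
    then obtain x where x: "x \<in> X" "u x \<noteq> 0" by (rule sum.not_neutral_contains_not_neutral)
    let ?u = "u(x := u x - 1)"
    have finX: "finite X" using X(1) by (simp add: indep_def)
    have "(\<Sum>z\<in>X. u z) = u x + (\<Sum>z\<in>X - {x}. u z)" using finX x(1) by (rule sum.remove)
    moreover have "(\<Sum>z\<in>X. ?u z) = (u x - 1) + (\<Sum>z\<in>X - {x}. u z)"
      using finX x(1) by (subst sum.remove[of _ x]) (auto intro!: sum.cong)
    ultimately have "N = (\<Sum>z\<in>X. ?u z)" using Suc.hyps(2) x(2) by simp
    moreover have "\<forall>y. y \<notin> X \<longrightarrow> ?u y = 0" using Suc.prems by simp
    ultimately obtain f where f: "finite (supp f)"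
      "\<And>v b. lam v (rsh b f) = (if ?u \<le> v then lam (\<lambda>y. v y - ?u y) (rsh b (single 0)) else 0)"
      using Suc.hyps(1)[of ?u] by blast
    let ?f = "\<lambda>c. lsh x f c - f c"
    have "finite (supp ?f)"
      by (rule finite_subset[of _ "supp (lsh x f) \<union> supp f"]) (use f(1) finite_supp_lsh in auto)
    moreover have "lam v (rsh b ?f) = (if u \<le> v then lam (\<lambda>y. v y - u y) (rsh b (single 0)) else 0)" for v b
    proof -
      \<comment> \<open>Left multiplication by \<open>x\<close> commutes with right translation, so
        the factor \<open>x - 1\<close> acts in the same way on the Taylor coefficients of every
        translate.\<close>
      have "rsh b ?f = (\<lambda>c. rsh b (lsh x f) c - rsh b f c)" by (auto simp: rsh_def algebra_simps)
      also have "\<dots> = (\<lambda>c. lsh x (rsh b f) c - rsh b f c)" by (simp add: lsh_rsh)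
      finally have "lam v (rsh b ?f) = (if v x = 0 then 0 else lam (v(x := v x - 1)) (rsh b f))"
        using lam_lsh[OF x(1) finite_supp_rsh[OF f(1)], of v b] by simp
      moreover have "u \<le> v \<longleftrightarrow> v x \<noteq> 0 \<and> ?u \<le> v(x := v x - 1)"
      proof
        assume l: "u \<le> v"
        have lx: "u x \<le> v x" using l by (rule le_funD)
        have "?u \<le> v(x := v x - 1)"
        proof (rule le_funI)
          fix y show "?u y \<le> (v(x := v x - 1)) y" using le_funD[OF l, of y] by (cases "y = x") auto
        qed
        then show "v x \<noteq> 0 \<and> ?u \<le> v(x := v x - 1)" using lx x(2) by simp
      next
        assume r: "v x \<noteq> 0 \<and> ?u \<le> v(x := v x - 1)"
        show "u \<le> v"
        proof (rule le_funI)
          fix y show "u y \<le> v y"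
            using r[THEN conjunct2, THEN le_funD, of y] r x(2) by (cases "y = x") auto
        qed
      qed
      moreover have "(\<lambda>y. (v(x := v x - 1)) y - ?u y) = (\<lambda>y. v y - u y)" using x(2) by auto
      ultimately show ?thesis using f(2)[of "v(x := v x - 1)" b] by auto
    qed
    ultimately show ?case by (intro exI[of _ ?f]) simp
  qed
  \<comment> \<open>Upward closure of \<open>T'\<close> keeps the product with exponent
    \<open>u\<close> in \<open>Psi T'\<close>; its own coefficient at \<open>u\<close> is a nonzero
    constant, which excludes it from \<open>Psi T\<close>.\<close>
  have strict: "\<not> Psi T' \<subseteq> Psi T"
    if u: "\<forall>y. y \<notin> X \<longrightarrow> u y = 0" "u \<in> T'" "u \<notin> T" "\<And>v w. v \<in> T' \<Longrightarrow> v \<le> w \<Longrightarrow> w \<in> T'" for u T T'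
  proof -
    obtain f where f: "finite (supp f)"
      "\<And>v b. lam v (rsh b f) = (if u \<le> v then lam (\<lambda>y. v y - u y) (rsh b (single 0)) else 0)"
      using ex[OF u(1)] by blast
    have "f \<in> Psi T'" unfolding Psi_def using f u(2,4) by auto
    moreover have "lam u (rsh 0 f) \<noteq> 0"
    proof -
      have "rsh 0 (single 0) = (\<lambda>x. \<tau> 0 0 * single 0 x + 0 * single 0 x)" by (simp add: rsh_zero)
      then have "lam (\<lambda>_. 0) (rsh 0 (single 0)) = \<tau> 0 0 * lam (\<lambda>_. 0) (single 0)"
        using lam_lin[of "single 0" "single 0"] by (simp del: mult_zero_left)
      also have "lam (\<lambda>_. 0) (single 0) = h (\<lambda>_. 0) 0" by (simp add: lam_def single_def)
      finally show ?thesis using h0 by (simp add: f(2))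
    qed
    then have "f \<notin> Psi T" using u(3) by (auto simp: Psi_def)
    ultimately show ?thesis by blast
  qed
  \<comment> \<open>The induction needs intervals for which \<open>U' - U\<close> contains an
    orthant with directions \<open>S\<close> based at \<open>u\<close>. Moving the base along one
    \<open>s\<close> in \<open>S\<close> gives a chain whose consecutive differences contain
    orthants with directions \<open>S - {s}\<close>, so one deviation level pays for one
    direction.\<close>
  have main: "card S \<le> m" if "devle m (tga_right_ideals \<tau>) (Psi U) (Psi U')" "S \<subseteq> X" "\<forall>y. y \<notin> X \<longrightarrow> u y = 0"
      "\<And>w. (\<forall>y. y \<notin> S \<longrightarrow> w y = 0) \<Longrightarrow> (\<lambda>y. u y + w y) \<in> U' - U"
      "\<And>v w. v \<in> U \<Longrightarrow> v \<le> w \<Longrightarrow> w \<in> U" "\<And>v w. v \<in> U' \<Longrightarrow> v \<le> w \<Longrightarrow> w \<in> U'" "U \<subseteq> U'" for S u U U' m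
    using that
  proof (induction m arbitrary: S u U U')
    case (0 S u U U')
    show ?case
    proof (rule ccontr)
      assume "\<not> ?case"
      then obtain s where s: "s \<in> S" by fastforce
      define e where "e i = u(s := u s + i)" for i :: nat
      have eeq: "e i = (\<lambda>y. u y + (if y = s then i else 0))" for i by (auto simp: e_def)
      have eU: "e i \<in> U' - U" for i unfolding eeq using s by (intro 0(4)) auto
      define T where "T i = U \<union> {v. e i \<le> v}" for i
      have eT: "e (Suc i) \<le> v \<Longrightarrow> e i \<le> v" for i v unfolding e_def le_fun_def by (auto split: if_splits dest: spec[of _ s])
      have "\<forall>i. Psi (T i) \<in> tga_right_ideals \<tau> \<and> Psi U \<subseteq> Psi (T i) \<and> Psi (T i) \<subseteq> Psi U' \<and> Psi (T (Suc i)) \<subseteq> Psi (T i)"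
      proof (intro allI conjI Psi_R Psi_mono)
        fix i
        show "U \<subseteq> T i" by (simp add: T_def)
        show "T i \<subseteq> U'" unfolding T_def using eU[of i] 0(6,7) by blast
        show "T (Suc i) \<subseteq> T i" unfolding T_def using eT by blast
      qed
      from mp[OF spec[OF 0(1)[unfolded devle.simps], of "\<lambda>i. Psi (T i)"] this]
      obtain l where "\<forall>i\<ge>l. Psi (T (Suc i)) = Psi (T i)" ..
      then have "Psi (T l) \<subseteq> Psi (T (Suc l))" by simp
      moreover have "\<not> Psi (T l) \<subseteq> Psi (T (Suc l))"
      proof (rule strict[of "e l"])
        show "\<forall>y. y \<notin> X \<longrightarrow> e l y = 0" using 0(2,3) s by (auto simp: e_def)
        show "e l \<in> T l" by (simp add: T_def)
        show "e l \<notin> T (Suc l)" using eU[of l] by (auto simp: T_def e_def le_fun_def)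
        show "v \<in> T l \<Longrightarrow> v \<le> w \<Longrightarrow> w \<in> T l" for v w using 0(5) unfolding T_def by (auto intro: order_trans)
      qed
      ultimately show False by blast
    qed
  next
    case (Suc m S u U U')
    show ?case
    proof (cases "S = {}")
      case False
      then obtain s where s: "s \<in> S" by blast
      define e where "e i = u(s := u s + i)" for i :: nat
      have eeq: "e i = (\<lambda>y. u y + (if y = s then i else 0))" for i by (auto simp: e_def)
      have eU: "e i \<in> U' - U" for i unfolding eeq using s by (intro Suc.prems(4)) auto
      define T where "T i = U \<union> {v. e i \<le> v}" for i
      have eT: "e (Suc i) \<le> v \<Longrightarrow> e i \<le> v" for i v unfolding e_def le_fun_def by (auto split: if_splits dest: spec[of _ s])
      have "\<forall>i. Psi (T i) \<in> tga_right_ideals \<tau> \<and> Psi U \<subseteq> Psi (T i) \<and> Psi (T i) \<subseteq> Psi U' \<and> Psi (T (Suc i)) \<subseteq> Psi (T i)"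
      proof (intro allI conjI Psi_R Psi_mono)
        fix i
        show "U \<subseteq> T i" by (simp add: T_def)
        show "T i \<subseteq> U'" unfolding T_def using eU[of i] Suc.prems(6,7) by blast
        show "T (Suc i) \<subseteq> T i" unfolding T_def using eT by blast
      qed
      from mp[OF spec[OF Suc.prems(1)[unfolded devle.simps], of "\<lambda>i. Psi (T i)"] this]
      obtain l where "\<forall>i\<ge>l. devle m (tga_right_ideals \<tau>) (Psi (T (Suc i))) (Psi (T i))" ..
      then have dl: "devle m (tga_right_ideals \<tau>) (Psi (T (Suc l))) (Psi (T l))" by simp
      have "card (S - {s}) \<le> m"
      proof (rule Suc.IH[OF dl, of "S - {s}" "e l"])
        show "S - {s} \<subseteq> X" using Suc.prems(2) by blast
        show "\<forall>y. y \<notin> X \<longrightarrow> e l y = 0" using Suc.prems(2,3) s by (auto simp: e_def)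
        show "T (Suc l) \<subseteq> T l" using eT by (auto simp: T_def)
        show "v \<in> T i \<Longrightarrow> v \<le> w \<Longrightarrow> w \<in> T i" for v w i using Suc.prems(5) unfolding T_def by (auto intro: order_trans)
        show "v \<in> T i \<Longrightarrow> v \<le> w \<Longrightarrow> w \<in> T i" for v w i using Suc.prems(5) unfolding T_def by (auto intro: order_trans)
        fix w :: "'a \<Rightarrow> nat" assume w: "\<forall>y. y \<notin> S - {s} \<longrightarrow> w y = 0"
        \<comment> \<open>A shift by \<open>w\<close> from the new base is a shift from
          \<open>u\<close> that takes \<open>l\<close> steps along \<open>s\<close>.\<close>
        have "(\<lambda>y. e l y + w y) = (\<lambda>y. u y + (w(s := l)) y)" using w by (auto simp: e_def)
        moreover have "(\<lambda>y. u y + (w(s := l)) y) \<in> U' - U" using w s by (intro Suc.prems(4)) auto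
        ultimately have "(\<lambda>y. e l y + w y) \<notin> U" by simp
        moreover have "\<not> e (Suc l) \<le> (\<lambda>y. e l y + w y)" using w by (auto simp: e_def le_fun_def)
        moreover have "e l \<le> (\<lambda>y. e l y + w y)" by (simp add: le_fun_def)
        ultimately show "(\<lambda>y. e l y + w y) \<in> T l - T (Suc l)" by (simp add: T_def)
      qed
      then show ?thesis using s card_Suc_Diff1[of S s] finite_subset[OF Suc.prems(2)] X(1) by (simp add: indep_def)
    qed simp
  qed
  have dev': "devle m (tga_right_ideals \<tau>) (Psi {}) (Psi UNIV)"
    using dev
  proof (rule devle_mono)
    show "{\<lambda>_. 0} \<subseteq> Psi {}" by (simp add: Psi_def rsh_def lam_def)
    show "Psi UNIV \<subseteq> tga_carrier" by (auto simp: Psi_def tga_carrier_def)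
  qed
  show ?thesis by (rule main[OF dev', of X "\<lambda>_. 0"]) auto
qed

theorem isotropic_card_le_tga_kdim:
  assumes "indep X" "isotropic X"
  shows "enat (card X) \<le> tga_kdim \<tau>"
proof (cases "\<exists>m. devle m (tga_right_ideals \<tau>) {\<lambda>_. 0} tga_carrier")
  case True
  then have "card X \<le> (LEAST m. devle m (tga_right_ideals \<tau>) {\<lambda>_. 0} tga_carrier)"
    by (rule isotropic_card_le_devle[OF assms LeastI_ex])
  then show ?thesis using True by (simp add: tga_kdim_def kdim_def)
next
  case False
  then show ?thesis by (simp add: tga_kdim_def kdim_def)
qed

end

subsection \<open>Isotropic sets in a product\<close>

lemma additive_zero: "(\<And>x y. f (x + y) = f x + f y) \<Longrightarrow> f (0::'a::ab_group_add) = (0::'b::ab_group_add)"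
  by (metis add_cancel_right_right)

lemma additive_zspan_sum:
  fixes f :: "'a::ab_group_add \<Rightarrow> 'b::ab_group_add"
  assumes "\<And>x y. f (x + y) = f x + f y"
  shows "f (\<Sum>y\<in>Y. zsc (c y) y) = (\<Sum>y\<in>Y. zsc (c y) (f y))"
  by (induction Y rule: infinite_finite_induct)
    (auto simp: assms additive_zero[of f, OF assms] additive_zsc[of f, OF assms])

lemma zspan_image:
  fixes f :: "'a::ab_group_add \<Rightarrow> 'b::ab_group_add"
  assumes add: "\<And>x y. f (x + y) = f x + f y" and X: "finite X" and z: "z \<in> zspan (f ` X)"
  shows "\<exists>x\<in>zspan X. z = f x"
proof -
  have "z \<in> f ` zspan X"
  proof (rule zspan_minimal[OF z])
    show "f ` X \<subseteq> f ` zspan X" using zspan_base[OF X] by blast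
    show "0 \<in> f ` zspan X" using additive_zero[of f, OF add] by (intro image_eqI[of _ _ 0]) auto
    show "x + y \<in> f ` zspan X" if "x \<in> f ` zspan X" "y \<in> f ` zspan X" for x y
      using that by (auto simp: add[symmetric] intro!: imageI zspan_add)
    show "zsc k x \<in> f ` zspan X" if "x \<in> f ` zspan X" for k x
      using that by (auto simp: additive_zsc[of f, OF add, symmetric] intro!: imageI zspan_zsc)
  qed
  then show ?thesis by blast
qed

lemma indep_image:
  fixes f :: "'a::ab_group_add \<Rightarrow> 'b::ab_group_add"
  assumes add: "\<And>x y. f (x + y) = f x + f y" and Y: "indep Y" and ker: "\<And>y. y \<in> zspan Y \<Longrightarrow> f y = 0 \<Longrightarrow> y = 0"
  shows "indep (f ` Y)" "card (f ` Y) = card Y"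
proof -
  have fin: "finite Y" using Y by (simp add: indep_def)
  have inj: "inj_on f Y"
  proof (rule inj_onI)
    fix x y assume xy: "x \<in> Y" "y \<in> Y" "f x = f y"
    have "x + zsc (-1) y \<in> zspan Y" using xy zspan_base[OF fin] by (intro zspan_add zspan_zsc)
    moreover have "f (x + zsc (-1) y) = 0"
      unfolding add additive_zsc[of f, OF add] using xy(3) by (simp add: zsc_minus)
    ultimately have "x + zsc (-1) y = 0" by (rule ker)
    then show "x = y" by (simp add: zsc_minus)
  qed
  then show "card (f ` Y) = card Y" by (rule card_image)
  have "c (f y) = 0" if c: "(\<Sum>z\<in>f ` Y. zsc (c z) z) = 0" and y: "y \<in> Y" for c y
  proof -
    have "f (\<Sum>y\<in>Y. zsc (c (f y)) y) = (\<Sum>z\<in>f ` Y. zsc (c z) z)"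
      unfolding sum.reindex[OF inj] o_def by (rule additive_zspan_sum[of f, OF add])
    then have "(\<Sum>y\<in>Y. zsc (c (f y)) y) = 0" using c by (intro ker) (auto simp: zspan_def)
    then show ?thesis using indepD[OF Y, of "\<lambda>y. c (f y)"] y by blast
  qed
  then show "indep (f ` Y)" using fin unfolding indep_def by blast
qed

text \<open>A nonzero multiple of \<open>s\<close>, written once through \<open>Z - X\<close> and
  once through \<open>X\<close>, is a relation on \<open>Z\<close>.\<close>

lemma indep_disjoint_isolator:
  assumes Z: "indep Z" and X: "X \<subseteq> Z" and s: "s \<in> zspan (Z - X)" "s \<in> isolator X"
  shows "s = 0"
proof -
  have fin: "finite Z" "finite X" using Z X finite_subset by (auto simp: indep_def)
  obtain c where c: "s = (\<Sum>y\<in>Z - X. zsc (c y) y)" using s(1) by (auto simp: zspan_def)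
  obtain m e where m: "m \<noteq> 0" "zsc m s = (\<Sum>x\<in>X. zsc (e x) x)" using s(2) by (auto simp: isolator_def zspan_def)
  define k where "k z = (if z \<in> X then - e z else m * c z)" for z
  have "(\<Sum>z\<in>Z. zsc (k z) z) = (\<Sum>z\<in>Z - X. zsc (k z) z) + (\<Sum>z\<in>X. zsc (k z) z)"
    using sum.subset_diff[OF X fin(1)] .
  also have "(\<Sum>z\<in>Z - X. zsc (k z) z) = zsc m s"
    unfolding c zsc_sum by (intro sum.cong) (auto simp: k_def zsc_zsc)
  also have "(\<Sum>z\<in>X. zsc (k z) z) = - zsc m s"
    unfolding m(2) sum_negf[symmetric] by (intro sum.cong) (auto simp: k_def zsc_minus)
  finally have "(\<Sum>z\<in>Z. zsc (k z) z) = 0" by simp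
  then have "k y = 0" if "y \<in> Z - X" for y using indepD[OF Z, of k y] that by blast
  then have "c y = 0" if "y \<in> Z - X" for y using that m(1) by (force simp: k_def)
  then show ?thesis unfolding c by (intro sum.neutral) auto
qed

context cocycle
begin

lemma commutator_zsc: "commutator (zsc m x) z = commutator x (zsc m z)"
proof -
  have inv: "commutator a b = inverse (commutator b a)" for a b by (simp add: commutator_def)
  have 1: "commutator (zsc (m + 1) x) z = commutator x z * commutator (zsc m x) z" for m
    by (simp add: zsc_Suc commutator_add_left)
  have 2: "commutator x (zsc (m + 1) z) = commutator x z * commutator x (zsc m z)" for m
    unfolding inv[of x] by (simp add: zsc_Suc commutator_add_left)
  have 0: "commutator 0 b = 1" for b using commute_zero[of b] by (simp add: commute_iff)
  show ?thesis
  proof (induction m rule: int_induct[where k = 0])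
    case base
    then show ?case using 0 inv[of x 0] by simp
  next
    case (step1 i)
    then show ?case by (simp add: 1 2)
  next
    case (step2 i)
    then show ?case using 1[of "i - 1"] 2[of "i - 1"] by simp
  qed
qed

text \<open>The basis element of an \<open>x\<close> in the radical of the commutator form is
  central, and central elements are supported at 0.\<close>

lemma center_is_F_nondegenerate:
  assumes "center_is_F \<tau>" "\<And>y. commute x y"
  shows "x = 0"
proof (rule ccontr)
  assume "x \<noteq> 0"
  have "single x \<in> tga_center \<tau>" unfolding tga_center_def mem_Collect_eq
  proof (intro conjI ballI)
    show "single x \<in> tga_carrier" by (simp add: tga_carrier_def)
    fix y :: "'a \<Rightarrow> 'f" assume "y \<in> tga_carrier"
    then have "tga_mult \<tau> y (single x) = rsh x y" by (intro tga_mult_single) (simp add: tga_carrier_def)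
    moreover have "tga_mult \<tau> (single x) y = rsh x y"
    proof
      fix c
      have "\<tau> x (c - x) = \<tau> (c - x) x" using assms(2)[of "c - x"] by (simp add: commute_def)
      then show "tga_mult \<tau> (single x) y c = rsh x y c"
        unfolding tga_mult_def supp_single by (simp add: rsh_def single_def)
    qed
    ultimately show "tga_mult \<tau> (single x) y = tga_mult \<tau> y (single x)" by simp
  qed
  then have "single x x = (0::'f)" using assms(1) \<open>x \<noteq> 0\<close> unfolding center_is_F_def by blast
  then show False by (simp add: single_def)
qed

end

text \<open>The form is bimultiplicative, so a multiplier of \<open>z\<close> can be moved to
  \<open>g\<close>. One nonzero multiple of \<open>g\<close> that works for a whole basis lies in
  the radical, and the group is torsion free.\<close>

lemma (in twisted_lattice) commute_multiples:
  assumes nondeg: "\<And>x. (\<And>y. commute x y) \<Longrightarrow> x = 0"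
    and mult: "\<And>z. \<exists>m. m \<noteq> 0 \<and> commute g (zsc m z)"
  shows "g = 0"
proof -
  have "\<forall>i. \<exists>e. \<forall>j<n. coord e j = (if j = i then 1 else 0)" by (intro allI coord_surj)
  from choice[OF this] obtain e where e: "\<And>i j. j < n \<Longrightarrow> coord (e i) j = (if j = i then 1 else 0)" by blast
  obtain m where m: "\<And>z. m z \<noteq> 0" "\<And>z. commute g (zsc (m z) z)" using mult by metis
  define M where "M = (\<Prod>i<n. m (e i))"
  have M: "M \<noteq> 0" using m(1) by (simp add: M_def)
  have gi: "commute (zsc M g) (e i)" if "i < n" for i
  proof -
    have "commute (zsc (m (e i)) g) (e i)" using m(2)[of "e i"] by (simp add: commute_iff commutator_zsc)
    moreover have "m (e i) dvd M" unfolding M_def using that by (intro dvd_prodI) auto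
    then obtain k where "M = k * m (e i)" by (metis dvd_def mult.commute)
    ultimately show ?thesis by (simp add: zsc_zsc commute_zsc)
  qed
  have "commute (zsc M g) y" for y
  proof -
    have y: "y = (\<Sum>i<n. zsc (coord y i) (e i))"
    proof (rule coord_inj)
      fix j assume "j < n"
      then show "coord y j = coord (\<Sum>i<n. zsc (coord y i) (e i)) j"
        by (simp add: coord_sum coord_zsc e if_distrib[of "(*) _"] sum.delta cong: if_cong)
    qed
    have "commute (\<Sum>i<n. zsc (coord y i) (e i)) (zsc M g)"
      by (intro commute_sum commute_zsc commute_sym[OF gi]) simp
    then show ?thesis using y commute_sym by metis
  qed
  then have "zsc M g = 0" by (rule nondeg)
  then show ?thesis using zsc_eq_0D M by blast
qed

section \<open>The bound for isotropic sets in a product\<close>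

lemma two_cocycle_tensor: "two_cocycle \<tau>1 \<Longrightarrow> two_cocycle \<tau>2 \<Longrightarrow> two_cocycle (tensor_cocycle \<tau>1 \<tau>2)"
  unfolding two_cocycle_def tensor_cocycle_def
  by (auto simp: mult.assoc mult.left_commute)

lemma lattice_product:
  assumes "lattice n1 coord1" "lattice n2 coord2"
  shows "lattice (n1 + n2) (\<lambda>a i. if i < n1 then coord1 (fst a) i else coord2 (snd a) (i - n1))"
proof -
  interpret L1: lattice n1 coord1 by fact
  interpret L2: lattice n2 coord2 by fact
  show ?thesis
  proof
    fix a b :: "'a \<times> 'b" and i
    show "(if i < n1 then coord1 (fst (a + b)) i else coord2 (snd (a + b)) (i - n1)) =
      (if i < n1 then coord1 (fst a) i else coord2 (snd a) (i - n1)) +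
      (if i < n1 then coord1 (fst b) i else coord2 (snd b) (i - n1))"
      by (simp add: L1.coord_add L2.coord_add)
  next
    fix a b :: "'a \<times> 'b"
    assume *: "\<And>i. i < n1 + n2 \<Longrightarrow> (if i < n1 then coord1 (fst a) i else coord2 (snd a) (i - n1)) =
      (if i < n1 then coord1 (fst b) i else coord2 (snd b) (i - n1))"
    have "coord1 (fst a) i = coord1 (fst b) i" if "i < n1" for i using *[of i] that by simp
    then have "fst a = fst b" by (rule L1.coord_inj)
    moreover have "coord2 (snd a) i = coord2 (snd b) i" if "i < n2" for i using *[of "n1 + i"] that by simp
    then have "snd a = snd b" by (rule L2.coord_inj)
    ultimately show "a = b" by (rule prod_eqI)
  next
    fix f :: "nat \<Rightarrow> int"
    obtain a b where "\<forall>i<n1. coord1 a i = f i" "\<forall>i<n2. coord2 b i = f (n1 + i)"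
      using L1.coord_surj[of f] L2.coord_surj[of "\<lambda>i. f (n1 + i)"] by blast
    then show "\<exists>a. \<forall>i<n1 + n2. (if i < n1 then coord1 (fst a) i else coord2 (snd a) (i - n1)) = f i"
      by (intro exI[of _ "(a, b)"]) auto
  qed
qed

text \<open>Within \<open>B\<close> the commutator of the first components is inverse to that of the
  second ones, so commutation in one factor can be read off in the other. With \<open>X\<close>
  maximal independent in the part of \<open>B\<close> with second component 0, and \<open>?Y\<close>
  completing it in \<open>B\<close>, one has \<open>card X \<le> d1\<close> and
  \<open>card ?Y \<le> n2\<close>; failure of the bound leaves a total deficit of at most 1.\<close>

lemma isotropic_product_bound:
  fixes \<tau>1 :: "'a::ab_group_add \<Rightarrow> 'a \<Rightarrow> 'f::field" and \<tau>2 :: "'b::ab_group_add \<Rightarrow> 'b \<Rightarrow> 'f"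
  assumes tl1: "twisted_lattice n1 coord1 \<tau>1" and tl2: "twisted_lattice n2 coord2 \<tau>2"
    and X0: "indep X0" "cocycle.isotropic (tensor_cocycle \<tau>1 \<tau>2) X0"
    and d1: "\<And>X. indep X \<Longrightarrow> cocycle.isotropic \<tau>1 X \<Longrightarrow> card X \<le> d1"
    and d2: "\<And>X. indep X \<Longrightarrow> cocycle.isotropic \<tau>2 X \<Longrightarrow> card X \<le> d2" "d2 + 2 \<le> n2"
    and Y0: "indep Y0" "cocycle.isotropic \<tau>2 Y0" "2 \<le> card Y0"
    and nondeg: "\<And>x. (\<And>y. cocycle.commute \<tau>2 x y) \<Longrightarrow> x = 0"
  shows "card X0 + 2 \<le> d1 + n2"
proof (rule ccontr)
  assume "\<not> ?thesis"
  then have big: "d1 + n2 \<le> card X0 + 1" by simp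
  interpret C1: twisted_lattice n1 coord1 \<tau>1 by fact
  interpret C2: twisted_lattice n2 coord2 \<tau>2 by fact
  interpret P: cocycle "tensor_cocycle \<tau>1 \<tau>2"
    by standard (rule two_cocycle_tensor[OF C1.two_cocycle C2.two_cocycle])
  interpret L: lattice "n1 + n2" "\<lambda>a i. if i < n1 then coord1 (fst a) i else coord2 (snd a) (i - n1)"
    by (rule lattice_product) unfold_locales
  have fst_add: "fst (x + y) = fst x + fst y" and snd_add: "snd (x + y) = snd x + snd y" for x y :: "'a \<times> 'b"
    by simp_all
  have fst_zsc: "fst (zsc k x) = zsc k (fst x)" and snd_zsc: "snd (zsc k x) = zsc k (snd x)" for k and x :: "'a \<times> 'b"
    by (cases x; simp add: zsc_prod)+
  have P_commute: "P.commute x y \<longleftrightarrow>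
      \<tau>1 (fst x) (fst y) * \<tau>2 (snd x) (snd y) = \<tau>1 (fst y) (fst x) * \<tau>2 (snd y) (snd x)" for x y
    unfolding P.commute_def by (cases x; cases y) (simp add: tensor_cocycle_def)
  have comm1: "C1.commute (fst x) (fst y)" if "P.commute x y" "C2.commute (snd x) (snd y)" for x y
    using that by (simp add: P_commute C1.commute_def C2.commute_def)
  have comm2: "C2.commute (snd x) (snd y)" if "P.commute x y" "C1.commute (fst x) (fst y)" for x y
    using that by (simp add: P_commute C1.commute_def C2.commute_def)
  define B where "B = zspan X0"
  have finX0: "finite X0" using X0(1) by (simp add: indep_def)
  have Bcomm: "P.commute x y" if "x \<in> B" "y \<in> B" for x y
    using P.isotropic_zspan[OF X0(2)] that unfolding P.isotropic_def B_def by blast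
  have B_sub: "zspan W \<subseteq> B" if "W \<subseteq> B" for W
    by (rule subsetI, erule zspan_minimal) (use that in \<open>auto simp: B_def intro: zspan_add zspan_zsc\<close>)
  have X0B: "X0 \<subseteq> B" unfolding B_def using zspan_base[OF finX0] by blast
  define K where "K = {b \<in> B. snd b = 0}"
  define B2 where "B2 = {b \<in> B. fst b = 0}"
  obtain X where X: "X \<subseteq> K" "indep X" "K \<subseteq> isolator X"
    using indep_extend[of "{}" K, OF indep_empty _ L.indep_card_le_rank] by auto
  have XB: "X \<subseteq> B" using X(1) by (auto simp: K_def)
  have finX: "finite X" using X(2) by (simp add: indep_def)
  obtain Z where Z: "X \<subseteq> Z" "Z \<subseteq> B" "indep Z" "B \<subseteq> isolator Z"
    using indep_extend[OF X(2) XB L.indep_card_le_rank] by auto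
  have finZ: "finite Z" using Z(3) by (simp add: indep_def)
  let ?Y = "Z - X"
  have "card X0 \<le> card Z" using X0(1) finZ by (rule indep_card_le) (use X0B Z(4) in blast)
  moreover have "card Z = card X + card ?Y"
    using card_Diff_subset[OF finX Z(1)] card_mono[OF finZ Z(1)] by simp
  ultimately have XY: "card X0 \<le> card X + card ?Y" by simp
  have snd0: "snd w = 0" if "w \<in> zspan X" for w
  proof -
    have "w \<in> {w. snd w = 0}" by (rule zspan_minimal[OF that]) (use X(1) in \<open>auto simp: K_def snd_zsc\<close>)
    then show ?thesis by simp
  qed
  have Yi: "indep (snd ` ?Y)" "card (snd ` ?Y) = card ?Y"
  proof -
    have ker: "y = 0" if "y \<in> zspan ?Y" "snd y = 0" for y
    proof -
      have "y \<in> B" using that(1) B_sub[of ?Y] Z(2) by blast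
      then have "y \<in> isolator X" using that(2) X(3) by (auto simp: K_def)
      then show ?thesis using indep_disjoint_isolator[OF Z(3,1) that(1)] by simp
    qed
    have "indep ?Y" using Z(3) by (rule indep_subset) blast
    from indep_image[of snd, OF snd_add this ker] show "indep (snd ` ?Y)" "card (snd ` ?Y) = card ?Y" by auto
  qed
  have Yn: "card ?Y \<le> n2" using C2.indep_card_le_rank[OF Yi(1)] Yi(2) by simp
  have X1: "indep (fst ` X)" "card (fst ` X) = card X"
  proof -
    have ker: "y = 0" if "y \<in> zspan X" "fst y = 0" for y
      using snd0[OF that(1)] that(2) by (simp add: prod_eq_iff)
    from indep_image[of fst, OF fst_add X(2) ker] show "indep (fst ` X)" "card (fst ` X) = card X" by auto
  qed
  \<comment> \<open>\<open>X\<close> has second component 0, which commutes with everything.\<close>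
  have commX: "C1.commute (fst x) (fst b)" if "x \<in> X" "b \<in> B" for x b
  proof (rule comm1)
    show "P.commute x b" using Bcomm that XB by blast
    have "snd x = 0" using X(1) that(1) by (auto simp: K_def)
    then show "C2.commute (snd x) (snd b)" by simp
  qed
  have "C1.isotropic (fst ` X)" unfolding C1.isotropic_def using commX XB by blast
  then have Xd: "card X \<le> d1" using d1[OF X1(1)] X1(2) by simp
  show False
  proof (cases "card ?Y = n2")
    case True
    \<comment> \<open>\<open>?Y\<close> projects to an independent set of full rank, so every
      element of the second group has a nonzero multiple in the projection of
      \<open>B\<close>.\<close>
    have Bsnd: "\<exists>m b. m \<noteq> 0 \<and> b \<in> B \<and> snd b = zsc m z" for z
    proof -
      have "z \<in> isolator (snd ` ?Y)"
      proof (rule ccontr)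
        assume "z \<notin> isolator (snd ` ?Y)"
        from indep_insert[OF Yi(1) this] have "indep (insert z (snd ` ?Y))" "card (insert z (snd ` ?Y)) = Suc n2"
          using Yi(2) True finZ by auto
        then show False using C2.indep_card_le_rank[of "insert z (snd ` ?Y)"] by simp
      qed
      then obtain m where m: "m \<noteq> 0" "zsc m z \<in> zspan (snd ` ?Y)" by (auto simp: isolator_def)
      from zspan_image[of snd, OF snd_add _ m(2)] finZ obtain b where "b \<in> zspan ?Y" "zsc m z = snd b" by auto
      moreover have "b \<in> B" using calculation(1) B_sub[of ?Y] Z(2) by blast
      ultimately show ?thesis using m(1) by metis
    qed
    \<comment> \<open>The second component of such a \<open>g\<close> commutes with the projection
      of all of \<open>B\<close>, hence with a multiple of every element.\<close>
    have inj: "g = 0" if g: "g \<in> B" "fst g = 0" for g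
    proof -
      have "snd g = 0"
      proof (rule C2.commute_multiples[OF nondeg])
        show "\<exists>m. m \<noteq> 0 \<and> C2.commute (snd g) (zsc m z)" for z
        proof -
          obtain m b where mb: "m \<noteq> 0" "b \<in> B" "snd b = zsc m z" using Bsnd by blast
          have "C2.commute (snd g) (snd b)" using g mb(2) Bcomm by (intro comm2) auto
          then show ?thesis using mb by auto
        qed
      qed
      then show ?thesis using g(2) by (simp add: prod_eq_iff)
    qed
    obtain T where T: "T \<subseteq> Y0" "card T = 2" using obtain_subset_with_card_n[OF Y0(3)] by blast
    then obtain y1 y2 where y: "T = {y1, y2}" "y1 \<noteq> y2" by (auto simp: card_2_iff)
    have indT: "indep {y1, y2}" using indep_subset[OF Y0(1) T(1)] y by simp
    have rel: "k = 0 \<and> l = 0" if "zsc k y1 + zsc l y2 = 0" for k l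
    proof -
      define c where "c y = (if y = y1 then k else l)" for y
      have "(\<Sum>y\<in>{y1, y2}. zsc (c y) y) = 0" using that y(2) by (simp add: c_def)
      then have "c y1 = 0" "c y2 = 0" using indepD[OF indT, of c] by auto
      then show ?thesis using y(2) by (simp add: c_def split: if_splits)
    qed
    \<comment> \<open>Lift multiples of two independent commuting elements. Their second components
      lie in the isotropic \<open>zspan Y0\<close>, so adjoining the lifts to \<open>X\<close> keeps
      the first components isotropic and raises the rank by two, although \<open>card X\<close> is
      at least \<open>d1 - 1\<close>.\<close>
    obtain m1 b1 where b1: "m1 \<noteq> 0" "b1 \<in> B" "snd b1 = zsc m1 y1" using Bsnd by blast
    obtain m2 b2 where b2: "m2 \<noteq> 0" "b2 \<in> B" "snd b2 = zsc m2 y2" using Bsnd by blast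
    have n1: "b1 \<notin> isolator X"
    proof
      assume "b1 \<in> isolator X"
      then obtain m where m: "m \<noteq> 0" "zsc m b1 \<in> zspan X" by (auto simp: isolator_def)
      have "zsc (m * m1) y1 + zsc 0 y2 = 0" using snd0[OF m(2)] by (simp add: snd_zsc b1(3) zsc_zsc)
      then show False using rel m(1) b1(1) by fastforce
    qed
    have i1: "indep (insert b1 X)" "b1 \<notin> X" using indep_insert[OF X(2) n1] by auto
    \<comment> \<open>Over the span of \<open>b1\<close> and \<open>X\<close> only multiples of
      \<open>y1\<close> occur as second components.\<close>
    have n2: "b2 \<notin> isolator (insert b1 X)"
    proof
      assume "b2 \<in> isolator (insert b1 X)"
      then obtain m where m: "m \<noteq> 0" "zsc m b2 \<in> zspan (insert b1 X)" by (auto simp: isolator_def)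
      have "zsc m b2 \<in> {w. \<exists>k. snd w = zsc k y1}"
      proof (rule zspan_minimal[OF m(2)])
        show "insert b1 X \<subseteq> {w. \<exists>k. snd w = zsc k y1}"
        proof
          fix w assume "w \<in> insert b1 X"
          then have "snd w = zsc m1 y1 \<or> snd w = zsc 0 y1" using b1(3) X(1) by (auto simp: K_def)
          then show "w \<in> {w. \<exists>k. snd w = zsc k y1}" by blast
        qed
        show "0 \<in> {w. \<exists>k. snd w = zsc k y1}" by (auto intro: exI[of _ 0])
        show "x + y \<in> {w. \<exists>k. snd w = zsc k y1}"
          if "x \<in> {w. \<exists>k. snd w = zsc k y1}" "y \<in> {w. \<exists>k. snd w = zsc k y1}" for x y :: "'a \<times> 'b"
          using that by (auto simp: zsc_add[symmetric])
        show "zsc k x \<in> {w. \<exists>k. snd w = zsc k y1}" if "x \<in> {w. \<exists>k. snd w = zsc k y1}" for k and x :: "'a \<times> 'b"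
          using that by (auto simp: snd_zsc zsc_zsc[symmetric])
      qed
      then obtain k where k: "zsc (m * m2) y2 = zsc k y1" by (auto simp: snd_zsc b2(3) zsc_zsc)
      have "zsc (- k) y1 + zsc (m * m2) y2 = 0" unfolding k by (simp add: zsc_minus)
      then show False using rel m(1) b2(1) by fastforce
    qed
    let ?W = "insert b2 (insert b1 X)"
    have i2: "indep ?W" "b2 \<notin> insert b1 X" using indep_insert[OF i1(1) n2] by auto
    have WB: "?W \<subseteq> B" using XB b1 b2 by blast
    have cW: "card ?W = card X + 2" using finX i1(2) i2(2) by simp
    have W1: "indep (fst ` ?W)" "card (fst ` ?W) = card ?W"
    proof -
      have ker: "g = 0" if "g \<in> zspan ?W" "fst g = 0" for g using inj that B_sub[OF WB] by blast
      from indep_image[of fst, OF fst_add i2(1) ker] show "indep (fst ` ?W)" "card (fst ` ?W) = card ?W" by auto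
    qed
    have sndW: "snd w \<in> zspan Y0" if "w \<in> ?W" for w
    proof -
      have finY0: "finite Y0" using Y0(1) by (simp add: indep_def)
      have "y1 \<in> zspan Y0" "y2 \<in> zspan Y0" using T(1) y zspan_base[OF finY0] by auto
      then show ?thesis using that b1(3) b2(3) X(1) by (auto simp: K_def intro: zspan_zsc)
    qed
    have "C1.isotropic (fst ` ?W)" unfolding C1.isotropic_def
    proof (intro ballI)
      fix p q assume "p \<in> fst ` ?W" "q \<in> fst ` ?W"
      then obtain w v where wv: "w \<in> ?W" "p = fst w" "v \<in> ?W" "q = fst v" by blast
      have "P.commute w v" using Bcomm WB wv by blast
      moreover have "C2.commute (snd w) (snd v)"
        using C2.isotropic_zspan[OF Y0(2)] sndW wv unfolding C2.isotropic_def by blast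
      ultimately show "C1.commute p q" unfolding wv by (rule comm1)
    qed
    then have "card X + 2 \<le> d1" using d1[OF W1(1)] W1(2) cW by simp
    then show False using XY True big by simp
  next
    case False
    \<comment> \<open>The deficit of one is used up by \<open>?Y\<close>, so \<open>X\<close>
      already has the largest possible rank and any enlargement is contradictory.\<close>
    then have Xd1: "card X = d1" and X0n: "card X + n2 \<le> card X0 + 1" using XY big Yn Xd by linarith+
    obtain Z2 where Z2: "Z2 \<subseteq> B2" "indep Z2" "B2 \<subseteq> isolator Z2"
      using indep_extend[of "{}" B2, OF indep_empty _ L.indep_card_le_rank] by auto
    have finZ2: "finite Z2" using Z2(2) by (simp add: indep_def)
    have fst0: "fst w = 0" if "w \<in> zspan Z2" for w
    proof -
      have "w \<in> {w. fst w = 0}" by (rule zspan_minimal[OF that]) (use Z2(1) in \<open>auto simp: B2_def fst_zsc\<close>)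
      then show ?thesis by simp
    qed
    have "card Z2 \<le> d2"
    proof -
      have ker: "y = 0" if "y \<in> zspan Z2" "snd y = 0" for y
        using fst0[OF that(1)] that(2) by (simp add: prod_eq_iff)
      note Zi = indep_image[of snd, OF snd_add Z2(2) ker]
      have "C2.isotropic (snd ` Z2)" unfolding C2.isotropic_def
      proof (intro ballI)
        fix p q assume "p \<in> snd ` Z2" "q \<in> snd ` Z2"
        then obtain w v where wv: "w \<in> Z2" "p = snd w" "v \<in> Z2" "q = snd v" by blast
        then have "w \<in> B" "v \<in> B" "fst w = 0" using Z2(1) by (auto simp: B2_def)
        then show "C2.commute p q" unfolding wv using Bcomm by (intro comm2) auto
      qed
      then show ?thesis using d2(1)[OF Zi(1)] Zi(2) by simp
    qed
    \<comment> \<open>Here \<open>d2 + 2 \<le> n2\<close> enters: the parts of \<open>B\<close>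
      inside the two factors together have smaller rank than \<open>B\<close>. An element
      \<open>b\<close> independent of both has a first component independent of those of
      \<open>X\<close>.\<close>
    then have "card (X \<union> Z2) < card X0" using card_Un_le[of X Z2] d2(2) X0n by linarith
    then have "\<not> X0 \<subseteq> isolator (X \<union> Z2)" using indep_card_le[OF X0(1), of "X \<union> Z2"] finX finZ2 by auto
    then obtain b where b: "b \<in> X0" "b \<notin> isolator (X \<union> Z2)" by blast
    have bB: "b \<in> B" using b(1) X0B by blast
    have "fst b \<notin> isolator (fst ` X)"
    proof
      assume "fst b \<in> isolator (fst ` X)"
      then obtain m where m: "m \<noteq> 0" "zsc m (fst b) \<in> zspan (fst ` X)" by (auto simp: isolator_def)
      from zspan_image[of fst, OF fst_add finX m(2)] obtain x where x: "x \<in> zspan X" "zsc m (fst b) = fst x" by blast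
      let ?g = "zsc m b + zsc (-1) x"
      have "x \<in> B" using x(1) B_sub[OF XB] by blast
      then have "?g \<in> B" using bB unfolding B_def by (intro zspan_add zspan_zsc)
      moreover have "fst ?g = 0" using x(2) by (simp add: fst_zsc zsc_minus)
      ultimately have "?g \<in> isolator Z2" using Z2(3) by (auto simp: B2_def)
      then obtain l where l: "l \<noteq> 0" "zsc l ?g \<in> zspan Z2" by (auto simp: isolator_def)
      have "zsc l ?g \<in> zspan (X \<union> Z2)" using l(2) zspan_mono[of "X \<union> Z2" Z2] finX finZ2 by blast
      moreover have "zsc l x \<in> zspan (X \<union> Z2)"
        using zspan_zsc[OF x(1), of l] zspan_mono[of "X \<union> Z2" X] finX finZ2 by blast
      ultimately have "zsc l ?g + zsc l x \<in> zspan (X \<union> Z2)" by (rule zspan_add)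
      moreover have "zsc l ?g + zsc l x = zsc (l * m) b"
        by (simp add: zsc_add_right[symmetric] zsc_zsc zsc_minus)
      ultimately have "b \<in> isolator (X \<union> Z2)" using l(1) m(1) unfolding isolator_def
        by (metis (mono_tags, lifting) mem_Collect_eq mult_eq_0_iff)
      then show False using b(2) by simp
    qed
    from indep_insert[OF X1(1) this] have W: "indep (insert (fst b) (fst ` X))" "card (insert (fst b) (fst ` X)) = Suc d1"
      using X1(2) Xd1 finX by auto
    have "C1.isotropic (insert (fst b) (fst ` X))" unfolding C1.isotropic_def
      using commX[OF _ bB] commX XB C1.commute_sym C1.commute_refl by blast
    then show False using d1[OF W(1)] W(2) by simp
  qed
qed

section \<open>Coordinates from a basis, and the conclusion\<close>

definition basis_coord :: "'a::ab_group_add list \<Rightarrow> 'a \<Rightarrow> nat \<Rightarrow> int" where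
  "basis_coord bs a i = (if i < length bs then
     (THE c. length c = length bs \<and> a = (\<Sum>i<length bs. zsc (c ! i) (bs ! i))) ! i else 0)"

text \<open>Beyond the length of the basis the coordinates default to 0, which makes them additive
  at every index, as \<open>lattice\<close> demands; uniqueness of the coefficients gives the
  rest.\<close>

lemma lattice_basis:
  assumes "ab_basis bs"
  shows "lattice (length bs) (basis_coord bs)"
proof -
  let ?n = "length bs"
  let ?P = "\<lambda>a c. length c = ?n \<and> a = (\<Sum>i<?n. zsc (c ! i) (bs ! i))"
  have uniq: "\<exists>!c. ?P a c" for a using assms by (simp add: ab_basis_def)
  have coordI: "basis_coord bs a i = f i" if a: "a = (\<Sum>i<?n. zsc (f i) (bs ! i))" and i: "i < ?n" for a f i
  proof -
    have "?P a (map f [0..<?n])" unfolding a by (auto intro!: sum.cong)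
    then have "(THE c. ?P a c) = map f [0..<?n]" using uniq by (rule the1_equality[rotated])
    then show ?thesis using i by (simp add: basis_coord_def)
  qed
  have rep: "a = (\<Sum>i<?n. zsc (basis_coord bs a i) (bs ! i))" for a
  proof -
    have "?P a (THE c. ?P a c)" by (rule theI'[OF uniq])
    then have "a = (\<Sum>i<?n. zsc ((THE c. ?P a c) ! i) (bs ! i))" by (rule conjunct2)
    also have "\<dots> = (\<Sum>i<?n. zsc (basis_coord bs a i) (bs ! i))"
      by (intro sum.cong) (auto simp: basis_coord_def)
    finally show ?thesis .
  qed
  show ?thesis
  proof
    fix a b i
    show "basis_coord bs (a + b) i = basis_coord bs a i + basis_coord bs b i"
    proof (cases "i < ?n")
      case True
      show ?thesis
      proof (rule coordI[OF _ True])
        have "a + b = (\<Sum>i<?n. zsc (basis_coord bs a i) (bs ! i)) + (\<Sum>i<?n. zsc (basis_coord bs b i) (bs ! i))"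
          using rep[of a] rep[of b] by (rule arg_cong2)
        then show "a + b = (\<Sum>i<?n. zsc (basis_coord bs a i + basis_coord bs b i) (bs ! i))"
          by (simp add: zsc_add sum.distrib)
      qed
    qed (simp add: basis_coord_def)
  next
    fix a b assume "\<And>i. i < ?n \<Longrightarrow> basis_coord bs a i = basis_coord bs b i"
    then have "(\<Sum>i<?n. zsc (basis_coord bs a i) (bs ! i)) = (\<Sum>i<?n. zsc (basis_coord bs b i) (bs ! i))"
      by (intro sum.cong) auto
    then show "a = b" using rep[of a] rep[of b] by simp
  next
    fix f :: "nat \<Rightarrow> int"
    show "\<exists>a. \<forall>i<?n. basis_coord bs a i = f i" using coordI[OF refl] by blast
  qed
qed

lemma free_fg_ab_lattice:
  assumes "free_fg_ab TYPE('a::ab_group_add)"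
  shows "\<exists>coord::'a \<Rightarrow> nat \<Rightarrow> int. lattice (grk TYPE('a)) coord"
proof -
  have "ab_basis (SOME bs::'a list. ab_basis bs)"
    using assms unfolding free_fg_ab_def by (rule someI_ex)
  from lattice_basis[OF this] show ?thesis unfolding grk_def by blast
qed

lemma tga_kdim_eq_max_isotropic:
  fixes coord :: "'a::ab_group_add \<Rightarrow> nat \<Rightarrow> int" and \<tau> :: "'a \<Rightarrow> 'a \<Rightarrow> 'f::field"
  assumes "lattice n coord" "two_cocycle \<tau>"
  shows "\<exists>X. indep X \<and> cocycle.isotropic \<tau> X \<and> tga_kdim \<tau> = enat (card X) \<and>
    (\<forall>Y. indep Y \<longrightarrow> cocycle.isotropic \<tau> Y \<longrightarrow> card Y \<le> card X)"
proof -
  interpret twisted_lattice n coord \<tau> using assms by (simp add: twisted_lattice_def cocycle_def)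
  obtain X where X: "indep X" "isotropic X" "tga_kdim \<tau> \<le> enat (card X)" using tga_kdim_le_isotropic by blast
  then have "tga_kdim \<tau> = enat (card X)" using isotropic_card_le_tga_kdim[OF X(1,2)] by simp
  then show ?thesis using X isotropic_card_le_tga_kdim by fastforce
qed

theorem theorem5p14:
  fixes \<tau>1 :: "'a::ab_group_add \<Rightarrow> 'a \<Rightarrow> 'f::field"
    and \<tau>2 :: "'b::ab_group_add \<Rightarrow> 'b \<Rightarrow> 'f"
  assumes "free_fg_ab TYPE('a)" and "free_fg_ab TYPE('b)"
    and "two_cocycle \<tau>1" and "two_cocycle \<tau>2"
    and "tga_codim TYPE('a) \<tau>1 \<ge> 2" and "tga_codim TYPE('b) \<tau>2 \<ge> 2"
    and "tga_kdim \<tau>1 \<ge> 2" and "tga_kdim \<tau>2 \<ge> 2"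
    and "center_is_F \<tau>1" and "center_is_F \<tau>2"
  shows "tga_kdim (tensor_cocycle \<tau>1 \<tau>2)
           < min (tga_kdim \<tau>1 + enat (grk TYPE('b))) (tga_kdim \<tau>2 + enat (grk TYPE('a))) - 1"
proof -
  let ?n1 = "grk TYPE('a)" and ?n2 = "grk TYPE('b)" and ?\<tau> = "tensor_cocycle \<tau>1 \<tau>2"
  obtain coord1 coord2 where l1: "lattice ?n1 (coord1 :: 'a \<Rightarrow> _)" and l2: "lattice ?n2 (coord2 :: 'b \<Rightarrow> _)"
    using free_fg_ab_lattice[OF assms(1)] free_fg_ab_lattice[OF assms(2)] by blast
  have tl1: "twisted_lattice ?n1 coord1 \<tau>1" and tl2: "twisted_lattice ?n2 coord2 \<tau>2"
    using l1 l2 assms(3,4) by (simp_all add: twisted_lattice_def cocycle_def)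
  interpret C1: cocycle \<tau>1 by standard (rule assms(3))
  interpret C2: cocycle \<tau>2 by standard (rule assms(4))
  interpret P: cocycle ?\<tau> by standard (rule two_cocycle_tensor[OF assms(3,4)])
  interpret Q: cocycle "tensor_cocycle \<tau>2 \<tau>1" by standard (rule two_cocycle_tensor[OF assms(4,3)])
  obtain X1 where X1: "indep X1" "C1.isotropic X1" "tga_kdim \<tau>1 = enat (card X1)"
    "\<And>Y. indep Y \<Longrightarrow> C1.isotropic Y \<Longrightarrow> card Y \<le> card X1"
    using tga_kdim_eq_max_isotropic[OF l1 assms(3)] by blast
  obtain X2 where X2: "indep X2" "C2.isotropic X2" "tga_kdim \<tau>2 = enat (card X2)"
    "\<And>Y. indep Y \<Longrightarrow> C2.isotropic Y \<Longrightarrow> card Y \<le> card X2"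
    using tga_kdim_eq_max_isotropic[OF l2 assms(4)] by blast
  obtain X where X: "indep X" "P.isotropic X" "tga_kdim ?\<tau> = enat (card X)"
    using tga_kdim_eq_max_isotropic[OF lattice_product[OF l1 l2] two_cocycle_tensor[OF assms(3,4)]] by blast
  \<comment> \<open>\<open>tga_codim\<close> is a truncated difference; a value of at least 2
    excludes truncation.\<close>
  have r1: "card X1 + 2 \<le> ?n1" "2 \<le> card X1"
    using assms(5,7) by (auto simp: tga_codim_def X1(3) numeral_eq_enat)
  have r2: "card X2 + 2 \<le> ?n2" "2 \<le> card X2"
    using assms(6,8) by (auto simp: tga_codim_def X2(3) numeral_eq_enat)
  have b1: "card X + 2 \<le> card X1 + ?n2"
    by (rule isotropic_product_bound[OF tl1 tl2 X(1,2) X1(4) X2(4) r2(1) X2(1,2) r2(2)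
          C2.center_is_F_nondegenerate[OF assms(10)]])
  \<comment> \<open>The bound treats the two factors differently, so it is applied again after
    exchanging them.\<close>
  let ?X = "prod.swap ` X"
  have swap: "indep ?X" "card ?X = card X"
    by (rule indep_image[OF _ X(1)]; auto simp: prod_eq_iff)+
  have "Q.isotropic ?X" unfolding Q.isotropic_def Q.commute_def
  proof (intro ballI)
    fix p q assume "p \<in> ?X" "q \<in> ?X"
    then obtain x y where xy: "x \<in> X" "p = prod.swap x" "y \<in> X" "q = prod.swap y" by blast
    then have "?\<tau> x y = ?\<tau> y x" using X(2) unfolding P.isotropic_def P.commute_def by blast
    then show "tensor_cocycle \<tau>2 \<tau>1 p q = tensor_cocycle \<tau>2 \<tau>1 q p"
      unfolding xy by (cases x; cases y) (simp add: tensor_cocycle_def mult.commute)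
  qed
  then have b2: "card X + 2 \<le> card X2 + ?n1"
    using isotropic_product_bound[OF tl2 tl1 swap(1) _ X2(4) X1(4) r1(1) X1(1,2) r1(2)
          C1.center_is_F_nondegenerate[OF assms(9)]] swap(2) by simp
  \<comment> \<open>All dimensions are finite, and the \<open>+ 2\<close> in \<open>b1\<close> and
    \<open>b2\<close> is strictness together with the subtraction of 1.\<close>
  show ?thesis using b1 b2 unfolding X(3) X1(3) X2(3) by (auto simp: one_enat_def min_def)
qed

end
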